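(* Let $C$ be a non-singular tropical curve in a non-singular projective tropical toric surface $\mathbb{T}\mathbb{P}_\Sigma$. Then the set of all multi-bridges on $C$ spans the $\mathbb{Z}_2$-vector space $\mathrm{Div}(C)$. Moreover, if every primitive cycle of $C$ has at most two edges of each possible direction modulo $2$, then the set of all multi-bridges forms a basis of $\mathrm{Div}(C)$.
   Context: **Tropical curves.** A tropical polynomial is $P(x,y)=\max_{(i,j)\in A}(a_{i,j}+ix+jy)$ with $A\subset(\mathbb{Z}_{\ge 0})^2$ finite; its tropical curve in $\mathbb{R}^2$ is the locus where the maximum is attained at least twice, $\Delta=\mathrm{Conv}\{(i,j): a_{i,j}\neq-\infty\}$ is its Newton polygon, and the dual subdivision $\Delta_C$ of $\Delta$ has faces $F^\vee=\mathrm{Conv}\{(i,j): P(x_0,y_0)=a_{i,j}+ix_0+jy_0\}$ for $F$ a cell of the decomposition of $\mathbb{R}^2$ induced by the curve, $(x_0,y_0)$ in its relative interior. The curve is non-singular if $\Delta_C$ is a triangulation with all triangles of area $1/2$. $\Sigma$ is the fan dual to $\Delta$, assumed complete and unimodular; $\mathbb{T}\mathbb{P}_\Sigma$ is the corresponding tropical toric surface, a compactification of $\mathbb{R}^2$ whose strata correspond to faces of $\Delta$. A non-singular tropical curve $C$ in $\mathbb{T}\mathbb{P}_\Sigma$ is the compactification of such a curve, each unbounded edge receiving a 1-valent vertex on the boundary. $\mathrm{Edge}^0(C)$ is the set of edges bounded in $\mathbb{R}^2$. A primitive cycle is a cycle of $C$ bounding a component of $\mathbb{T}\mathbb{P}_\Sigma\setminus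 C$. **Configurations of twists.** Subsets of $\mathrm{Edge}^0(C)$ are identified with vectors of $\mathbb{Z}_2^{|\mathrm{Edge}^0(C)|}$ (sum = symmetric difference). For an edge $e$, $\overrightarrow{e}\in\mathbb{Z}_2^2$ is its direction modulo 2. A subset $T\subset\mathrm{Edge}^0(C)$ is admissible if $\sum_{e\in\gamma\cap T}\overrightarrow{e}=0\in\mathbb{Z}_2^2$ for every cycle $\gamma$ of $C$; an admissible $T$ is dividing if $|\gamma\cap T|$ is even for every cycle $\gamma$ of $C$. $\mathrm{Div}(C)$ is the $\mathbb{Z}_2$-vector space of dividing sets. A multi-bridge on $C$ is a dividing set $B$ of bounded edges with common direction modulo 2 such that $C\setminus B$ is disconnected and, for every proper subset $B'\subsetneq B$, $C\setminus B'$ is connected (here edges are removed without their endpoints). *)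

theory Defs
  imports
    "HOL-Analysis.Analysis"
    "HOL-Library.Z2"
    "HOL-Library.Function_Algebras"
begin

section \<open>Tropical polynomials and their curves in the plane\<close>

type_synonym plane = "real \<times> real"

text \<open>A tropical polynomial is a partial map from exponents to real coefficients. Its domain is the
  finite set of exponents; being undefined at an exponent means having coefficient minus infinity.\<close>

type_synonym tpoly = "nat \<times> nat \<rightharpoonup> real"

definition pt :: "nat \<times> nat \<Rightarrow> plane" where
  "pt m = (real (fst m), real (snd m))"

definition monomial :: "tpoly \<Rightarrow> nat \<times> nat \<Rightarrow> plane \<Rightarrow> real" where
  "monomial P m x = the (P m) + real (fst m) * fst x + real (snd m) * snd x"

definition tropical_eval :: "tpoly \<Rightarrow> plane \<Rightarrow> real" where
  "tropical_eval P x = Max ((\<lambda>m. monomial P m x) ` dom P)"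

definition attained :: "tpoly \<Rightarrow> plane \<Rightarrow> (nat \<times> nat) set" where
  "attained P x = {m \<in> dom P. monomial P m x = tropical_eval P x}"

definition planar_curve :: "tpoly \<Rightarrow> plane set" where
  "planar_curve P = {x. 2 \<le> card (attained P x)}"

definition newton_polygon :: "tpoly \<Rightarrow> plane set" where
  "newton_polygon P = convex hull (pt ` dom P)"

text \<open>The relative interior of the cell, in the decomposition of the plane induced by the curve,
  that contains \<open>x\<close> in its relative interior.\<close>

definition open_cell :: "tpoly \<Rightarrow> plane \<Rightarrow> plane set" where
  "open_cell P x = {y. attained P y = attained P x}"

definition dual_subdivision :: "tpoly \<Rightarrow> plane set set" where
  "dual_subdivision P = {convex hull (pt ` attained P x) | x. True}"

definition nonsingular :: "tpoly \<Rightarrow> bool" where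
  "nonsingular P \<longleftrightarrow> triangulation (dual_subdivision P) \<and>
     (\<forall>T \<in> dual_subdivision P. aff_dim T = 2 \<longrightarrow> measure lebesgue T = 1/2)"

text \<open>Edges are open cells, that is, they do not contain their endpoints.\<close>

definition edges :: "tpoly \<Rightarrow> plane set set" where
  "edges P = {open_cell P x | x. aff_dim (open_cell P x) = 1}"

definition bounded_edges :: "tpoly \<Rightarrow> plane set set" where
  "bounded_edges P = {e \<in> edges P. bounded e}"

text \<open>Direction modulo 2. The primitive integer direction of an edge is unique up to sign,
  hence its reduction modulo 2 is unique.\<close>

definition edge_dir :: "plane set \<Rightarrow> bit \<times> bit" where
  "edge_dir e = (THE w. \<exists>p q :: int. coprime p q \<and>
     (\<forall>x\<in>e. \<forall>y\<in>e. y - x \<in> span {(real_of_int p, real_of_int q)}) \<and>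
     w = (of_int p, of_int q))"


section \<open>Fans\<close>

definition lattice :: "plane set" where
  "lattice = {(real_of_int p, real_of_int q) | p q. True}"

text \<open>With the max convention, the dual fan of a polygon consists of its outer normal cones.\<close>

definition normal_cone :: "plane set \<Rightarrow> plane set \<Rightarrow> plane set" where
  "normal_cone D F = {u. \<forall>x\<in>F. \<forall>y\<in>D. u \<bullet> y \<le> u \<bullet> x}"

definition dual_fan :: "plane set \<Rightarrow> plane set set" where
  "dual_fan D = {normal_cone D F | F. F face_of D \<and> F \<noteq> {}}"

definition complete_fan :: "plane set set \<Rightarrow> bool" where
  "complete_fan \<Sigma> \<longleftrightarrow> \<Union>\<Sigma> = UNIV"

text \<open>Every cone is generated by part of a basis of the lattice. Two vectors that generate the
  lattice form a basis of it. A cone of this form is strongly convex, so for a dual fan the condition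
  forces the polygon to be two-dimensional.\<close>

definition unimodular_fan :: "plane set set \<Rightarrow> bool" where
  "unimodular_fan \<Sigma> \<longleftrightarrow>
     (\<forall>\<sigma>\<in>\<Sigma>. \<exists>b c. lattice = {of_int k *\<^sub>R b + of_int l *\<^sub>R c | k l :: int. True} \<and>
        (\<exists>S \<subseteq> {b, c}. \<sigma> = convex_cone hull S))"


section \<open>The tropical toric surface of a fan\<close>

text \<open>The surface is the disjoint union, over the cones \<open>\<sigma>\<close>, of the quotients of the plane by
  \<open>span \<sigma>\<close>. A point is encoded as a cone together with a coset of its span.\<close>

type_synonym tpoint = "plane set \<times> plane set"

definition toric_points :: "plane set set \<Rightarrow> tpoint set" where
  "toric_points \<Sigma> = {(\<sigma>, (\<lambda>v. x + v) ` span \<sigma>) | \<sigma> x. \<sigma> \<in> \<Sigma>}"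

definition chart :: "plane set set \<Rightarrow> plane set \<Rightarrow> tpoint set" where
  "chart \<Sigma> \<sigma> = {p \<in> toric_points \<Sigma>. fst p face_of \<sigma>}"

text \<open>Exponents of the monomials that stay bounded above in the directions of \<open>\<sigma>\<close>. Since
  addition is tropical multiplication and the missing value is minus infinity, this is minus the usual
  dual cone.\<close>

definition chart_monomials :: "plane set \<Rightarrow> plane set" where
  "chart_monomials \<sigma> = {m \<in> lattice. \<forall>u\<in>\<sigma>. m \<bullet> u \<le> 0}"

text \<open>The value of a monomial at a point of a stratum. In the first case \<open>m\<close> is orthogonal to
  \<open>span \<tau>\<close>, so the value does not depend on the representative of the coset.\<close>

definition monomial_value :: "tpoint \<Rightarrow> plane \<Rightarrow> ereal" where
  "monomial_value p m =
     (if \<forall>u \<in> fst p. m \<bullet> u = 0 then ereal (m \<bullet> (SOME x. x \<in> snd p)) else - \<infinity>)"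

text \<open>The affine chart of \<open>\<sigma>\<close> carries the coarsest topology making its monomials continuous as
  functions with values in the tropical numbers, and the surface is obtained by gluing the charts.\<close>

definition chart_topology :: "plane set set \<Rightarrow> plane set \<Rightarrow> tpoint topology" where
  "chart_topology \<Sigma> \<sigma> =
     pullback_topology (chart \<Sigma> \<sigma>) (\<lambda>p. restrict (monomial_value p) (chart_monomials \<sigma>))
       (product_topology (\<lambda>_. euclidean) (chart_monomials \<sigma>))"

definition toric_surface :: "plane set set \<Rightarrow> tpoint topology" where
  "toric_surface \<Sigma> = topology (\<lambda>U. U \<subseteq> toric_points \<Sigma> \<and>
     (\<forall>\<sigma>\<in>\<Sigma>. openin (chart_topology \<Sigma> \<sigma>) (U \<inter> chart \<Sigma> \<sigma>)))"

lemma openin_toric_surface: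
  "openin (toric_surface \<Sigma>) U \<longleftrightarrow> U \<subseteq> toric_points \<Sigma> \<and>
     (\<forall>\<sigma>\<in>\<Sigma>. openin (chart_topology \<Sigma> \<sigma>) (U \<inter> chart \<Sigma> \<sigma>))"
proof -
  have "istopology (\<lambda>U. U \<subseteq> toric_points \<Sigma> \<and>
     (\<forall>\<sigma>\<in>\<Sigma>. openin (chart_topology \<Sigma> \<sigma>) (U \<inter> chart \<Sigma> \<sigma>)))"
    unfolding istopology_def
  proof (intro conjI allI impI ballI)
    fix S T \<sigma>
    assume "S \<subseteq> toric_points \<Sigma> \<and> (\<forall>\<sigma>\<in>\<Sigma>. openin (chart_topology \<Sigma> \<sigma>) (S \<inter> chart \<Sigma> \<sigma>))"
      and "T \<subseteq> toric_points \<Sigma> \<and> (\<forall>\<sigma>\<in>\<Sigma>. openin (chart_topology \<Sigma> \<sigma>) (T \<inter> chart \<Sigma> \<sigma>))"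
      and "\<sigma> \<in> \<Sigma>"
    then have "openin (chart_topology \<Sigma> \<sigma>) ((S \<inter> chart \<Sigma> \<sigma>) \<inter> (T \<inter> chart \<Sigma> \<sigma>))"
      by (intro openin_Int[of _ "S \<inter> chart \<Sigma> \<sigma>" "T \<inter> chart \<Sigma> \<sigma>"]) simp_all
    moreover have "(S \<inter> chart \<Sigma> \<sigma>) \<inter> (T \<inter> chart \<Sigma> \<sigma>) = S \<inter> T \<inter> chart \<Sigma> \<sigma>"
      by blast
    ultimately show "openin (chart_topology \<Sigma> \<sigma>) (S \<inter> T \<inter> chart \<Sigma> \<sigma>)"
      by simp
  next
    fix \<K> \<sigma>
    assume "\<forall>K\<in>\<K>. K \<subseteq> toric_points \<Sigma> \<and>
        (\<forall>\<sigma>\<in>\<Sigma>. openin (chart_topology \<Sigma> \<sigma>) (K \<inter> chart \<Sigma> \<sigma>))"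
      and "\<sigma> \<in> \<Sigma>"
    then have "openin (chart_topology \<Sigma> \<sigma>) (\<Union> ((\<lambda>K. K \<inter> chart \<Sigma> \<sigma>) ` \<K>))"
      by (intro openin_Union) auto
    moreover have "\<Union> ((\<lambda>K. K \<inter> chart \<Sigma> \<sigma>) ` \<K>) = \<Union>\<K> \<inter> chart \<Sigma> \<sigma>"
      by blast
    ultimately show "openin (chart_topology \<Sigma> \<sigma>) (\<Union>\<K> \<inter> chart \<Sigma> \<sigma>)"
      by simp
  qed auto
  then show ?thesis
    by (simp add: toric_surface_def topology_inverse')
qed

text \<open>The inclusion of the plane as the dense stratum, the one of the cone \<open>{0}\<close>.\<close>

definition embed :: "plane \<Rightarrow> tpoint" where
  "embed x = ({0}, {x})"


section \<open>Compactified tropical curves\<close>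

definition fan_of :: "tpoly \<Rightarrow> plane set set" where
  "fan_of P = dual_fan (newton_polygon P)"

abbreviation surface_of :: "tpoly \<Rightarrow> tpoint topology" where
  "surface_of P \<equiv> toric_surface (fan_of P)"

definition curve :: "tpoly \<Rightarrow> tpoint set" where
  "curve P = surface_of P closure_of (embed ` planar_curve P)"

definition closed_edge :: "tpoly \<Rightarrow> plane set \<Rightarrow> tpoint set" where
  "closed_edge P e = surface_of P closure_of (embed ` e)"

text \<open>The two end vertices of an edge. For an unbounded edge one of them is its 1-valent vertex on the
  boundary of the surface.\<close>

definition edge_ends :: "tpoly \<Rightarrow> plane set \<Rightarrow> tpoint set" where
  "edge_ends P e = closed_edge P e - embed ` e"

text \<open>Cycles are simple closed paths in the graph, encoded by their sets of edges.\<close>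

definition cycle :: "tpoly \<Rightarrow> plane set set \<Rightarrow> bool" where
  "cycle P \<gamma> \<longleftrightarrow>
     (\<exists>(n::nat) v e. 0 < n \<and> inj_on v {..<n} \<and> inj_on e {..<n} \<and> e ` {..<n} = \<gamma> \<and>
        (\<forall>i<n. e i \<in> edges P \<and> edge_ends P (e i) = {v i, v (Suc i mod n)}))"

definition primitive_cycle :: "tpoly \<Rightarrow> plane set set \<Rightarrow> bool" where
  "primitive_cycle P \<gamma> \<longleftrightarrow> cycle P \<gamma> \<and>
     (\<exists>U \<in> connected_components_of (subtopology (surface_of P) (- curve P)).
        surface_of P frontier_of U = (\<Union>e\<in>\<gamma>. closed_edge P e))"


section \<open>Configurations of twists\<close>

definition admissible :: "tpoly \<Rightarrow> plane set set \<Rightarrow> bool" where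
  "admissible P T \<longleftrightarrow> T \<subseteq> bounded_edges P \<and>
     (\<forall>\<gamma>. cycle P \<gamma> \<longrightarrow> (\<Sum>e \<in> \<gamma> \<inter> T. edge_dir e) = 0)"

definition dividing :: "tpoly \<Rightarrow> plane set set \<Rightarrow> bool" where
  "dividing P T \<longleftrightarrow> admissible P T \<and> (\<forall>\<gamma>. cycle P \<gamma> \<longrightarrow> even (card (\<gamma> \<inter> T)))"

definition remove_edges :: "tpoly \<Rightarrow> plane set set \<Rightarrow> tpoint set" where
  "remove_edges P B = curve P - (\<Union>e\<in>B. embed ` e)"

definition multi_bridge :: "tpoly \<Rightarrow> plane set set \<Rightarrow> bool" where
  "multi_bridge P B \<longleftrightarrow> dividing P B \<and> (\<exists>w. \<forall>e\<in>B. edge_dir e = w) \<and>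
     \<not> connectedin (surface_of P) (remove_edges P B) \<and>
     (\<forall>B'. B' \<subset> B \<longrightarrow> connectedin (surface_of P) (remove_edges P B'))"

text \<open>A set of edges is identified with its indicator function, with values in the field \<open>bit\<close>;
  the sum of functions then corresponds to the symmetric difference.\<close>

definition set_vec :: "plane set set \<Rightarrow> plane set \<Rightarrow> bit" where
  "set_vec T = indicator T"

definition scale2 :: "bit \<Rightarrow> ('e \<Rightarrow> bit) \<Rightarrow> 'e \<Rightarrow> bit" where
  "scale2 c f = (\<lambda>e. c * f e)"

global_interpretation F2: vector_space "scale2 :: bit \<Rightarrow> ('e \<Rightarrow> bit) \<Rightarrow> 'e \<Rightarrow> bit"
  by unfold_locales (auto simp: scale2_def fun_eq_iff algebra_simps)

definition Div :: "tpoly \<Rightarrow> (plane set \<Rightarrow> bit) set" where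
  "Div P = set_vec ` {T. dividing P T}"

definition multi_bridges :: "tpoly \<Rightarrow> (plane set \<Rightarrow> bit) set" where
  "multi_bridges P = set_vec ` {B. multi_bridge P B}"

end

theory Submission
  imports Defs
begin

text \<open>The three nonzero directions modulo 2 add up to zero. Therefore a set of bounded edges is dividing
  iff each of its direction classes meets every cycle in an even number of edges
  (\<open>even_direction_classes\<close>, \<open>dividing_iff\<close>), and sets that meet every cycle evenly are the cuts of the
  curve, seen as a graph. Multi-bridges are the minimal cuts with edges of a single direction. So the
  first claim is the fact that every cut is a disjoint union of minimal ones: a nonempty direction class
  disconnects the curve (\<open>even_set_disconnects\<close>), a minimal disconnecting subset of it again meets
  every cycle evenly (\<open>minimal_disconnecting_even\<close>), so it is a multi-bridge, and what remains after
  its removal is a smaller dividing set.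

  For the second claim it suffices that distinct multi-bridges \<open>B\<close> and \<open>B'\<close> are disjoint
  (\<open>multi_bridges_disjoint\<close>). Suppose that they share an edge. The boundary of a bounded region of the
  complement of the curve is a primitive cycle (\<open>region_boundary_primitive\<close>). It meets \<open>B\<close> evenly and
  has at most two edges of the direction of \<open>B\<close>, so it contains either no edge of \<open>B\<close> or two, which are
  then all its edges of this direction; the same holds for \<open>B'\<close>. Hence it meets \<open>B \<inter> B'\<close> in none or two
  edges. By the Jordan curve theorem, every cycle that contains a bounded edge is the sum modulo 2 of
  the boundaries of the regions inside of it, so \<open>B \<inter> B'\<close> meets every cycle evenly
  (\<open>even_on_cycles\<close>). It is nonempty and therefore disconnects the curve, and minimality of \<open>B\<close> and of
  \<open>B'\<close> gives \<open>B = B \<inter> B' = B'\<close>.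

  Multi-bridges are defined by connectedness in the toric surface, so the topology of the compactified
  curve has to be related to the graph. The points of the curve are classified by the exponents attained
  there, which are one, two or three non-collinear ones (\<open>attained_cases\<close>), and the edges are segments
  or rays (\<open>edge_cases\<close>). The plane is open in the surface (\<open>openin_embed\<close>), compact subsets of it stay
  closed (\<open>closedin_embed_compact\<close>), and different unbounded edges have no common point at infinity
  (\<open>closed_edges_meet_in_plane\<close>). Finally, the curve is connected (\<open>connected_curve\<close>), since otherwise
  the plane would not be. Completeness and unimodularity of the fan give a two-dimensional Newton
  polygon (\<open>nonsingular_curveI\<close>), which excludes edges that are whole lines.\<close>


section \<open>Areas of lattice triangles\<close>

abbreviation of_cart :: "real ^ 2 \<Rightarrow> plane" where
  "of_cart v \<equiv> (v $ 1, v $ 2)"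

text \<open>This carries the area formula for triangles over from vectors indexed by a two-element type to
  pairs.\<close>

lemma lborel_of_cart: "distr lborel borel of_cart = lborel"
proof (rule lborel_eqI[symmetric])
  fix l u :: plane
  assume "\<And>b. b \<in> Basis \<Longrightarrow> l \<bullet> b \<le> u \<bullet> b"
  from this[of "(1,0)"] this[of "(0,1)"] have lu: "fst l \<le> fst u" "snd l \<le> snd u"
    by (simp_all add: Basis_prod_def inner_prod_def)
  have meas: "of_cart \<in> borel_measurable borel"
    by (intro borel_measurable_continuous_onI continuous_intros)
  have pre: "of_cart -` box l u = box (vector [fst l, snd l]) (vector [fst u, snd u])"
    by (auto simp: box_def Basis_prod_def Basis_vec_def inner_prod_def inner_axis forall_2)
  have "emeasure (distr lborel borel of_cart) (box l u) =
        emeasure lborel (box (vector [fst l, snd l] :: real^2) (vector [fst u, snd u]))"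
    using meas by (simp add: emeasure_distr pre)
  also have "\<dots> = (\<Prod>b\<in>Basis. ((vector [fst u, snd u] :: real^2) - vector [fst l, snd l]) \<bullet> b)"
  proof (intro emeasure_lborel_box)
    have "\<forall>i. (vector [fst l, snd l] :: real^2) $ i \<le> vector [fst u, snd u] $ i"
      using lu by (simp add: forall_2)
    then show "\<And>b. b \<in> Basis \<Longrightarrow> (vector [fst l, snd l] :: real^2) \<bullet> b \<le> vector [fst u, snd u] \<bullet> b"
      by (auto simp: Basis_vec_def inner_axis)
  qed
  also have "\<dots> = (\<Prod>b\<in>Basis. (u - l) \<bullet> b)"
  proof -
    have B: "(Basis :: (real^2) set) = {axis 1 1, axis 2 1}"
      by (auto simp: Basis_vec_def) (metis exhaust_2)
    have "axis 1 (1::real) \<noteq> (axis 2 1 :: real^2)"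
      by (simp add: axis_eq_axis)
    then have "(\<Prod>b\<in>Basis. f b) = f (axis 1 1) * f (axis 2 1)" for f :: "real^2 \<Rightarrow> real"
      unfolding B by simp
    then show ?thesis
      by (simp add: Basis_prod_def inner_axis inner_prod_def mult.commute)
  qed
  finally show "emeasure (distr lborel borel of_cart) (box l u) = (\<Prod>b\<in>Basis. (u - l) \<bullet> b)" .
qed simp

text \<open>The determinant of the two vectors, that is, the signed area of the parallelogram they span.\<close>

definition cross :: "plane \<Rightarrow> plane \<Rightarrow> real" where
  "cross u v = fst u * snd v - snd u * fst v"

lemma measure_triangle:
  "measure lebesgue (convex hull {a, b, c}) = \<bar>cross (b - a) (c - a)\<bar> / 2"
proof -
  define v :: "plane \<Rightarrow> real ^ 2" where "v x = vector [fst x, snd x]" for x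
  have v: "of_cart (v x) = x" for x by (simp add: v_def)
  have lin: "linear of_cart"
    by (rule linearI) auto
  have bij: "v (of_cart x) = x" for x
    by (simp add: v_def vec_eq_iff forall_2)
  have meas: "of_cart \<in> borel_measurable borel"
    by (intro borel_measurable_continuous_onI continuous_intros)
  have comp: "compact (convex hull {a, b, c})"
    by (intro finite_imp_compact_convex_hull) auto
  then have "measure lebesgue (convex hull {a, b, c}) = measure lborel (convex hull {a, b, c})"
    by (intro measure_completion) (auto dest: compact_imp_closed)
  also have "\<dots> = measure (distr lborel borel of_cart) (convex hull {a, b, c})"
    by (simp only: lborel_of_cart)
  also have "\<dots> = measure lborel (of_cart -` (convex hull {a, b, c}))"
    using comp meas by (subst measure_distr) (auto dest: compact_imp_closed)
  also have "of_cart -` (convex hull {a, b, c}) = convex hull {v a, v b, v c}"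
  proof -
    have "convex hull {a, b, c} = of_cart ` (convex hull {v a, v b, v c})"
      by (simp add: convex_hull_linear_image[OF lin] v)
    then show ?thesis
      using bij by (auto simp: image_iff) (metis bij)
  qed
  also have "measure lborel \<dots> = \<bar>cross (b - a) (c - a)\<bar> / 2"
    by (subst content_triangle) (simp add: v_def cross_def abs_minus_commute mult.commute)
  finally show ?thesis .
qed


section \<open>Local structure of a tropical curve\<close>

text \<open>Rotation by a right angle: it turns the determinant into an inner product, so that
  \<open>cross w z = 0\<close> becomes orthogonality to a vector.\<close>

definition rot :: "plane \<Rightarrow> plane" where
  "rot w = (- snd w, fst w)"

lemma inner_rot: "rot w \<bullet> z = cross w z"
  by (simp add: rot_def cross_def inner_prod_def)

lemma rot_eq_0_iff [simp]: "rot w = 0 \<longleftrightarrow> w = 0"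
  by (cases w) (auto simp: rot_def zero_prod_def)

lemma pt_inject [simp]: "pt a = pt b \<longleftrightarrow> a = b"
  by (cases a; cases b) (auto simp: pt_def)

text \<open>Twice the signed area of a triangle of exponents; it vanishes iff the exponents are collinear.\<close>

abbreviation orient :: "nat \<times> nat \<Rightarrow> nat \<times> nat \<Rightarrow> nat \<times> nat \<Rightarrow> real" where
  "orient a b c \<equiv> cross (pt b - pt a) (pt c - pt a)"

text \<open>The attained exponents whose monomials grow fastest in direction \<open>d\<close>. They are the
  exponents attained after a small step in that direction.\<close>

abbreviation leading :: "tpoly \<Rightarrow> plane \<Rightarrow> plane \<Rightarrow> (nat \<times> nat) set" where
  "leading P x d \<equiv> {a \<in> attained P x. \<forall>b\<in>attained P x. pt b \<bullet> d \<le> pt a \<bullet> d}"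

lemma monomial_eq: "monomial P m x = the (P m) + pt m \<bullet> x"
  by (simp add: monomial_def pt_def inner_prod_def)

lemma monomial_add: "monomial P m (x + d) = monomial P m x + pt m \<bullet> d"
  by (simp add: monomial_eq inner_add_right)

lemma monomial_scale: "monomial P m (x + s *\<^sub>R d) = monomial P m x + s * (d \<bullet> pt m)"
  by (simp add: monomial_eq inner_add_right inner_commute)

lemma continuous_on_monomial: "continuous_on S (monomial P m)"
  unfolding monomial_eq by (intro continuous_intros)

lemma orthogonal_line:
  fixes w d z :: plane
  assumes "w \<noteq> 0" "d \<noteq> 0" "d \<bullet> w = 0" "z \<bullet> w = 0"
  obtains s where "z = s *\<^sub>R d"
proof -
  have *: "fst d * fst w + snd d * snd w = 0" "fst z * fst w + snd z * snd w = 0"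
    using assms by (simp_all add: inner_prod_def)
  have c: "fst z * snd d = snd z * fst d"
  proof -
    have "(fst z * snd d - snd z * fst d) * fst w = 0" "(fst z * snd d - snd z * fst d) * snd w = 0"
      using * by algebra+
    moreover have "fst w \<noteq> 0 \<or> snd w \<noteq> 0"
      using assms(1) by (auto simp: prod_eq_iff)
    ultimately show ?thesis by auto
  qed
  have "fst d \<noteq> 0 \<or> snd d \<noteq> 0"
    using assms(2) by (auto simp: prod_eq_iff)
  then show thesis
  proof
    assume "fst d \<noteq> 0"
    then have "z = (fst z / fst d) *\<^sub>R d"
      using c by (auto simp: prod_eq_iff field_simps)
    then show thesis by (rule that)
  next
    assume "snd d \<noteq> 0"
    then have "z = (snd z / snd d) *\<^sub>R d"
      using c by (auto simp: prod_eq_iff field_simps)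
    then show thesis by (rule that)
  qed
qed

lemma orthogonal_cross:
  fixes w d z :: plane
  assumes "d \<noteq> 0" "d \<bullet> w = 0" "d \<bullet> z = 0"
  shows "cross w z = 0"
proof -
  have *: "fst d * fst w + snd d * snd w = 0" "fst d * fst z + snd d * snd z = 0"
    using assms by (simp_all add: inner_prod_def)
  have "fst d * cross w z = 0" "snd d * cross w z = 0"
    using * unfolding cross_def by algebra+
  moreover have "fst d \<noteq> 0 \<or> snd d \<noteq> 0"
    using assms(1) by (auto simp: prod_eq_iff)
  ultimately show ?thesis by auto
qed

text \<open>The assumption \<open>full\<close> says that no nonzero linear functional is constant on the exponents, that
  is, the Newton polygon is two-dimensional.\<close>

locale tropical_curve =
  fixes P :: tpoly
  assumes fin: "finite (dom P)" and ne: "dom P \<noteq> {}"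
    and full: "\<And>d a. d \<noteq> 0 \<Longrightarrow> a \<in> dom P \<Longrightarrow> \<exists>k\<in>dom P. d \<bullet> (pt k - pt a) \<noteq> 0"
begin

lemma attained_iff:
  "m \<in> attained P x \<longleftrightarrow> m \<in> dom P \<and> (\<forall>k\<in>dom P. monomial P k x \<le> monomial P m x)"
proof -
  let ?S = "(\<lambda>m. monomial P m x) ` dom P"
  have "finite ?S" "?S \<noteq> {}" using fin ne by auto
  then have "m \<in> dom P \<Longrightarrow> monomial P m x = Max ?S \<longleftrightarrow> (\<forall>k\<in>dom P. monomial P k x \<le> monomial P m x)"
    by (subst eq_commute, subst Max_eq_iff) auto
  then show ?thesis
    unfolding attained_def tropical_eval_def by blast
qed

lemma attained_subset: "attained P x \<subseteq> dom P"
  by (auto simp: attained_def)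

lemma finite_attained [simp]: "finite (attained P x)"
  using attained_subset fin finite_subset by blast

lemma attained_nonempty: "attained P x \<noteq> {}"
proof -
  let ?S = "(\<lambda>m. monomial P m x) ` dom P"
  have "Max ?S \<in> ?S" using fin ne by (intro Max_in) auto
  then obtain m where "m \<in> dom P" "monomial P m x = Max ?S"
    by (force simp del: Max_in)
  then have "m \<in> attained P x" by (simp add: attained_def tropical_eval_def)
  then show ?thesis by blast
qed

lemma attained_eqD:
  "a \<in> attained P x \<Longrightarrow> b \<in> attained P x \<Longrightarrow> monomial P a x = monomial P b x"
  by (auto simp: attained_def)

lemma attained_less:
  "a \<in> attained P x \<Longrightarrow> k \<in> dom P \<Longrightarrow> k \<notin> attained P x \<Longrightarrow> monomial P k x < monomial P a x"
  by (metis attained_iff dual_order.trans linorder_not_less)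

lemma attained_transfer:
  "a \<in> attained P x \<Longrightarrow> b \<in> dom P \<Longrightarrow> monomial P b x = monomial P a x \<Longrightarrow> b \<in> attained P x"
  by (simp add: attained_def)

text \<open>Near \<open>x\<close> the monomials that are not attained at \<open>x\<close> stay smaller, and two attained ones differ
  by a linear function of the displacement.\<close>

lemma attained_near:
  obtains r where "r > 0" and "\<And>y. y \<in> ball x r \<Longrightarrow> attained P y = leading P x (y - x)"
proof -
  obtain a0 where a0: "a0 \<in> attained P x" using attained_nonempty by blast
  define U where "U = (\<Inter>k\<in>dom P - attained P x. {y. monomial P k y < monomial P a0 y})"
  have "open U" unfolding U_def
    using fin by (intro open_INT ballI open_Collect_less continuous_on_monomial) auto
  moreover have "x \<in> U" using a0 by (auto simp: U_def attained_less)
  ultimately obtain r where r: "r > 0" "ball x r \<subseteq> U" by (auto elim: openE)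
  show thesis
  proof (rule that[OF r(1)])
    fix y assume "y \<in> ball x r"
    then have "y \<in> U" using r(2) by blast
    then have y: "monomial P k y < monomial P a0 y" if "k \<in> dom P" "k \<notin> attained P x" for k
      using that by (simp add: U_def del: split_paired_All)
    have le: "monomial P b y \<le> monomial P a y \<longleftrightarrow> pt b \<bullet> (y - x) \<le> pt a \<bullet> (y - x)"
      if "a \<in> attained P x" "b \<in> attained P x" for a b
      using attained_eqD[OF that] monomial_add[of P _ x "y - x"] by simp
    have sub: "attained P y \<subseteq> attained P x"
    proof
      fix k assume k: "k \<in> attained P y"
      then have "k \<in> dom P" "monomial P a0 y \<le> monomial P k y"
        using a0 attained_subset[of x] unfolding attained_iff[of _ y] by blast+
      then show "k \<in> attained P x" using y[of k] by fastforce
    qed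
    show "attained P y = leading P x (y - x)" (is "_ = ?R")
    proof
      show "attained P y \<subseteq> ?R"
      proof
        fix a assume a: "a \<in> attained P y"
        have "pt b \<bullet> (y - x) \<le> pt a \<bullet> (y - x)" if b: "b \<in> attained P x" for b
        proof -
          have "monomial P b y \<le> monomial P a y"
            using a b attained_subset unfolding attained_iff[of _ y] by blast
          then show ?thesis using le a b sub by blast
        qed
        then show "a \<in> ?R" using a sub by blast
      qed
      show "?R \<subseteq> attained P y"
      proof
        fix a assume a: "a \<in> ?R"
        have "monomial P k y \<le> monomial P a y" if "k \<in> dom P" for k
        proof (cases "k \<in> attained P x")
          case True then show ?thesis using a le by auto
        next
          case False
          then have "monomial P k y < monomial P a0 y" using y that by blast
          also have "\<dots> \<le> monomial P a y" using a a0 le by auto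
          finally show ?thesis by simp
        qed
        then show "a \<in> attained P y" using a attained_subset by (auto simp: attained_iff)
      qed
    qed
  qed
qed

lemma attained_near_subset:
  obtains r where "r > 0" "\<And>y. dist y x < r \<Longrightarrow> attained P y \<subseteq> attained P x"
proof -
  obtain r where r: "r > 0" "\<And>y. y \<in> ball x r \<Longrightarrow> attained P y = leading P x (y - x)"
    using attained_near by blast
  show thesis
  proof (rule that[OF r(1)])
    fix y assume "dist y x < r"
    then have "y \<in> ball x r" by (simp add: dist_commute)
    then show "attained P y \<subseteq> attained P x" using r(2) by blast
  qed
qed

lemma attained_near_dir:
  obtains r where "r > 0" and "\<And>s. 0 < s \<Longrightarrow> s < r \<Longrightarrow> attained P (x + s *\<^sub>R d) = leading P x d"
proof -
  obtain r where r: "r > 0" "\<And>y. y \<in> ball x r \<Longrightarrow> attained P y = leading P x (y - x)"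
    using attained_near by blast
  show thesis
  proof (rule that)
    show "r / (norm d + 1) > 0" using r(1) by (simp add: add_nonneg_pos)
    fix s assume s: "0 < s" "s < r / (norm d + 1)"
    moreover have "0 < norm d + 1" by (simp add: add_nonneg_pos)
    ultimately have "s * (norm d + 1) < r" by (simp only: pos_less_divide_eq)
    then have "s * norm d < r" using s(1) by (simp add: distrib_left)
    then have "x + s *\<^sub>R d \<in> ball x r" using s by (simp add: dist_norm)
    from r(2)[OF this] show "attained P (x + s *\<^sub>R d) = leading P x d"
      using s by simp
  qed
qed

text \<open>At a convex combination of two points where \<open>m\<close> is attained, the gap between \<open>m\<close> and another monomial
  is the convex combination of two nonnegative gaps, so it vanishes only if both do.\<close>

lemma attained_between:
  assumes m: "m \<in> attained P x" "m \<in> attained P y" and t: "0 < t" "t < 1"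
  shows "attained P ((1 - t) *\<^sub>R x + t *\<^sub>R y) = attained P x \<inter> attained P y"
proof -
  let ?z = "(1 - t) *\<^sub>R x + t *\<^sub>R y"
  have z: "monomial P k ?z = (1 - t) * monomial P k x + t * monomial P k y" for k
    by (simp add: monomial_eq inner_add_right algebra_simps)
  have le: "monomial P k ?z \<le> monomial P m ?z" if "k \<in> dom P" for k
    unfolding z using t m that by (intro add_mono mult_left_mono) (auto simp: attained_iff)
  have mz: "m \<in> attained P ?z" using le m(1) by (auto simp: attained_iff)
  have "k \<in> attained P ?z \<longleftrightarrow> k \<in> attained P x \<and> k \<in> attained P y" if k: "k \<in> dom P" for k
  proof
    assume "k \<in> attained P x \<and> k \<in> attained P y"
    then have "monomial P k ?z = monomial P m ?z"
      using m by (simp add: z attained_eqD[of k _ m])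
    then show "k \<in> attained P ?z" using attained_transfer mz k by blast
  next
    assume "k \<in> attained P ?z"
    then have eq: "monomial P k ?z = monomial P m ?z" using mz attained_eqD by blast
    have 1: "(1 - t) * monomial P k x \<le> (1 - t) * monomial P m x"
      and 2: "t * monomial P k y \<le> t * monomial P m y"
      using t m k by (auto intro!: mult_left_mono simp: attained_iff)
    have "(1 - t) * monomial P k x = (1 - t) * monomial P m x" "t * monomial P k y = t * monomial P m y"
      using eq 1 2 unfolding z by linarith+
    then show "k \<in> attained P x \<and> k \<in> attained P y"
      using t m k attained_transfer[of m _ k] by simp
  qed
  then show ?thesis using attained_subset by blast
qed

text \<open>Moving along a direction in which all attained monomials grow equally fast, nothing changes until
  the first faster monomial catches up. The time at which the monomial \<open>k\<close> catches up is called
  \<open>\<tau> k\<close> in the proof.\<close>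

lemma shoot:
  assumes const: "\<And>b. b \<in> attained P x \<Longrightarrow> d \<bullet> (pt b - pt a) = 0"
    and a: "a \<in> attained P x" and k0: "k0 \<in> dom P" "d \<bullet> (pt k0 - pt a) > 0"
  obtains t k where "t > 0" "k \<in> attained P (x + t *\<^sub>R d)" "d \<bullet> (pt k - pt a) > 0"
    "attained P x \<subseteq> attained P (x + t *\<^sub>R d)"
    "\<And>s. 0 \<le> s \<Longrightarrow> s < t \<Longrightarrow> attained P (x + s *\<^sub>R d) = attained P x"
proof -
  define K where "K = {k \<in> dom P. d \<bullet> (pt k - pt a) > 0}"
  define \<tau> where "\<tau> k = (monomial P a x - monomial P k x) / (d \<bullet> (pt k - pt a))" for k
  have K: "finite K" "K \<noteq> {}" using fin k0 unfolding K_def by (simp, metis (mono_tags, lifting) empty_iff mem_Collect_eq)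
  define t where "t = Min (\<tau> ` K)"
  have "t \<in> \<tau> ` K" using K by (auto simp: t_def)
  then obtain k where k: "k \<in> K" "t = \<tau> k" by blast
  have tmin: "t \<le> \<tau> j" if "j \<in> K" for j using K that by (auto simp: t_def)
  have Kx: "j \<notin> attained P x" if "j \<in> K" for j using that const[of j] by (auto simp: K_def)
  have pos: "\<tau> j > 0" if "j \<in> K" for j
    using that a Kx[OF that] by (auto simp: \<tau>_def K_def attained_less)
  have diff: "monomial P j (x + s *\<^sub>R d) - monomial P a (x + s *\<^sub>R d) =
      monomial P j x - monomial P a x + s * (d \<bullet> (pt j - pt a))" for j s
    by (simp add: monomial_scale inner_diff_right algebra_simps)
  have inK: "monomial P j (x + s *\<^sub>R d) - monomial P a (x + s *\<^sub>R d) = (s - \<tau> j) * (d \<bullet> (pt j - pt a))"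
    if "j \<in> K" for j s
    using that by (simp add: diff \<tau>_def K_def field_simps)
  have le: "monomial P j (x + s *\<^sub>R d) \<le> monomial P a (x + s *\<^sub>R d)"
    if "j \<in> dom P" "0 \<le> s" "s \<le> t" for j s
  proof (cases "j \<in> K")
    case True
    then have "(s - \<tau> j) * (d \<bullet> (pt j - pt a)) \<le> 0"
      using tmin[of j] that by (intro mult_nonpos_nonneg) (auto simp: K_def)
    then show ?thesis using inK[OF True, of s] by linarith
  next
    case False
    then have "s * (d \<bullet> (pt j - pt a)) \<le> 0"
      using that by (intro mult_nonneg_nonpos) (auto simp: K_def)
    moreover have "monomial P j x \<le> monomial P a x" using a that by (auto simp: attained_iff)
    ultimately show ?thesis using diff[of j s] by linarith
  qed
  have adom: "a \<in> dom P" using a attained_subset by blast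
  have a_att: "a \<in> attained P (x + s *\<^sub>R d)" if "0 \<le> s" "s \<le> t" for s
    using le that adom by (auto simp: attained_iff)
  have sub: "attained P x \<subseteq> attained P (x + s *\<^sub>R d)" if "0 \<le> s" "s \<le> t" for s
  proof
    fix b assume b: "b \<in> attained P x"
    then have "monomial P b (x + s *\<^sub>R d) = monomial P a (x + s *\<^sub>R d)"
      using diff[of b s] const[OF b] attained_eqD[OF a b] by simp
    then show "b \<in> attained P (x + s *\<^sub>R d)"
      using attained_transfer a_att[OF that] b attained_subset by blast
  qed
  have t0: "t > 0" using pos k by simp
  show thesis
  proof (rule that[OF t0, of k])
    have "monomial P k (x + t *\<^sub>R d) = monomial P a (x + t *\<^sub>R d)"
      using inK[of k t] k by simp
    then show "k \<in> attained P (x + t *\<^sub>R d)"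
      using attained_transfer[OF a_att[of t]] t0 k by (auto simp: K_def)
    show "d \<bullet> (pt k - pt a) > 0" using k by (simp add: K_def)
    show "attained P x \<subseteq> attained P (x + t *\<^sub>R d)" using sub t0 by simp
    fix s assume s: "0 \<le> s" "s < t"
    have "attained P (x + s *\<^sub>R d) \<subseteq> attained P x"
    proof
      fix j assume j: "j \<in> attained P (x + s *\<^sub>R d)"
      then have eq: "monomial P j (x + s *\<^sub>R d) = monomial P a (x + s *\<^sub>R d)"
        using s by (intro attained_eqD[OF _ a_att]) auto
      show "j \<in> attained P x"
      proof (cases "j \<in> K")
        case True
        then have "(s - \<tau> j) * (d \<bullet> (pt j - pt a)) < 0"
          using tmin[of j] s by (intro mult_neg_pos) (auto simp: K_def)
        then show ?thesis using inK[OF True, of s] eq by linarith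
      next
        case False
        have jd: "j \<in> dom P" using j attained_subset by blast
        have "s * (d \<bullet> (pt j - pt a)) \<le> 0"
          using False s jd by (intro mult_nonneg_nonpos) (auto simp: K_def)
        moreover have "monomial P j x \<le> monomial P a x" using a jd by (auto simp: attained_iff)
        ultimately have "monomial P j x = monomial P a x" using diff[of j s] eq by linarith
        then show ?thesis using attained_transfer a jd by blast
      qed
    qed
    then show "attained P (x + s *\<^sub>R d) = attained P x" using sub[of s] s by auto
  qed
qed

lemma shoot_forever:
  assumes const: "\<And>b. b \<in> attained P x \<Longrightarrow> d \<bullet> (pt b - pt a) = 0"
    and a: "a \<in> attained P x" and k0: "\<And>k. k \<in> dom P \<Longrightarrow> d \<bullet> (pt k - pt a) \<le> 0" and s: "0 \<le> s"
  shows "attained P (x + s *\<^sub>R d) = attained P x"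
proof -
  have diff: "monomial P j (x + s *\<^sub>R d) - monomial P a (x + s *\<^sub>R d) =
      monomial P j x - monomial P a x + s * (d \<bullet> (pt j - pt a))" for j
    by (simp add: monomial_scale inner_diff_right algebra_simps)
  have neg: "s * (d \<bullet> (pt j - pt a)) \<le> 0" if "j \<in> dom P" for j
    using k0[OF that] s by (intro mult_nonneg_nonpos)
  have le: "monomial P j x \<le> monomial P a x" if "j \<in> dom P" for j
    using a that by (auto simp: attained_iff)
  have adom: "a \<in> dom P" using a attained_subset by blast
  have a': "a \<in> attained P (x + s *\<^sub>R d)"
    using diff neg le adom unfolding attained_iff by (smt (verit))
  show ?thesis
  proof (intro set_eqI iffI)
    fix j assume j: "j \<in> attained P (x + s *\<^sub>R d)"
    then have jd: "j \<in> dom P" using attained_subset by blast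
    have "monomial P j x = monomial P a x"
      using diff[of j] neg[OF jd] le[OF jd] attained_eqD[OF j a'] by linarith
    then show "j \<in> attained P x" using attained_transfer a jd by blast
  next
    fix j assume j: "j \<in> attained P x"
    then have jd: "j \<in> dom P" using attained_subset by blast
    have "monomial P j (x + s *\<^sub>R d) = monomial P a (x + s *\<^sub>R d)"
      using diff[of j] const[OF j] attained_eqD[OF j a] by simp
    then show "j \<in> attained P (x + s *\<^sub>R d)" using attained_transfer a' jd by blast
  qed
qed

end

text \<open>The barycentric coordinates of a lattice point are quotients of integer determinants by the
  determinant of the triangle, so they are integers if the latter is \<open>1\<close> or \<open>-1\<close>.\<close>

lemma lattice_triangle_points:
  assumes cross1: "\<bar>cross (q - p) (r - p)\<bar> = 1"
    and int: "\<exists>a. p = pt a" "\<exists>a. q = pt a" "\<exists>a. r = pt a" "\<exists>a. z = pt a"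
    and z: "z \<in> convex hull {p, q, r}"
  shows "z \<in> {p, q, r}"
proof -
  obtain \<alpha> \<beta> \<gamma> where c: "0 \<le> \<alpha>" "0 \<le> \<beta>" "0 \<le> \<gamma>" "\<alpha> + \<beta> + \<gamma> = 1"
    "z = \<alpha> *\<^sub>R p + \<beta> *\<^sub>R q + \<gamma> *\<^sub>R r"
    using z unfolding convex_hull_3 by blast
  have a: "\<alpha> = 1 - \<beta> - \<gamma>" using c by simp
  have "cross (z - p) (r - p) = \<beta> * cross (q - p) (r - p)"
    "cross (q - p) (z - p) = \<gamma> * cross (q - p) (r - p)"
    unfolding c(5) a cross_def by (simp_all add: algebra_simps)
  moreover have "cross (u - v) (w - v) \<in> \<int>" if "\<exists>a. u = pt a" "\<exists>a. v = pt a" "\<exists>a. w = pt a" for u v w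
  proof -
    have "fst y \<in> \<int>" "snd y \<in> \<int>" if "\<exists>a. y = pt a" for y
      using that by (auto simp: pt_def)
    then show ?thesis
      using that unfolding cross_def by (intro Ints_diff Ints_mult) (simp_all add: Ints_diff)
  qed
  ultimately have \<beta>\<gamma>: "\<beta> * cross (q - p) (r - p) \<in> \<int>" "\<gamma> * cross (q - p) (r - p) \<in> \<int>"
    using int by metis+
  have "cross (q - p) (r - p) = 1 \<or> cross (q - p) (r - p) = -1"
    using cross1 by linarith
  then have "\<beta> \<in> \<int>" "\<gamma> \<in> \<int>"
    using \<beta>\<gamma> by (auto simp: minus_in_Ints_iff)
  then obtain i j :: int where ij: "\<beta> = of_int i" "\<gamma> = of_int j" by (auto elim!: Ints_cases)
  have "0 \<le> i" "0 \<le> j" "i + j \<le> 1" using c ij by linarith+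
  then have "(i = 0 \<and> j = 0) \<or> (i = 1 \<and> j = 0) \<or> (i = 0 \<and> j = 1)" by linarith
  then show ?thesis using c(5) a ij by auto
qed

locale nonsingular_curve = tropical_curve +
  assumes nonsing: "nonsingular P"
begin

text \<open>The three exponents make the dual cell two-dimensional. So it is a lattice triangle of area
  \<open>1/2\<close>, and it contains no exponent besides its vertices.\<close>

lemma attained_triangle:
  assumes abc: "a \<in> attained P x" "b \<in> attained P x" "c \<in> attained P x"
    and nc: "orient a b c \<noteq> 0"
  shows "attained P x = {a, b, c}"
proof -
  let ?A = "attained P x"
  define T where "T = convex hull (pt ` ?A)"
  have T: "T \<in> dual_subdivision P" unfolding T_def dual_subdivision_def
    by (intro CollectI exI[of _ x]) simp
  have dist: "a \<noteq> b" "a \<noteq> c" "b \<noteq> c" using nc by (auto simp: cross_def)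
  have "\<not> collinear {pt a, pt b, pt c}"
  proof
    assume "collinear {pt a, pt b, pt c}"
    then obtain u where u: "\<forall>v\<in>{pt a, pt b, pt c}. \<forall>w\<in>{pt a, pt b, pt c}. \<exists>s. v - w = s *\<^sub>R u"
      unfolding collinear_def ..
    obtain s where "pt b - pt a = s *\<^sub>R u" using u by fastforce
    moreover obtain t where "pt c - pt a = t *\<^sub>R u" using u by fastforce
    ultimately
    show False using nc by (simp add: cross_def)
  qed
  then have "\<not> aff_dim {pt a, pt b, pt c} \<le> 1"
    by (simp add: collinear_aff_dim)
  moreover have "aff_dim {pt a, pt b, pt c} \<le> aff_dim T"
    unfolding T_def aff_dim_convex_hull using abc by (intro aff_dim_subset) auto
  moreover have "aff_dim T \<le> 2"
    using aff_dim_le_DIM[of T] by simp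
  ultimately have dim: "aff_dim T = 2" by linarith
  then have area: "measure lebesgue T = 1/2" using nonsing T by (auto simp: nonsingular_def)
  obtain n where "n simplex T" using nonsing T by (auto simp: nonsingular_def triangulation_def)
  then obtain C where C: "\<not> affine_dependent C" "int (card C) = n + 1" "T = convex hull C"
    by (auto simp: simplex_def)
  have "n = 2" using C dim by (simp add: aff_dim_convex_hull aff_dim_affine_independent)
  then have "card C = 3" using C by simp
  then obtain p q r where pqr: "C = {p, q, r}" by (auto simp: card_3_iff)
  have CA: "C \<subseteq> pt ` ?A"
  proof
    fix z assume "z \<in> C"
    then have "z extreme_point_of (convex hull (pt ` ?A))"
      using C T_def extreme_point_of_convex_hull_affine_independent by metis
    then show "z \<in> pt ` ?A" by (rule extreme_point_of_convex_hull)
  qed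
  have "\<bar>cross (q - p) (r - p)\<bar> = 1"
    using area unfolding C(3) pqr measure_triangle by simp
  moreover have lat: "\<exists>m. z = pt m" if "z \<in> pt ` ?A" for z
    using that by blast
  moreover have "p \<in> pt ` ?A" "q \<in> pt ` ?A" "r \<in> pt ` ?A" using CA pqr by auto
  ultimately have "z \<in> C" if "z \<in> pt ` ?A" for z
    using lattice_triangle_points[of q p r z] that hull_inc[OF that, of convex]
    unfolding T_def[symmetric] C(3) pqr by metis
  then have "pt ` ?A \<subseteq> C" by (rule subsetI)
  then have "pt ` ?A = C" using CA by blast
  then have "card ?A = 3" using \<open>card C = 3\<close> card_image[of pt ?A] by (simp add: inj_on_def)
  moreover have "card {a, b, c} = 3" using dist by simp
  ultimately show ?thesis
    using abc by (intro card_subset_eq[symmetric]) auto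
qed

text \<open>Collinear attained exponents stay attained along a line. Where another monomial first joins them
  on this line, the attained exponents span a triangle, so there are exactly three of them.\<close>

lemma edge_end:
  assumes ab: "a \<in> attained P x" "b \<in> attained P x" "a \<noteq> b"
    and col: "\<And>c. c \<in> attained P x \<Longrightarrow> orient a b c = 0"
    and d: "d \<noteq> 0" "d \<bullet> (pt b - pt a) = 0" and k: "k \<in> dom P" "d \<bullet> (pt k - pt a) > 0"
  obtains t k where "t > 0" "attained P (x + t *\<^sub>R d) = {a, b, k}"
    "orient a b k \<noteq> 0"
    "\<And>s. 0 \<le> s \<Longrightarrow> s < t \<Longrightarrow> attained P (x + s *\<^sub>R d) = {a, b}"
proof -
  have w: "pt b - pt a \<noteq> 0" using ab by simp
  have orth: "d \<bullet> z = 0 \<longleftrightarrow> cross (pt b - pt a) z = 0" for z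
  proof
    show "d \<bullet> z = 0 \<Longrightarrow> cross (pt b - pt a) z = 0" using orthogonal_cross d by blast
    assume z: "cross (pt b - pt a) z = 0"
    obtain s where "d = s *\<^sub>R rot (pt b - pt a)"
    proof (rule orthogonal_line[of "pt b - pt a" "rot (pt b - pt a)" d])
      show "rot (pt b - pt a) \<bullet> (pt b - pt a) = 0" by (simp add: inner_rot cross_def)
    qed (use w d in auto)
    then show "d \<bullet> z = 0" using z by (simp add: inner_rot)
  qed
  have const: "\<And>c. c \<in> attained P x \<Longrightarrow> d \<bullet> (pt c - pt a) = 0" using col orth by blast
  obtain t j where t: "t > 0" "j \<in> attained P (x + t *\<^sub>R d)" "d \<bullet> (pt j - pt a) > 0"
    "attained P x \<subseteq> attained P (x + t *\<^sub>R d)"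
    "\<And>s. 0 \<le> s \<Longrightarrow> s < t \<Longrightarrow> attained P (x + s *\<^sub>R d) = attained P x"
    using shoot[OF const ab(1) k] by metis
  have nc: "orient a b j \<noteq> 0" using t(3) orth[of "pt j - pt a"] by auto
  have v: "attained P (x + t *\<^sub>R d) = {a, b, j}"
    using attained_triangle[OF _ _ t(2) nc] t(4) ab by blast
  have "j \<notin> attained P x" using col nc by blast
  then have "attained P x = {a, b}" using t(4) v ab by blast
  then show thesis using that[OF t(1) v nc] t(5) by blast
qed

lemma attained_pair:
  assumes ab: "a \<in> attained P x" "b \<in> attained P x" "a \<noteq> b"
    and col: "\<And>c. c \<in> attained P x \<Longrightarrow> orient a b c = 0"
  shows "attained P x = {a, b}"
proof -
  let ?d = "rot (pt b - pt a)"
  have d: "?d \<noteq> 0" "- ?d \<noteq> 0" using ab by auto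
  have o: "?d \<bullet> (pt b - pt a) = 0" "- ?d \<bullet> (pt b - pt a) = 0" by (simp_all add: inner_rot cross_def)
  obtain k where k: "k \<in> dom P" "?d \<bullet> (pt k - pt a) \<noteq> 0"
    using full[OF d(1)] ab(1) attained_subset by blast
  then consider "?d \<bullet> (pt k - pt a) > 0" | "- ?d \<bullet> (pt k - pt a) > 0" by fastforce
  then show ?thesis
  proof cases
    case 1
    from edge_end[OF ab col d(1) o(1) k(1) 1] obtain t where "t > 0"
      "\<And>s. 0 \<le> s \<Longrightarrow> s < t \<Longrightarrow> attained P (x + s *\<^sub>R ?d) = {a, b}" by metis
    then show ?thesis by (metis add.right_neutral order_refl scaleR_zero_left)
  next
    case 2
    from edge_end[OF ab col d(2) o(2) k(1) 2] obtain t where "t > 0"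
      "\<And>s. 0 \<le> s \<Longrightarrow> s < t \<Longrightarrow> attained P (x + s *\<^sub>R (- ?d)) = {a, b}" by metis
    then show ?thesis by (metis add.right_neutral order_refl scaleR_zero_left)
  qed
qed

lemma attained_cases:
  obtains (region) a where "attained P x = {a}"
  | (edge) a b where "attained P x = {a, b}" "a \<noteq> b"
  | (vertex) a b c where "attained P x = {a, b, c}" "orient a b c \<noteq> 0"
proof -
  obtain a where a: "a \<in> attained P x" using attained_nonempty by blast
  show thesis
  proof (cases "\<exists>b\<in>attained P x. b \<noteq> a")
    case False
    then show thesis using region[of a] a by blast
  next
    case True
    then obtain b where b: "b \<in> attained P x" "b \<noteq> a" by blast
    show thesis
    proof (cases "\<exists>c\<in>attained P x. orient a b c \<noteq> 0")
      case True
      then show thesis using attained_triangle[OF a b(1)] vertex by blast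
    next
      case False
      then show thesis using attained_pair[OF a b(1)] b edge by blast
    qed
  qed
qed

end


section \<open>Edges, vertices and regions\<close>

abbreviation open_ray :: "plane \<Rightarrow> plane \<Rightarrow> plane set" where
  "open_ray p u \<equiv> {p + s *\<^sub>R u | s. 0 < s}"

abbreviation closed_ray :: "plane \<Rightarrow> plane \<Rightarrow> plane set" where
  "closed_ray p u \<equiv> {p + s *\<^sub>R u | s. 0 \<le> s}"

lemma closed_ray_eq:
  fixes p u :: plane
  assumes "u \<noteq> 0"
  shows "closed_ray p u = {x. rot u \<bullet> (x - p) = 0 \<and> 0 \<le> u \<bullet> (x - p)}"
proof (intro set_eqI iffI)
  fix x assume x: "x \<in> {x. rot u \<bullet> (x - p) = 0 \<and> 0 \<le> u \<bullet> (x - p)}"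
  obtain s where s: "x - p = s *\<^sub>R u"
  proof (rule orthogonal_line[of "rot u" u "x - p"])
    show "u \<bullet> rot u = 0" by (simp add: inner_prod_def rot_def)
    show "(x - p) \<bullet> rot u = 0" using x by (simp add: inner_commute)
  qed (use assms in auto)
  have "0 < u \<bullet> u" using assms by simp
  moreover have "0 \<le> s * (u \<bullet> u)" using x s by simp
  ultimately have "0 \<le> s" using zero_le_mult_iff by (smt (verit))
  then show "x \<in> closed_ray p u"
    using s by (intro CollectI exI[of _ s]) (simp add: algebra_simps)
qed (auto simp: inner_rot cross_def)

lemma closed_closed_ray:
  fixes p u :: plane
  assumes "u \<noteq> 0"
  shows "closed (closed_ray p u)"
proof -
  have "closed_ray p u = {x. rot u \<bullet> (x - p) = 0} \<inter> {x. 0 \<le> u \<bullet> (x - p)}"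
    unfolding closed_ray_eq[OF assms] by blast
  also have "closed \<dots>"
    by (intro closed_Int closed_Collect_eq closed_Collect_le continuous_intros)
  finally show ?thesis .
qed

lemma closure_from_direction:
  fixes x d :: "'a::real_normed_vector"
  assumes "r > 0" "\<And>s. 0 < s \<Longrightarrow> s < r \<Longrightarrow> x + s *\<^sub>R d \<in> S"
  shows "x \<in> closure S"
proof -
  have "(\<lambda>s. x + s *\<^sub>R d) ` closure {0<..<r} \<subseteq> closure S"
    using assms closure_subset[of S] by (intro image_closure_subset continuous_intros) auto
  moreover have "0 \<in> closure {0<..<r}" using assms(1) by simp
  ultimately show ?thesis by force
qed

text \<open>If not empty, this is the relatively open cell dual to the convex hull of \<open>A\<close>. The regions, edges
  and vertices of a non-singular curve are the cells of one, two and three exponents.\<close>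

definition cell :: "tpoly \<Rightarrow> (nat \<times> nat) set \<Rightarrow> plane set" where
  "cell P A = {x. attained P x = A}"

lemma mem_cell [simp]: "x \<in> cell P A \<longleftrightarrow> attained P x = A"
  by (simp add: cell_def)

lemma open_cell_eq: "open_cell P x = cell P (attained P x)"
  by (simp add: open_cell_def cell_def)

context tropical_curve
begin

lemma closure_cell: "x \<in> closure (cell P A) \<Longrightarrow> A \<subseteq> attained P x"
proof -
  assume x: "x \<in> closure (cell P A)"
  obtain r where r: "r > 0" "\<And>y. dist y x < r \<Longrightarrow> attained P y \<subseteq> attained P x"
    using attained_near_subset by blast
  then obtain y where "y \<in> cell P A" "dist y x < r"
    using x unfolding closure_approachable by blast
  then show ?thesis using r(2)[of y] by simp
qed

text \<open>The cells whose closure contains a given point are found by stepping off in suitable directions.\<close>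

lemma closure_cell_leading:
  assumes "leading P x d = A"
  shows "x \<in> closure (cell P A)"
proof -
  obtain r where r: "r > 0" "\<And>s. 0 < s \<Longrightarrow> s < r \<Longrightarrow> attained P (x + s *\<^sub>R d) = leading P x d"
    using attained_near_dir by blast
  then show ?thesis using assms by (intro closure_from_direction[OF r(1), of x d]) simp
qed

lemma convex_cell: "convex (cell P A)"
proof (cases "A = {}")
  case False
  then obtain m where m: "m \<in> A" by blast
  show ?thesis
    unfolding convex_alt
  proof (intro ballI allI impI)
    fix x y t assume xy: "x \<in> cell P A" "y \<in> cell P A" and t: "0 \<le> t \<and> t \<le> (1::real)"
    show "(1 - t) *\<^sub>R x + t *\<^sub>R y \<in> cell P A"
    proof (cases "t = 0 \<or> t = 1")
      case True then show ?thesis using xy by (elim disjE) simp_all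
    next
      case False
      then show ?thesis using attained_between[of m x y t] m xy t by simp
    qed
  qed
qed (simp add: cell_def attained_nonempty)

lemma equal_monomials_orthogonal:
  assumes "{a, b} \<subseteq> attained P x" "{a, b} \<subseteq> attained P y"
  shows "(y - x) \<bullet> (pt b - pt a) = 0"
proof -
  have "monomial P a x = monomial P b x" "monomial P a y = monomial P b y"
    using assms by (auto intro: attained_eqD)
  then show ?thesis
    using monomial_add[of P a x "y - x"] monomial_add[of P b x "y - x"]
    by (simp add: inner_diff_right inner_commute)
qed

lemma open_region: "open (cell P {a})"
  unfolding open_contains_ball
proof
  fix x assume x: "x \<in> cell P {a}"
  obtain r where r: "r > 0" "\<And>y. dist y x < r \<Longrightarrow> attained P y \<subseteq> attained P x"
    using attained_near_subset by blast
  have "attained P y = {a}" if "y \<in> ball x r" for y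
    using r(2)[of y] that x attained_nonempty[of y] by (simp add: dist_commute subset_singleton_iff)
  then have "ball x r \<subseteq> cell P {a}" by (auto simp del: mem_ball)
  then show "\<exists>r>0. ball x r \<subseteq> cell P {a}" using r(1) by blast
qed

end

lemma of_int_bit: "(of_int p :: bit) = of_bool (odd p)"
  by (cases "even p") (auto elim!: evenE oddE)

text \<open>A primitive integer vector on a line is unique up to sign, so its parity depends only on the line.
  This makes the direction of an edge modulo 2 well defined.\<close>

lemma coprime_directions_parity:
  fixes p q p' q' :: int and z :: plane
  assumes co: "coprime p q" "coprime p' q'" and z: "z \<noteq> 0"
    and "z \<in> span {(real_of_int p, real_of_int q)}" "z \<in> span {(real_of_int p', real_of_int q')}"
  shows "\<bar>p\<bar> = \<bar>p'\<bar> \<and> \<bar>q\<bar> = \<bar>q'\<bar>"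
proof -
  obtain s t where st: "z = s *\<^sub>R (real_of_int p, real_of_int q)"
    "z = t *\<^sub>R (real_of_int p', real_of_int q')"
    using assms(4,5) unfolding span_singleton by blast
  then have s: "s \<noteq> 0" "t \<noteq> 0" using z by (metis scaleR_zero_left)+
  have e: "s * p = t * p'" "s * q = t * q'" using st by auto
  then have "s * t * (real_of_int p * real_of_int q') = s * t * (real_of_int q * real_of_int p')"
    by algebra
  then have "real_of_int p * real_of_int q' = real_of_int q * real_of_int p'" using s by simp
  then have eq: "p * q' = q * p'" by (metis of_int_eq_iff of_int_mult)
  have "p dvd p'" using eq co(1) by (metis coprime_dvd_mult_right_iff dvd_triv_left)
  moreover have "p' dvd p" using eq co(2) by (metis coprime_dvd_mult_left_iff dvd_triv_right)
  moreover have "q dvd q'" using eq co(1) by (metis coprime_commute coprime_dvd_mult_right_iff dvd_triv_left)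
  moreover have "q' dvd q" using eq co(2) by (metis coprime_commute coprime_dvd_mult_left_iff dvd_triv_right)
  ultimately show ?thesis by (meson zdvd_antisym_abs)
qed

context nonsingular_curve
begin

text \<open>A cell of one exponent is open, and a cell of three exponents is a point, because two independent
  linear equations hold between any two of its points. This leaves the cells of two exponents.\<close>

lemma edge_iff: "e \<in> edges P \<longleftrightarrow> (\<exists>a b. a \<noteq> b \<and> e = cell P {a, b} \<and> e \<noteq> {})"
proof
  assume "e \<in> edges P"
  then obtain x where x: "e = cell P (attained P x)" "aff_dim e = 1"
    by (auto simp: edges_def open_cell_eq)
  then have ne: "e \<noteq> {}" by auto
  show "\<exists>a b. a \<noteq> b \<and> e = cell P {a, b} \<and> e \<noteq> {}"
  proof (cases x rule: attained_cases)
    case (region a)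
    then have "aff_dim e = 2" using x ne open_region[of a] by (simp add: aff_dim_open)
    then show ?thesis using x by simp
  next
    case (edge a b)
    show ?thesis
    proof (intro exI conjI)
      show "a \<noteq> b" "e = cell P {a, b}" "e \<noteq> {}" using edge x(1) ne by simp_all
    qed
  next
    case (vertex a b c)
    have "e \<subseteq> {x}"
    proof
      fix y assume "y \<in> e"
      then have y: "attained P y = {a, b, c}" using x vertex by simp
      show "y \<in> {x}"
      proof (rule ccontr)
        assume "y \<notin> {x}"
        moreover have "(y - x) \<bullet> (pt b - pt a) = 0" "(y - x) \<bullet> (pt c - pt a) = 0"
          using y vertex by (auto intro!: equal_monomials_orthogonal)
        ultimately show False using orthogonal_cross[of "y - x"] vertex(2) by simp
      qed
    qed
    then have "aff_dim e \<le> aff_dim {x}" by (rule aff_dim_subset)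
    then show ?thesis using x by simp
  qed
next
  assume "\<exists>a b. a \<noteq> b \<and> e = cell P {a, b} \<and> e \<noteq> {}"
  then obtain a b x where ab: "a \<noteq> b" "e = cell P {a, b}" "x \<in> e" by blast
  define w where "w = pt b - pt a"
  have w: "w \<noteq> 0" using ab by (simp add: w_def)
  have "aff_dim e \<le> aff_dim {y. w \<bullet> y = w \<bullet> x}"
  proof (rule aff_dim_subset, rule subsetI)
    fix y assume "y \<in> e"
    then have "(y - x) \<bullet> w = 0"
      unfolding w_def using ab by (intro equal_monomials_orthogonal) auto
    then have "w \<bullet> (y - x) = 0" by (simp add: inner_commute)
    then show "y \<in> {y. w \<bullet> y = w \<bullet> x}" by (simp add: inner_diff_right)
  qed
  then have le: "aff_dim e \<le> 1" using w by simp
  (* A small step along the edge gives a second point, so the dimension is not zero. *)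
  obtain r where r: "r > 0" "\<And>s. 0 < s \<Longrightarrow> s < r \<Longrightarrow> attained P (x + s *\<^sub>R rot w) = leading P x (rot w)"
    using attained_near_dir by blast
  have "pt b \<bullet> rot w = pt a \<bullet> rot w"
    by (simp add: w_def inner_prod_def rot_def algebra_simps)
  then have "x + (r/2) *\<^sub>R rot w \<in> e" using r(1) r(2)[of "r/2"] ab by auto
  then have "aff_dim {x, x + (r/2) *\<^sub>R rot w} \<le> aff_dim e"
    using ab by (intro aff_dim_subset) auto
  moreover have "aff_dim {x, x + (r/2) *\<^sub>R rot w} = 1"
    using r(1) w by (simp add: aff_dim_2)
  ultimately have "aff_dim e = 1" using le by simp
  then show "e \<in> edges P"
    unfolding edges_def open_cell_eq using ab by (intro CollectI exI[of _ x]) simp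
qed

lemma edgeI:
  assumes "attained P x = {a, b}" "a \<noteq> b"
  shows "cell P {a, b} \<in> edges P"
proof -
  have "cell P {a, b} \<noteq> {}" using assms mem_cell[of x P] by blast
  then show ?thesis unfolding edge_iff using assms(2) by (intro exI[of _ a] exI[of _ b]) simp
qed

lemma edgeE:
  assumes "e \<in> edges P"
  obtains a b x where "a \<noteq> b" "e = cell P {a, b}" "attained P x = {a, b}"
proof -
  obtain a b where "a \<noteq> b" "e = cell P {a, b}" "e \<noteq> {}" using assms unfolding edge_iff by (elim exE conjE)
  moreover from this obtain x where "x \<in> e" by blast
  ultimately show thesis using that by simp
qed

text \<open>In each of its two directions an edge either stops at a point where more monomials are attained, or
  no monomial grows faster than the two of the edge.\<close>

lemma edge_half:
  assumes x: "attained P x = {a, b}" "a \<noteq> b" and d: "d \<noteq> 0" "d \<bullet> (pt b - pt a) = 0"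
  obtains (stop) t where "t > 0" "{a, b} \<subset> attained P (x + t *\<^sub>R d)"
      "\<And>s. 0 \<le> s \<Longrightarrow> attained P (x + s *\<^sub>R d) = {a, b} \<longleftrightarrow> s < t"
  | (forever) "\<And>k. k \<in> dom P \<Longrightarrow> d \<bullet> (pt k - pt a) \<le> 0"
      "\<And>s. 0 \<le> s \<Longrightarrow> attained P (x + s *\<^sub>R d) = {a, b}"
proof (cases "\<exists>k\<in>dom P. d \<bullet> (pt k - pt a) > 0")
  case True
  then obtain k0 where k0: "k0 \<in> dom P" "d \<bullet> (pt k0 - pt a) > 0" by blast
  have ax: "a \<in> attained P x" "b \<in> attained P x" using x by auto
  have col: "orient a b c = 0" if "c \<in> attained P x" for c
    using that x by (auto simp: cross_def)
  obtain t k where t: "t > 0" "attained P (x + t *\<^sub>R d) = {a, b, k}"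
    "orient a b k \<noteq> 0"
    "\<And>s. 0 \<le> s \<Longrightarrow> s < t \<Longrightarrow> attained P (x + s *\<^sub>R d) = {a, b}"
    using edge_end[OF ax x(2) col d k0] by blast
  have "k \<noteq> a" "k \<noteq> b" using t(3) by (auto simp: cross_def)
  then have strict: "{a, b} \<subset> attained P (x + t *\<^sub>R d)" using t(2) by blast
  have "s < t" if s: "0 \<le> s" "attained P (x + s *\<^sub>R d) = {a, b}" for s
  proof (rule ccontr)
    assume "\<not> s < t"
    moreover have "s \<noteq> t" using s strict by auto
    ultimately have st: "t < s" by simp
    have "x + t *\<^sub>R d = (1 - t / s) *\<^sub>R x + (t / s) *\<^sub>R (x + s *\<^sub>R d)"
      using st t(1) by (simp add: algebra_simps)
    moreover have "attained P \<dots> = attained P x \<inter> attained P (x + s *\<^sub>R d)"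
      using st t(1) s x by (intro attained_between[of a]) auto
    ultimately show False using strict x s by auto
  qed
  then show thesis using stop[OF t(1) strict] t(4) by blast
next
  case False
  then have neg: "\<And>k. k \<in> dom P \<Longrightarrow> d \<bullet> (pt k - pt a) \<le> 0" by force
  have const: "d \<bullet> (pt c - pt a) = 0" if "c \<in> attained P x" for c using that x d by auto
  have "a \<in> attained P x" using x by simp
  from shoot_forever[OF const this neg] show thesis using forever[OF neg] x by simp
qed

text \<open>An edge cannot go on forever on both sides: no monomial would grow faster than the two of the edge
  in either direction, so the direction would be constant on all exponents.\<close>

lemma edge_cases:
  assumes "e \<in> edges P"
  obtains (segment) a b p q where "a \<noteq> b" "e = cell P {a, b}" "p \<noteq> q" "e = open_segment p q"
      "{a, b} \<subset> attained P p" "{a, b} \<subset> attained P q"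
  | (ray) a b p u where "a \<noteq> b" "e = cell P {a, b}" "u \<noteq> 0" "e = open_ray p u"
      "{a, b} \<subset> attained P p" "\<And>k. k \<in> dom P \<Longrightarrow> u \<bullet> pt k \<le> u \<bullet> pt a" "u \<bullet> pt b = u \<bullet> pt a"
proof -
  obtain a b x where ab: "a \<noteq> b" "e = cell P {a, b}" "x \<in> e"
    using assms by (metis edgeE mem_cell)
  define d where "d = rot (pt b - pt a)"
  have w: "pt b - pt a \<noteq> 0" using ab by simp
  have d: "d \<noteq> 0" "d \<bullet> (pt b - pt a) = 0" "- d \<noteq> 0" "- d \<bullet> (pt b - pt a) = 0"
    using ab by (auto simp: d_def inner_rot cross_def)
  have x: "attained P x = {a, b}" using ab by simp
  have line: "\<exists>s. y = x + s *\<^sub>R d" if "y \<in> e" for y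
  proof -
    have "(y - x) \<bullet> (pt b - pt a) = 0"
      using that ab by (intro equal_monomials_orthogonal) auto
    then obtain s where "y - x = s *\<^sub>R d" using orthogonal_line[OF w d(1,2)] by metis
    then show ?thesis by (metis add.commute diff_add_cancel)
  qed
  have ray_from: thesis
    if d': "d' \<noteq> 0" "d' \<bullet> (pt b - pt a) = 0" "\<And>y. y \<in> e \<Longrightarrow> \<exists>s. y = x + s *\<^sub>R d'"
      and up: "0 < t" "{a, b} \<subset> attained P (x + t *\<^sub>R d')"
        "\<And>s. 0 \<le> s \<Longrightarrow> attained P (x + s *\<^sub>R d') = {a, b} \<longleftrightarrow> s < t"
      and down: "\<And>k. k \<in> dom P \<Longrightarrow> - d' \<bullet> (pt k - pt a) \<le> 0"
        "\<And>s. 0 \<le> s \<Longrightarrow> attained P (x + s *\<^sub>R (- d')) = {a, b}" for d' t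
  proof -
    have mem: "x + s *\<^sub>R d' \<in> e \<longleftrightarrow> s < t" for s
    proof (cases "0 \<le> s")
      case True
      then show ?thesis using up(3)[OF True] by (simp add: ab(2))
    next
      case False
      then show ?thesis using down(2)[of "- s"] up(1) by (simp add: ab(2))
    qed
    let ?q = "x + t *\<^sub>R d'"
    have "e = {?q + s *\<^sub>R (- d') | s. 0 < s}"
    proof (intro set_eqI iffI)
      fix y assume "y \<in> e"
      then obtain s where s: "y = x + s *\<^sub>R d'" "s < t" using d'(3) mem by blast
      then have "y = ?q + (t - s) *\<^sub>R (- d') \<and> 0 < t - s" by (simp add: algebra_simps)
      then show "y \<in> {?q + s *\<^sub>R (- d') | s. 0 < s}" by blast
    next
      fix y assume "y \<in> {?q + s *\<^sub>R (- d') | s. 0 < s}"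
      then obtain s where "0 < s" "y = x + (t - s) *\<^sub>R d'" by (auto simp: algebra_simps)
      then show "y \<in> e" using mem[of "t - s"] by simp
    qed
    moreover have "(- d') \<bullet> pt k \<le> (- d') \<bullet> pt a" if "k \<in> dom P" for k
      using down(1)[OF that] by (simp add: inner_diff_right)
    moreover have "(- d') \<bullet> pt b = (- d') \<bullet> pt a" "- d' \<noteq> 0"
      using d' by (simp_all add: inner_diff_right)
    ultimately show thesis using ray[OF ab(1,2) _ _ up(2)] by blast
  qed
  show thesis
  proof (cases rule: edge_half[OF x ab(1) d(1,2), case_names stop forever])
    case up: (stop t1)
    show thesis
    proof (cases rule: edge_half[OF x ab(1) d(3,4), case_names stop forever])
      case down: (stop t2)
      have mem: "x + s *\<^sub>R d \<in> e \<longleftrightarrow> - t2 < s \<and> s < t1" for s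
      proof (cases "0 \<le> s")
        case True
        then show ?thesis using up(3)[OF True] down(1) by (simp add: ab(2))
      next
        case False
        then show ?thesis using down(3)[of "- s"] up(1) by (simp add: ab(2)) linarith
      qed
      let ?p = "x + (- t2) *\<^sub>R d" and ?q = "x + t1 *\<^sub>R d"
      have "?q - ?p = (t1 + t2) *\<^sub>R d" by (simp add: algebra_simps)
      then have pq: "?p \<noteq> ?q" using d(1) up(1) down(1)
        by (metis add_pos_pos eq_iff_diff_eq_0 less_irrefl scaleR_eq_0_iff)
      have "e = open_segment ?p ?q"
      proof (intro set_eqI iffI)
        fix y assume "y \<in> e"
        then obtain s where s: "y = x + s *\<^sub>R d" "- t2 < s" "s < t1" using line mem by blast
        define \<theta> where "\<theta> = (s + t2) / (t1 + t2)"
        have th: "0 < \<theta>" "\<theta> < 1" using s up(1) down(1) by (auto simp: \<theta>_def)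
        have "\<theta> * (t1 + t2) = s + t2" using up(1) down(1) by (simp add: \<theta>_def)
        then have "s = (1 - \<theta>) * (- t2) + \<theta> * t1" by (simp add: algebra_simps)
        then have "y = (1 - \<theta>) *\<^sub>R ?p + \<theta> *\<^sub>R ?q" unfolding s(1)
          by (simp only: scaleR_add_right scaleR_scaleR scaleR_add_left scaleR_left_diff_distrib scaleR_one) simp
        then show "y \<in> open_segment ?p ?q" using th pq unfolding in_segment by blast
      next
        fix y assume "y \<in> open_segment ?p ?q"
        then obtain \<theta> where th: "0 < \<theta>" "\<theta> < 1" "y = (1 - \<theta>) *\<^sub>R ?p + \<theta> *\<^sub>R ?q"
          unfolding in_segment by blast
        define c where "c = - t2 + \<theta> * (t1 + t2)"
        have y: "y = x + c *\<^sub>R d" unfolding th(3) c_def by (simp add: algebra_simps)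
        have tt: "0 < t1 + t2" using up(1) down(1) by simp
        have "c = t1 - (1 - \<theta>) * (t1 + t2)" by (simp add: c_def algebra_simps)
        moreover have "0 < \<theta> * (t1 + t2)" "0 < (1 - \<theta>) * (t1 + t2)" using th tt by auto
        ultimately have "- t2 < c" "c < t1" unfolding c_def by linarith+
        then show "y \<in> e" using mem y by blast
      qed
      then show thesis using segment[OF ab(1,2) pq] up(2) down(2) by simp
    next
      case down: forever
      show thesis by (rule ray_from[OF d(1,2) line up down])
    qed
  next
    case up: forever
    show thesis
    proof (cases rule: edge_half[OF x ab(1) d(3,4), case_names stop forever])
      case down: (stop t2)
      have "\<exists>s. y = x + s *\<^sub>R (- d)" if y: "y \<in> e" for y
      proof -
        obtain s where "y = x + s *\<^sub>R d" using line[OF y] by blast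
        then show ?thesis by (intro exI[of _ "- s"]) simp
      qed
      then show thesis by (rule ray_from[OF d(3,4) _ down]) (use up in simp_all)
    next
      case down: forever
      have "a \<in> dom P" using x attained_subset by blast
      then obtain k where "k \<in> dom P" "d \<bullet> (pt k - pt a) \<noteq> 0" using full[OF d(1)] by blast
      then show thesis using up(1)[of k] down(1)[of k] by simp
    qed
  qed
qed

lemma ray_unbounded:
  fixes p u :: plane
  assumes "u \<noteq> 0"
  shows "\<not> bounded (open_ray p u)"
proof
  assume "bounded (open_ray p u)"
  then obtain B where "\<forall>x\<in>open_ray p u. norm x \<le> B" unfolding bounded_iff by blast
  then have B: "norm (p + s *\<^sub>R u) \<le> B" if "0 < s" for s using that by blast
  define s where "s = (\<bar>B\<bar> + norm p + 1) / norm u"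
  have s: "0 < s" "s * norm u = \<bar>B\<bar> + norm p + 1"
    using assms by (auto simp: s_def intro!: divide_pos_pos add_nonneg_pos)
  have "norm (s *\<^sub>R u) \<le> norm (p + s *\<^sub>R u) + norm p"
    using norm_triangle_ineq4[of "p + s *\<^sub>R u" p] by simp
  then show False using s B[OF s(1)] by simp
qed

lemma bounded_edgeE:
  assumes "e \<in> bounded_edges P"
  obtains a b p q where "a \<noteq> b" "e = cell P {a, b}" "p \<noteq> q" "e = open_segment p q"
      "{a, b} \<subset> attained P p" "{a, b} \<subset> attained P q"
proof -
  have "e \<in> edges P" "bounded e" using assms by (auto simp: bounded_edges_def)
  from this(1) show thesis
  proof (cases rule: edge_cases)
    case (segment a b p q) then show ?thesis by (rule that)
  next
    case (ray a b p u) then show ?thesis using ray_unbounded[of u p] \<open>bounded e\<close> by simp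
  qed
qed

lemma unbounded_edgeE:
  assumes "e \<in> edges P" "e \<notin> bounded_edges P"
  obtains a b p u where "a \<noteq> b" "e = cell P {a, b}" "u \<noteq> 0" "e = open_ray p u"
      "{a, b} \<subset> attained P p" "\<And>k. k \<in> dom P \<Longrightarrow> u \<bullet> pt k \<le> u \<bullet> pt a" "u \<bullet> pt b = u \<bullet> pt a"
  using assms(1)
proof (cases rule: edge_cases)
  case (segment a b p q)
  then have "bounded e" by (metis bounded_open_segment)
  then show ?thesis using assms by (simp add: bounded_edges_def)
next
  case (ray a b p u) then show ?thesis by (rule that)
qed

lemma finite_edges: "finite (edges P)"
proof (rule finite_subset)
  show "edges P \<subseteq> cell P ` Pow (dom P)"
    using attained_subset by (auto simp: edges_def open_cell_eq)
qed (use fin in simp)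

lemma edge_closure_disjoint:
  assumes "e \<in> edges P" "f \<in> edges P" "x \<in> e" "x \<in> closure f"
  shows "e = f"
proof -
  obtain a b where ab: "a \<noteq> b" "e = cell P {a, b}" using assms(1) by (rule edgeE)
  obtain c d where cd: "c \<noteq> d" "f = cell P {c, d}" using assms(2) by (rule edgeE)
  have "{c, d} \<subseteq> {a, b}" using closure_cell assms(3,4) ab cd by (metis mem_cell)
  then have "{c, d} = {a, b}" using ab cd by blast
  then show ?thesis using ab cd by simp
qed

text \<open>The edge of \<open>a\<close> and \<open>b\<close> leaves the vertex in the direction in which these two monomials grow
  equally fast and the third one grows more slowly.\<close>

lemma edge_at_vertex:
  assumes v: "attained P v = {a, b, c}" and nc: "orient a b c \<noteq> 0"
  shows "cell P {a, b} \<in> edges P" "v \<in> closure (cell P {a, b})"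
proof -
  obtain d where d: "d \<bullet> (pt b - pt a) = 0" "d \<bullet> (pt c - pt a) < 0"
  proof (cases "orient a b c < 0")
    case True
    then show thesis by (intro that[of "rot (pt b - pt a)"]) (auto simp: inner_rot cross_def)
  next
    case False
    then show thesis using nc
      by (intro that[of "- rot (pt b - pt a)"]) (auto simp: inner_rot, auto simp: cross_def)
  qed
  have d': "pt b \<bullet> d = pt a \<bullet> d" "pt c \<bullet> d < pt a \<bullet> d"
    using d by (simp_all add: inner_diff_right inner_commute)
  have "leading P v d = {a, b}" using v d' by auto
  then show cl: "v \<in> closure (cell P {a, b})" by (rule closure_cell_leading)
  have "a \<noteq> b" using nc by (auto simp: cross_def)
  moreover have "cell P {a, b} \<noteq> {}" using cl by (metis closure_empty empty_iff)
  ultimately show "cell P {a, b} \<in> edges P" using edgeI by (metis mem_cell ex_in_conv)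
qed

lemma region_at_edge:
  assumes x: "attained P x = {a, b}" "a \<noteq> b"
  shows "x \<in> closure (cell P {a})"
proof (rule closure_cell_leading)
  let ?d = "pt a - pt b"
  have "0 < ?d \<bullet> ?d" using x by simp
  then have "pt b \<bullet> ?d < pt a \<bullet> ?d" by (simp add: inner_diff_left)
  then show "leading P x ?d = {a}" using x by auto
qed

lemma planar_curve_eq: "planar_curve P = (\<Union>e\<in>edges P. closure e)"
proof (intro set_eqI iffI)
  fix x assume x: "x \<in> planar_curve P"
  show "x \<in> (\<Union>e\<in>edges P. closure e)"
  proof (cases x rule: attained_cases)
    case (region a) then show ?thesis using x by (simp add: planar_curve_def)
  next
    case (edge a b)
    then have "x \<in> cell P {a, b}" by simp
    then have "x \<in> closure (cell P {a, b})" using closure_subset by blast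
    then show ?thesis using edgeI[OF edge] by blast
  next
    case (vertex a b c)
    then show ?thesis using edge_at_vertex[OF vertex] by (intro UN_I[of "cell P {a, b}"])
  qed
next
  fix x assume "x \<in> (\<Union>e\<in>edges P. closure e)"
  then obtain e where e: "e \<in> edges P" "x \<in> closure e" by blast
  obtain a b where ab: "a \<noteq> b" "e = cell P {a, b}" using e(1) by (rule edgeE)
  then have "{a, b} \<subseteq> attained P x" using closure_cell[of x "{a, b}"] e by simp
  then have "card {a, b} \<le> card (attained P x)" by (intro card_mono) auto
  then show "x \<in> planar_curve P" using ab by (simp add: planar_curve_def)
qed

lemma closed_planar_curve: "closed (planar_curve P)"
  unfolding planar_curve_eq using finite_edges by (intro closed_UN) auto

lemma planar_curve_region:
  "x \<notin> planar_curve P \<longleftrightarrow> (\<exists>a. attained P x = {a})"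
proof (cases x rule: attained_cases)
  case (vertex a b c)
  then have "a \<noteq> b" by (auto simp: cross_def)
  then have "card {a, b} \<le> card (attained P x)" using vertex by (intro card_mono) auto
  moreover have "attained P x \<noteq> {z}" for z using vertex(1) \<open>a \<noteq> b\<close> by (metis insertI1 insertCI singletonD)
  ultimately show ?thesis using \<open>a \<noteq> b\<close> by (simp add: planar_curve_def)
qed (auto simp: planar_curve_def)

text \<open>Dividing the difference of the two exponents of the edge by the greatest common divisor of its
  entries and rotating gives a primitive vector along the edge, and its entries are not both even.\<close>

lemma edge_dir_nonzero:
  assumes "e \<in> edges P"
  shows "edge_dir e \<noteq> 0"
proof -
  obtain a b where ab: "a \<noteq> b" "e = cell P {a, b}" using assms by (rule edgeE)
  define i j :: int where "i = int (fst b) - int (fst a)" and "j = int (snd b) - int (snd a)"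
  have w: "pt b - pt a = (real_of_int i, real_of_int j)" by (simp add: pt_def i_def j_def)
  have ij: "i \<noteq> 0 \<or> j \<noteq> 0" using ab by (auto simp: i_def j_def prod_eq_iff)
  define g where "g = gcd i j"
  have g: "g \<noteq> 0" using ij by (simp add: g_def)
  define p q where "p = - (j div g)" and "q = i div g"
  have co: "coprime p q"
    using div_gcd_coprime[OF ij] by (simp add: p_def q_def g_def coprime_commute)
  have pq: "j = - g * p" "i = g * q" by (simp_all add: p_def q_def g_def)
  have spans: "y - x \<in> span {(real_of_int p, real_of_int q)}" if "x \<in> e" "y \<in> e" for x y
  proof -
    have "(y - x) \<bullet> (pt b - pt a) = 0"
      using that ab by (intro equal_monomials_orthogonal) auto
    moreover have "(real_of_int p, real_of_int q) \<noteq> 0" using ij pq by (auto simp: zero_prod_def)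
    moreover have "(real_of_int p, real_of_int q) \<bullet> (pt b - pt a) = 0"
      unfolding w pq by (simp add: inner_prod_def)
    moreover have "pt b - pt a \<noteq> 0" using ab by simp
    ultimately obtain s where "y - x = s *\<^sub>R (real_of_int p, real_of_int q)"
      using orthogonal_line by metis
    then show ?thesis by (auto simp: span_singleton)
  qed
  obtain x y where xy: "x \<in> e" "y \<in> e" "x \<noteq> y"
  proof -
    have "aff_dim e = 1" using assms by (auto simp: edges_def)
    then have "e \<noteq> {}" "\<And>x. e \<noteq> {x}" by auto
    then show thesis using that by blast
  qed
  let ?Q = "\<lambda>w. \<exists>p q :: int. coprime p q \<and>
     (\<forall>x\<in>e. \<forall>y\<in>e. y - x \<in> span {(real_of_int p, real_of_int q)}) \<and> w = (of_int p, of_int q)"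
  have Q: "?Q (of_int p, of_int q)" using co spans by blast
  have uniq: "w = (of_int p, of_int q)" if Qw: "?Q w" for w :: "bit \<times> bit"
  proof -
    obtain p' q' :: int where pq': "coprime p' q'" "w = (of_int p', of_int q')"
      "\<forall>x\<in>e. \<forall>y\<in>e. y - x \<in> span {(real_of_int p', real_of_int q')}"
      using Qw by blast
    have "\<bar>p\<bar> = \<bar>p'\<bar> \<and> \<bar>q\<bar> = \<bar>q'\<bar>"
      using co pq'(1,3) xy spans by (intro coprime_directions_parity[of p q p' q' "y - x"]) auto
    then have "even p' = even p" "even q' = even q" by (metis dvd_abs_iff)+
    then have "(of_int p' :: bit) = of_int p" "(of_int q' :: bit) = of_int q"
      by (simp_all add: of_int_bit)
    then show ?thesis using pq'(2) by simp
  qed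
  have "edge_dir e = (of_int p, of_int q)"
    unfolding edge_dir_def using Q uniq by (rule the_equality)
  moreover have "\<not> (even p \<and> even q)" using co by (meson coprime_common_divisor odd_one)
  then have "(of_int p :: bit, of_int q :: bit) \<noteq> 0"
    by (auto simp: zero_prod_def of_int_bit)
  ultimately show ?thesis by simp
qed

end


section \<open>The plane and its rays in the toric surface\<close>

text \<open>The second component of the points of the surface in the stratum of \<open>\<tau>\<close>.\<close>

abbreviation coset :: "plane \<Rightarrow> plane set \<Rightarrow> plane set" where
  "coset x \<tau> \<equiv> (\<lambda>v. x + v) ` span \<tau>"

lemma monomial_value_coset:
  "monomial_value (\<tau>, coset x \<tau>) m =
     (if \<forall>u\<in>\<tau>. m \<bullet> u = 0 then ereal (m \<bullet> x) else - \<infinity>)"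
proof (cases "\<forall>u\<in>\<tau>. m \<bullet> u = 0")
  case True
  let ?C = "coset x \<tau>"
  have "x \<in> ?C" using span_zero[of \<tau>] by (intro image_eqI[of _ _ 0]) auto
  then have "(SOME y. y \<in> ?C) \<in> ?C" by (rule someI)
  then obtain v where v: "(SOME y. y \<in> ?C) = x + v" "v \<in> span \<tau>" by blast
  have "m \<bullet> v = 0"
    using True v(2) by (metis (no_types) orthogonal_def orthogonal_to_span)
  then show ?thesis using True v(1) by (simp add: monomial_value_def inner_add_right)
qed (auto simp: monomial_value_def)

lemma embed_coset: "embed x = ({0}, coset x {0})"
  by (simp add: embed_def span_singleton)

lemma monomial_value_embed [simp]: "monomial_value (embed x) m = ereal (m \<bullet> x)"
  unfolding embed_coset monomial_value_coset by simp

lemma embed_eq_iff: "embed x = embed y \<longleftrightarrow> x = y"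
  by (simp add: embed_def)

lemma topspace_chart [simp]: "topspace (chart_topology \<Sigma> \<sigma>) = chart \<Sigma> \<sigma>"
  by (auto simp: chart_topology_def topspace_pullback_topology)

lemma continuous_map_monomial_value:
  assumes "m \<in> chart_monomials \<sigma>"
  shows "continuous_map (chart_topology \<Sigma> \<sigma>) euclidean (\<lambda>z. monomial_value z m)"
proof -
  have "continuous_map (chart_topology \<Sigma> \<sigma>) euclidean
    ((\<lambda>f. f m) \<circ> (\<lambda>p. restrict (monomial_value p) (chart_monomials \<sigma>)))"
    unfolding chart_topology_def
    by (intro continuous_map_pullback continuous_map_product_projection assms)
  then show ?thesis using assms by (simp add: o_def)
qed

lemma openin_chart_preimage:
  assumes "m \<in> chart_monomials \<sigma>" "open W"
  shows "openin (chart_topology \<Sigma> \<sigma>) {z \<in> chart \<Sigma> \<sigma>. monomial_value z m \<in> W}"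
  using openin_continuous_map_preimage[OF continuous_map_monomial_value[OF assms(1)], of W] assms(2)
  by simp

lemma closedin_chart_preimage:
  assumes "m \<in> chart_monomials \<sigma>" "closed W"
  shows "closedin (chart_topology \<Sigma> \<sigma>) {z \<in> chart \<Sigma> \<sigma>. monomial_value z m \<in> W}"
  using closedin_continuous_map_preimage[OF continuous_map_monomial_value[OF assms(1)], of W] assms(2)
  by simp

lemma topspace_toric_surface [simp]: "topspace (toric_surface \<Sigma>) = toric_points \<Sigma>"
proof
  show "topspace (toric_surface \<Sigma>) \<subseteq> toric_points \<Sigma>"
    using openin_topspace[of "toric_surface \<Sigma>"] unfolding openin_toric_surface by blast
  have "toric_points \<Sigma> \<inter> chart \<Sigma> \<sigma> = topspace (chart_topology \<Sigma> \<sigma>)" for \<sigma>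
    by (auto simp: chart_def)
  then have "openin (toric_surface \<Sigma>) (toric_points \<Sigma>)"
    unfolding openin_toric_surface by (metis openin_topspace order_refl)
  then show "toric_points \<Sigma> \<subseteq> topspace (toric_surface \<Sigma>)" by (rule openin_subset)
qed

lemma closedin_toric_surface:
  assumes "Z \<subseteq> toric_points \<Sigma>"
    and "\<And>\<sigma>. \<sigma> \<in> \<Sigma> \<Longrightarrow> closedin (chart_topology \<Sigma> \<sigma>) (Z \<inter> chart \<Sigma> \<sigma>)"
  shows "closedin (toric_surface \<Sigma>) Z"
  unfolding closedin_def openin_toric_surface
proof (intro conjI ballI)
  fix \<sigma> assume "\<sigma> \<in> \<Sigma>"
  then have "openin (chart_topology \<Sigma> \<sigma>) (chart \<Sigma> \<sigma> - Z \<inter> chart \<Sigma> \<sigma>)"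
    using assms(2)[of \<sigma>] unfolding closedin_def by simp
  moreover have "chart \<Sigma> \<sigma> - Z \<inter> chart \<Sigma> \<sigma> = (topspace (toric_surface \<Sigma>) - Z) \<inter> chart \<Sigma> \<sigma>"
    by (auto simp: chart_def)
  ultimately show "openin (chart_topology \<Sigma> \<sigma>) ((topspace (toric_surface \<Sigma>) - Z) \<inter> chart \<Sigma> \<sigma>)"
    by simp
qed (use assms(1) in auto)

lemma chart_pointE:
  assumes "z \<in> chart \<Sigma> \<sigma>"
  obtains \<tau> x where "z = (\<tau>, coset x \<tau>)" "\<tau> \<in> \<Sigma>" "\<tau> \<subseteq> \<sigma>"
  using assms by (auto simp: chart_def toric_points_def dest: face_of_imp_subset)

definition half_line :: "plane \<Rightarrow> plane set" where
  "half_line u = {s *\<^sub>R u | s. 0 \<le> s}"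

text \<open>If \<open>half_line u\<close> is a cone of the fan, this is the limit of the ray from \<open>p\<close> in direction \<open>u\<close>
  in the surface; otherwise the pair is not a point of the surface.\<close>

definition ray_end :: "plane \<Rightarrow> plane \<Rightarrow> tpoint" where
  "ray_end p u = (half_line u, coset p (half_line u))"

lemma span_half_line: "span (half_line u) = span {u}"
proof
  show "span (half_line u) \<subseteq> span {u}"
    by (intro span_minimal) (auto simp: half_line_def span_mul span_base)
  have "u \<in> half_line u" by (auto simp: half_line_def intro: exI[of _ 1])
  then show "span {u} \<subseteq> span (half_line u)" by (intro span_mono) auto
qed

text \<open>Cramer's rule, as an estimate.\<close>

lemma coordinates_bound:
  fixes m1 m2 d :: plane
  assumes D: "cross m1 m2 \<noteq> 0" and "\<bar>m1 \<bullet> d\<bar> \<le> \<epsilon>" "\<bar>m2 \<bullet> d\<bar> \<le> \<epsilon>"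
  shows "norm d \<le> \<epsilon> * ((\<bar>fst m1\<bar> + \<bar>snd m1\<bar> + \<bar>fst m2\<bar> + \<bar>snd m2\<bar>) / \<bar>cross m1 m2\<bar>)"
proof -
  have f: "fst d * cross m1 m2 = (m1 \<bullet> d) * snd m2 - (m2 \<bullet> d) * snd m1"
    and s: "snd d * cross m1 m2 = (m2 \<bullet> d) * fst m1 - (m1 \<bullet> d) * fst m2"
    by (simp_all add: cross_def inner_prod_def algebra_simps)
  have "\<bar>fst d\<bar> * \<bar>cross m1 m2\<bar> \<le> \<epsilon> * \<bar>snd m2\<bar> + \<epsilon> * \<bar>snd m1\<bar>"
    unfolding abs_mult[symmetric] f
    by (rule order_trans[OF abs_triangle_ineq4]) (auto simp: abs_mult intro!: add_mono mult_right_mono assms)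
  moreover have "\<bar>snd d\<bar> * \<bar>cross m1 m2\<bar> \<le> \<epsilon> * \<bar>fst m1\<bar> + \<epsilon> * \<bar>fst m2\<bar>"
    unfolding abs_mult[symmetric] s
    by (rule order_trans[OF abs_triangle_ineq4]) (auto simp: abs_mult intro!: add_mono mult_right_mono assms)
  moreover have "norm d \<le> \<bar>fst d\<bar> + \<bar>snd d\<bar>"
    using norm_Pair_le[of "fst d" "snd d"] by simp
  then have "norm d * \<bar>cross m1 m2\<bar> \<le> (\<bar>fst d\<bar> + \<bar>snd d\<bar>) * \<bar>cross m1 m2\<bar>"
    by (intro mult_right_mono) auto
  ultimately have "norm d * \<bar>cross m1 m2\<bar> \<le> \<epsilon> * (\<bar>fst m1\<bar> + \<bar>snd m1\<bar> + \<bar>fst m2\<bar> + \<bar>snd m2\<bar>)"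
    by (simp add: algebra_simps)
  then show ?thesis using D by (simp add: field_simps)
qed

context tropical_curve
begin

abbreviation \<Sigma> :: "plane set set" where "\<Sigma> \<equiv> fan_of P"

lemma normal_cone_hull:
  "normal_cone (convex hull A) (convex hull B) = {u. \<forall>k\<in>B. \<forall>y\<in>A. u \<bullet> y \<le> u \<bullet> k}"
proof (intro set_eqI iffI)
  fix u assume "u \<in> normal_cone (convex hull A) (convex hull B)"
  then show "u \<in> {u. \<forall>k\<in>B. \<forall>y\<in>A. u \<bullet> y \<le> u \<bullet> k}"
    unfolding normal_cone_def by (auto intro: hull_inc)
next
  fix u assume u: "u \<in> {u. \<forall>k\<in>B. \<forall>y\<in>A. u \<bullet> y \<le> u \<bullet> k}"
  have "u \<bullet> y \<le> u \<bullet> x" if x: "x \<in> convex hull B" and y: "y \<in> convex hull A" for x y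
  proof -
    have "convex hull B \<subseteq> {x. u \<bullet> x \<ge> u \<bullet> y'}" if "y' \<in> A" for y'
      using u that by (intro hull_minimal convex_halfspace_ge) auto
    then have "A \<subseteq> {y. u \<bullet> y \<le> u \<bullet> x}" using x by blast
    then have "convex hull A \<subseteq> {y. u \<bullet> y \<le> u \<bullet> x}"
      by (intro hull_minimal convex_halfspace_le) auto
    then show ?thesis using y by blast
  qed
  then show "u \<in> normal_cone (convex hull A) (convex hull B)" by (simp add: normal_cone_def)
qed

text \<open>The cones of the dual fan are given by finitely many inequalities, because a face of the Newton
  polygon is the convex hull of the exponents on it.\<close>

lemma fan_coneE:
  assumes "\<sigma> \<in> \<Sigma>"
  obtains S where "S \<subseteq> dom P" "S \<noteq> {}"
    "\<sigma> = {u. \<forall>k\<in>S. \<forall>y\<in>dom P. u \<bullet> pt y \<le> u \<bullet> pt k}"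
proof -
  obtain F where F: "F face_of newton_polygon P" "F \<noteq> {}" "\<sigma> = normal_cone (newton_polygon P) F"
    using assms by (auto simp: fan_of_def dual_fan_def)
  have "compact (pt ` dom P)" using fin by (intro finite_imp_compact) simp
  then obtain S' where S': "S' \<subseteq> pt ` dom P" "F = convex hull S'"
    using face_of_convex_hull_subset F(1) unfolding newton_polygon_def by metis
  then obtain S where S: "S \<subseteq> dom P" "S' = pt ` S" by (metis subset_image_iff)
  show thesis
  proof (rule that[OF S(1)])
    show "S \<noteq> {}" using F(2) S'(2) S(2) by auto
    show "\<sigma> = {u. \<forall>k\<in>S. \<forall>y\<in>dom P. u \<bullet> pt y \<le> u \<bullet> pt k}"
      unfolding F(3) S'(2) S(2) newton_polygon_def normal_cone_hull by simp
  qed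
qed

lemma exponent_difference_lattice: "pt y - pt k \<in> lattice"
  unfolding lattice_def pt_def
  by (intro CollectI exI[of _ "int (fst y) - int (fst k)"] exI[of _ "int (snd y) - int (snd k)"]) simp

text \<open>Differences of exponents supply enough monomials on each chart: two independent ones, and for
  every direction outside of the cone one that grows in this direction.\<close>

lemma exponent_difference_chart:
  assumes "\<sigma> = {u. \<forall>k\<in>S. \<forall>y\<in>dom P. u \<bullet> pt y \<le> u \<bullet> pt k}" "k \<in> S" "y \<in> dom P"
  shows "pt y - pt k \<in> chart_monomials \<sigma>"
proof -
  have "(pt y - pt k) \<bullet> u \<le> 0" if "u \<in> \<sigma>" for u
  proof -
    have "u \<bullet> pt y \<le> u \<bullet> pt k" using that assms by blast
    then show ?thesis by (metis inner_commute inner_diff_right diff_le_0_iff_le)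
  qed
  then show ?thesis using exponent_difference_lattice by (simp add: chart_monomials_def)
qed

lemma origin_in_fan: "{0} \<in> \<Sigma>"
proof -
  have "newton_polygon P face_of newton_polygon P"
    by (simp add: newton_polygon_def face_of_refl)
  moreover have "newton_polygon P \<noteq> {}" using ne by (simp add: newton_polygon_def)
  moreover have "normal_cone (newton_polygon P) (newton_polygon P) = {0}"
  proof -
    have "u = 0" if "\<forall>k\<in>dom P. \<forall>y\<in>dom P. u \<bullet> pt y \<le> u \<bullet> pt k" for u
    proof (rule ccontr)
      assume "u \<noteq> 0"
      obtain a where a: "a \<in> dom P" using ne by blast
      obtain k where "k \<in> dom P" "u \<bullet> (pt k - pt a) \<noteq> 0" using full[OF \<open>u \<noteq> 0\<close> a] by blast
      then show False using that a by (simp add: inner_diff_right) (metis order_antisym)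
    qed
    then show ?thesis unfolding newton_polygon_def normal_cone_hull by auto
  qed
  ultimately show ?thesis unfolding fan_of_def dual_fan_def
    by (intro CollectI exI[of _ "newton_polygon P"]) simp
qed

lemma embed_in_surface: "embed x \<in> toric_points \<Sigma>"
  unfolding toric_points_def embed_coset using origin_in_fan by blast

lemma zero_in_cone: "\<sigma> \<in> \<Sigma> \<Longrightarrow> 0 \<in> \<sigma>"
  by (elim fan_coneE) simp

lemma scale_in_cone: "\<sigma> \<in> \<Sigma> \<Longrightarrow> u \<in> \<sigma> \<Longrightarrow> 0 \<le> s \<Longrightarrow> s *\<^sub>R u \<in> \<sigma>"
  by (elim fan_coneE) (auto simp: mult_left_mono)

lemma chart_monomial_pair:
  assumes "\<sigma> \<in> \<Sigma>"
  obtains m1 m2 where "m1 \<in> chart_monomials \<sigma>" "m2 \<in> chart_monomials \<sigma>" "cross m1 m2 \<noteq> 0"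
proof -
  obtain S where S: "S \<subseteq> dom P" "S \<noteq> {}" "\<sigma> = {u. \<forall>k\<in>S. \<forall>y\<in>dom P. u \<bullet> pt y \<le> u \<bullet> pt k}"
    by (rule fan_coneE[OF assms])
  then obtain k where k: "k \<in> S" "k \<in> dom P" by blast
  obtain y1 where y1: "y1 \<in> dom P" "(1, 0) \<bullet> (pt y1 - pt k) \<noteq> 0"
    using full[of "(1, 0)" k] k by (auto simp: zero_prod_def)
  then have "rot (pt y1 - pt k) \<noteq> 0" by auto
  then obtain y2 where "y2 \<in> dom P" "rot (pt y1 - pt k) \<bullet> (pt y2 - pt k) \<noteq> 0"
    using full k by blast
  then show thesis
    using that[of "pt y1 - pt k" "pt y2 - pt k"] exponent_difference_chart[OF S(3) k(1)] y1(1)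
    by (simp add: inner_rot)
qed

text \<open>Two independent monomials can only both be finite at a point whose cone is orthogonal to both of
  them, and that is the cone \<open>{0}\<close>, whose stratum is the plane.\<close>

lemma chart_planar_point:
  assumes z: "z \<in> chart \<Sigma> \<sigma>" and cr: "cross m1 m2 \<noteq> 0"
    and v: "monomial_value z m1 \<noteq> -\<infinity>" "monomial_value z m2 \<noteq> -\<infinity>"
  obtains y where "z = embed y"
proof -
  obtain \<tau> x where tx: "z = (\<tau>, coset x \<tau>)" "\<tau> \<in> \<Sigma>" "\<tau> \<subseteq> \<sigma>"
    by (rule chart_pointE[OF z])
  have "\<forall>u\<in>\<tau>. m1 \<bullet> u = 0" "\<forall>u\<in>\<tau>. m2 \<bullet> u = 0"
    using v unfolding tx(1) monomial_value_coset by (meson)+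
  then have "\<tau> \<subseteq> {0}" using orthogonal_cross[of _ m1 m2] cr by (auto simp: inner_commute)
  then have "\<tau> = {0}" using zero_in_cone[OF tx(2)] by blast
  then show thesis using that[of x] tx(1) embed_coset by simp
qed

text \<open>The values of two independent monomials cut out a small neighbourhood of a planar point: where they
  are finite the point is planar, and they bound its distance to the given point.\<close>

lemma openin_embed_chart:
  assumes \<sigma>: "\<sigma> \<in> \<Sigma>" and U: "open U"
  shows "openin (chart_topology \<Sigma> \<sigma>) (embed ` U \<inter> chart \<Sigma> \<sigma>)"
proof (subst openin_subopen, intro ballI)
  obtain m1 m2 where m: "m1 \<in> chart_monomials \<sigma>" "m2 \<in> chart_monomials \<sigma>" "cross m1 m2 \<noteq> 0"
    by (rule chart_monomial_pair[OF \<sigma>])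
  fix z assume "z \<in> embed ` U \<inter> chart \<Sigma> \<sigma>"
  then obtain x where x: "x \<in> U" "z = embed x" "z \<in> chart \<Sigma> \<sigma>" by blast
  obtain r where r: "r > 0" "ball x r \<subseteq> U" using U x(1) by (auto elim: openE)
  define c where "c = (\<bar>fst m1\<bar> + \<bar>snd m1\<bar> + \<bar>fst m2\<bar> + \<bar>snd m2\<bar>) / \<bar>cross m1 m2\<bar>"
  have c: "c \<ge> 0" by (simp add: c_def)
  define \<epsilon> where "\<epsilon> = r / (c + 1)"
  have e: "\<epsilon> > 0" using r(1) c by (simp add: \<epsilon>_def)
  have ec: "\<epsilon> * c < r" using r(1) c by (simp add: \<epsilon>_def field_simps)
  define N where "N m = {z \<in> chart \<Sigma> \<sigma>. monomial_value z m \<in> {ereal (m \<bullet> x - \<epsilon>) <..< ereal (m \<bullet> x + \<epsilon>)}}" for m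
  have "openin (chart_topology \<Sigma> \<sigma>) (N m1 \<inter> N m2)"
    unfolding N_def using m by (intro openin_Int openin_chart_preimage) auto
  moreover have "z \<in> N m1 \<inter> N m2" using x e by (simp add: N_def)
  moreover have "N m1 \<inter> N m2 \<subseteq> embed ` U \<inter> chart \<Sigma> \<sigma>"
  proof
    fix w assume w: "w \<in> N m1 \<inter> N m2"
    then have wc: "w \<in> chart \<Sigma> \<sigma>" by (simp add: N_def)
    have "monomial_value w m1 \<noteq> -\<infinity>" "monomial_value w m2 \<noteq> -\<infinity>" using w by (auto simp: N_def)
    then obtain y where y: "w = embed y" using chart_planar_point[OF wc m(3)] by metis
    have "\<bar>m1 \<bullet> (y - x)\<bar> \<le> \<epsilon>" "\<bar>m2 \<bullet> (y - x)\<bar> \<le> \<epsilon>"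
      using w unfolding N_def y by (auto simp: inner_diff_right)
    then have "norm (y - x) \<le> \<epsilon> * c" unfolding c_def by (intro coordinates_bound m(3))
    then have "y \<in> ball x r" using ec by (simp add: dist_norm norm_minus_commute)
    then show "w \<in> embed ` U \<inter> chart \<Sigma> \<sigma>" using r(2) y wc by blast
  qed
  ultimately show "\<exists>T. openin (chart_topology \<Sigma> \<sigma>) T \<and> z \<in> T \<and> T \<subseteq> embed ` U \<inter> chart \<Sigma> \<sigma>" by blast
qed

lemma openin_embed: "open U \<Longrightarrow> openin (surface_of P) (embed ` U)"
  unfolding openin_toric_surface using embed_in_surface openin_embed_chart by auto

text \<open>On a compact set any two monomials are bounded below. Inside a chart these bounds are a closed
  condition which only planar points satisfy, and the planar points outside of the set are open.\<close>

lemma closedin_embed_compact: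
  assumes K: "compact K"
  shows "closedin (surface_of P) (embed ` K)"
proof (rule closedin_toric_surface)
  show "embed ` K \<subseteq> toric_points \<Sigma>" using embed_in_surface by blast
  fix \<sigma> assume \<sigma>: "\<sigma> \<in> \<Sigma>"
  obtain m1 m2 where m: "m1 \<in> chart_monomials \<sigma>" "m2 \<in> chart_monomials \<sigma>" "cross m1 m2 \<noteq> 0"
    by (rule chart_monomial_pair[OF \<sigma>])
  have bdd: "\<exists>B. \<forall>x\<in>K. B \<le> m \<bullet> x" for m
  proof -
    have "bounded ((\<lambda>x. m \<bullet> x) ` K)"
      using K by (intro compact_imp_bounded compact_continuous_image continuous_intros)
    then obtain B where "\<forall>x\<in>K. \<bar>m \<bullet> x\<bar> \<le> B" unfolding bounded_iff by (auto simp: real_norm_def)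
    then show ?thesis by (intro exI[of _ "- B"]) force
  qed
  obtain B1 B2 where B: "\<forall>x\<in>K. B1 \<le> m1 \<bullet> x" "\<forall>x\<in>K. B2 \<le> m2 \<bullet> x" using bdd by metis
  define N where "N m B = {z \<in> chart \<Sigma> \<sigma>. monomial_value z m \<in> {ereal B..}}" for m B
  have "closedin (chart_topology \<Sigma> \<sigma>) (N m1 B1 \<inter> N m2 B2 - embed ` (- K) \<inter> chart \<Sigma> \<sigma>)"
    unfolding N_def using m K \<sigma>
    by (intro closedin_diff closedin_Int closedin_chart_preimage openin_embed_chart)
       (auto intro: open_Compl compact_imp_closed)
  moreover have "N m1 B1 \<inter> N m2 B2 - embed ` (- K) \<inter> chart \<Sigma> \<sigma> = embed ` K \<inter> chart \<Sigma> \<sigma>" (is "?L = ?R")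
  proof
    show "?L \<subseteq> ?R"
    proof
      fix z assume z: "z \<in> ?L"
      then have zc: "z \<in> chart \<Sigma> \<sigma>" by (simp add: N_def)
      have "monomial_value z m1 \<noteq> -\<infinity>" "monomial_value z m2 \<noteq> -\<infinity>" using z by (auto simp: N_def)
      then obtain y where "z = embed y" using chart_planar_point[OF zc m(3)] by metis
      then show "z \<in> ?R" using z zc by blast
    qed
    show "?R \<subseteq> ?L"
    proof
      fix z assume "z \<in> ?R"
      then obtain x where "x \<in> K" "z = embed x" "z \<in> chart \<Sigma> \<sigma>" by blast
      then show "z \<in> ?L" using B by (auto simp: N_def embed_eq_iff)
    qed
  qed
  ultimately show "closedin (chart_topology \<Sigma> \<sigma>) (embed ` K \<inter> chart \<Sigma> \<sigma>)" by simp
qed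

text \<open>The plane lies in the chart of the cone \<open>{0}\<close>, where all monomials take the values they have
  on the plane.\<close>

lemma continuous_map_embed: "continuous_map euclidean (surface_of P) embed"
  unfolding continuous_map_def
proof (intro conjI allI impI)
  show "embed \<in> topspace euclidean \<rightarrow> topspace (surface_of P)" using embed_in_surface by simp
  fix U assume "openin (surface_of P) U"
  then have "openin (chart_topology \<Sigma> {0}) (U \<inter> chart \<Sigma> {0})"
    using origin_in_fan by (simp add: openin_toric_surface)
  then obtain V where V: "openin (product_topology (\<lambda>_. euclidean) (chart_monomials {0})) V"
    "U \<inter> chart \<Sigma> {0} = (\<lambda>p. restrict (monomial_value p) (chart_monomials {0})) -` V \<inter> chart \<Sigma> {0}"
    unfolding chart_topology_def openin_pullback_topology by blast
  have c: "embed x \<in> chart \<Sigma> {0}" for x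
    using embed_in_surface by (simp add: chart_def embed_def face_of_refl)
  define g where "g x = restrict (\<lambda>m. ereal (m \<bullet> x)) (chart_monomials {0})" for x :: plane
  have "restrict (monomial_value (embed x)) (chart_monomials {0}) = g x" for x
    by (simp add: g_def fun_eq_iff restrict_def)
  then have "embed x \<in> U \<longleftrightarrow> g x \<in> V" for x
    using arg_cong[OF V(2), of "\<lambda>A. embed x \<in> A"] c by simp
  then have "{x. embed x \<in> U} = {x. g x \<in> V}" by simp
  moreover have "continuous_map euclidean (product_topology (\<lambda>_. euclidean) (chart_monomials {0})) g"
    unfolding continuous_map_componentwise
    by (auto simp: g_def intro!: continuous_on_ereal continuous_intros)
  then have "open {x. g x \<in> V}"
    using openin_continuous_map_preimage[OF _ V(1)] by fastforce
  ultimately show "openin euclidean {x \<in> topspace euclidean. embed x \<in> U}" by simp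
qed

lemma cone_on_line:
  assumes \<tau>: "\<tau> \<in> \<Sigma>" and u: "u \<noteq> 0" and m2: "m2 \<noteq> 0" "m2 \<bullet> u = 0" "\<forall>t\<in>\<tau>. m2 \<bullet> t = 0"
    and m1: "m1 \<bullet> u < 0" "\<forall>t\<in>\<tau>. m1 \<bullet> t \<le> 0" "\<exists>t\<in>\<tau>. m1 \<bullet> t \<noteq> 0"
  shows "\<tau> = half_line u"
proof -
  have line: "\<exists>s. t = s *\<^sub>R u" if "t \<in> \<tau>" for t
    using orthogonal_line[of m2 u t] that m2 u by (metis inner_commute)
  obtain t s where t: "t \<in> \<tau>" "m1 \<bullet> t \<noteq> 0" "t = s *\<^sub>R u" using m1(3) line by blast
  have "s * (m1 \<bullet> u) < 0" using t m1(2) by (metis inner_scaleR_right less_eq_real_def)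
  then have s: "s > 0" using m1(1) by (simp add: mult_less_0_iff)
  have "(r / s) *\<^sub>R t \<in> \<tau>" if "0 \<le> r" for r using scale_in_cone[OF \<tau> t(1)] that s by simp
  moreover have "(r / s) *\<^sub>R t = r *\<^sub>R u" for r using t(3) s by simp
  ultimately have "half_line u \<subseteq> \<tau>" by (auto simp: half_line_def)
  moreover have "\<tau> \<subseteq> half_line u"
  proof
    fix t' assume t': "t' \<in> \<tau>"
    then obtain s' where s': "t' = s' *\<^sub>R u" using line by blast
    then have "s' * (m1 \<bullet> u) \<le> 0" using m1(2) t' by (metis inner_scaleR_right)
    then have "0 \<le> s'" using m1(1) by (simp add: mult_le_0_iff)
    then show "t' \<in> half_line u" using s' by (auto simp: half_line_def)
  qed
  ultimately show ?thesis by blast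
qed

text \<open>Let \<open>m2\<close> be the difference of two exponents that are maximal in direction \<open>u\<close>, so that it is
  constant on the ray, and let \<open>m1\<close> decrease along the ray. The closed conditions that \<open>m2\<close> has
  its value on the ray and that \<open>m1\<close> is at most its value at \<open>p\<close> hold exactly on the ray and at
  its end: at a point where \<open>m1\<close> is minus infinity, the cone lies on the line of \<open>u\<close> and \<open>m1\<close>
  does not vanish on it, so it is the half-line of \<open>u\<close>.\<close>

lemma closedin_ray_chart_limit:
  assumes \<sigma>: "\<sigma> \<in> \<Sigma>" "u \<in> \<sigma>" and u: "u \<noteq> 0" and ab: "a \<noteq> b" "a \<in> dom P" "b \<in> dom P"
    and top: "\<And>k. k \<in> dom P \<Longrightarrow> u \<bullet> pt k \<le> u \<bullet> pt a" "u \<bullet> pt b = u \<bullet> pt a"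
  shows "closedin (chart_topology \<Sigma> \<sigma>)
    ((embed ` closed_ray p u \<union> {ray_end p u}) \<inter> chart \<Sigma> \<sigma>)"
proof -
  obtain S where S: "S \<subseteq> dom P" "S \<noteq> {}" "\<sigma> = {u. \<forall>k\<in>S. \<forall>y\<in>dom P. u \<bullet> pt y \<le> u \<bullet> pt k}"
    by (rule fan_coneE[OF \<sigma>(1)])
  then obtain k where k: "k \<in> S" "k \<in> dom P" by blast
  have "u \<bullet> pt a \<le> u \<bullet> pt k" using \<sigma>(2) S(3) k ab by blast
  then have uk: "u \<bullet> pt k = u \<bullet> pt a" using top(1)[OF k(2)] by simp
  obtain c where c: "c \<in> dom P" "c \<noteq> k" "u \<bullet> pt c = u \<bullet> pt a" using ab top(2) by metis
  obtain y where y: "y \<in> dom P" "u \<bullet> (pt y - pt k) \<noteq> 0" using full[OF u k(2)] by blast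
  define m1 m2 where "m1 = pt y - pt k" and "m2 = pt c - pt k"
  have m: "m1 \<in> chart_monomials \<sigma>" "m2 \<in> chart_monomials \<sigma>"
    using exponent_difference_chart[OF S(3) k(1)] y c by (auto simp: m1_def m2_def)
  have "u \<bullet> m2 = 0" using c uk by (simp add: m2_def inner_diff_right)
  then have m2: "m2 \<noteq> 0" "m2 \<bullet> u = 0" using c by (auto simp: m2_def inner_commute)
  have "u \<bullet> m1 < 0" using y uk top(1)[OF y(1)] by (simp add: m1_def inner_diff_right)
  then have m1: "m1 \<bullet> u < 0" by (simp add: inner_commute)
  obtain l where l: "u = l *\<^sub>R rot m2"
  proof (rule orthogonal_line[of m2 "rot m2" u])
    show "rot m2 \<bullet> m2 = 0" by (simp add: inner_rot cross_def)
    show "u \<bullet> m2 = 0" using m2 by (simp add: inner_commute)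
  qed (use m2 in auto)
  have cr: "cross m1 m2 \<noteq> 0"
  proof
    assume "cross m1 m2 = 0"
    then have "rot m2 \<bullet> m1 = 0" by (simp add: inner_rot cross_def mult.commute)
    then have "m1 \<bullet> u = 0" unfolding l by (simp add: inner_commute)
    then show False using m1 by simp
  qed
  define N where "N = {z \<in> chart \<Sigma> \<sigma>. monomial_value z m2 \<in> {ereal (m2 \<bullet> p)}} \<inter>
      {z \<in> chart \<Sigma> \<sigma>. monomial_value z m1 \<in> {..ereal (m1 \<bullet> p)}}"
  have "closedin (chart_topology \<Sigma> \<sigma>) N"
    unfolding N_def using m by (intro closedin_Int closedin_chart_preimage) auto
  moreover have "N = (embed ` closed_ray p u \<union> {ray_end p u}) \<inter> chart \<Sigma> \<sigma>" (is "_ = ?R")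
  proof
    show "?R \<subseteq> N"
    proof
      fix z assume z: "z \<in> ?R"
      consider s where "0 \<le> s" "z = embed (p + s *\<^sub>R u)" | "z = ray_end p u" using z by blast
      then show "z \<in> N"
      proof cases
        case 1
        then have "s * (m1 \<bullet> u) \<le> 0" using m1 by (intro mult_nonneg_nonpos) auto
        then show ?thesis using 1 z m2 by (simp add: N_def inner_add_right)
      next
        case 2
        have "u \<in> half_line u" by (auto simp: half_line_def intro: exI[of _ 1])
        then have "\<not> (\<forall>t\<in>half_line u. m1 \<bullet> t = 0)" using m1 by fastforce
        moreover have "\<forall>t\<in>half_line u. m2 \<bullet> t = 0" using m2 by (auto simp: half_line_def)
        ultimately have "monomial_value z m1 = -\<infinity>" "monomial_value z m2 = ereal (m2 \<bullet> p)"
          unfolding 2 ray_end_def monomial_value_coset by auto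
        then show ?thesis using z by (simp add: N_def)
      qed
    qed
    show "N \<subseteq> ?R"
    proof
      fix z assume z: "z \<in> N"
      then have zc: "z \<in> chart \<Sigma> \<sigma>" by (simp add: N_def)
      have on_line: "\<exists>s. y = p + s *\<^sub>R u" if "m2 \<bullet> y = m2 \<bullet> p" for y
      proof -
        have "m2 \<bullet> (y - p) = 0" using that by (simp add: inner_diff_right)
        then have "(y - p) \<bullet> m2 = 0" by (simp add: inner_commute)
        then obtain s where "y - p = s *\<^sub>R u" using orthogonal_line[of m2 u "y - p"] m2 u
          by (metis inner_commute)
        then show ?thesis by (metis add.commute diff_add_cancel)
      qed
      show "z \<in> ?R"
      proof (cases "monomial_value z m1 = -\<infinity>")
        case False
        moreover have "monomial_value z m2 \<noteq> -\<infinity>" using z by (auto simp: N_def)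
        ultimately obtain y where zy: "z = embed y" using chart_planar_point[OF zc cr] by metis
        then have "m2 \<bullet> y = m2 \<bullet> p" "m1 \<bullet> y \<le> m1 \<bullet> p" using z by (auto simp: N_def)
        then obtain s where s: "y = p + s *\<^sub>R u" using on_line by blast
        then have "s * (m1 \<bullet> u) \<le> 0" using \<open>m1 \<bullet> y \<le> m1 \<bullet> p\<close> by (simp add: inner_add_right)
        then have "0 \<le> s" using m1 by (simp add: mult_le_0_iff)
        then show ?thesis using s zy zc by blast
      next
        case True
        obtain \<tau> x where tx: "z = (\<tau>, coset x \<tau>)" "\<tau> \<in> \<Sigma>" "\<tau> \<subseteq> \<sigma>"
          by (rule chart_pointE[OF zc])
        have ex: "\<exists>t\<in>\<tau>. m1 \<bullet> t \<noteq> 0" using True unfolding tx(1) monomial_value_coset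
          by (auto split: if_splits)
        have "monomial_value z m2 = ereal (m2 \<bullet> p)" using z by (simp add: N_def)
        then have o2: "\<forall>t\<in>\<tau>. m2 \<bullet> t = 0" "m2 \<bullet> x = m2 \<bullet> p"
          unfolding tx(1) monomial_value_coset by (auto split: if_splits)
        have "\<forall>t\<in>\<tau>. m1 \<bullet> t \<le> 0" using m(1) tx(3) by (auto simp: chart_monomials_def)
        then have \<tau>: "\<tau> = half_line u" using cone_on_line[OF tx(2) u m2 o2(1) m1 _ ex] by blast
        obtain s where s: "x = p + s *\<^sub>R u" using on_line o2(2) by blast
        have "coset x \<tau> = coset p \<tau>"
        proof -
          have su: "s *\<^sub>R u \<in> span \<tau>" unfolding \<tau> span_half_line by (simp add: span_mul span_base)
          show ?thesis
          proof (intro set_eqI iffI)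
            fix w assume "w \<in> coset x \<tau>"
            then obtain v where "v \<in> span \<tau>" "w = p + (s *\<^sub>R u + v)" using s by (auto simp: add.assoc)
            then show "w \<in> coset p \<tau>" using span_add[OF su] by blast
          next
            fix w assume "w \<in> coset p \<tau>"
            then obtain v where "v \<in> span \<tau>" "w = x + (v - s *\<^sub>R u)" using s by (auto simp: algebra_simps)
            then show "w \<in> coset x \<tau>" using span_diff[OF _ su] by blast
          qed
        qed
        then have "z = ray_end p u" using tx(1) \<tau> by (simp add: ray_end_def)
        then show ?thesis using zc by blast
      qed
    qed
  qed
  ultimately show ?thesis by simp
qed

text \<open>Some monomial \<open>m1\<close> of the chart increases along the ray. As its values on the chart are below
  infinity, every point of the chart has a neighbourhood that meets only a bounded part of the ray. On
  this part an independent monomial \<open>m2\<close> is bounded below, so the ray has no limit outside of the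
  plane in this chart.\<close>

lemma closedin_ray_chart:
  assumes \<sigma>: "\<sigma> \<in> \<Sigma>" "u \<notin> \<sigma>" and u: "u \<noteq> 0"
  shows "closedin (chart_topology \<Sigma> \<sigma>)
    ((embed ` closed_ray p u \<union> {ray_end p u}) \<inter> chart \<Sigma> \<sigma>)"
proof -
  let ?R = "closed_ray p u"
  obtain S where S: "S \<subseteq> dom P" "S \<noteq> {}" "\<sigma> = {u. \<forall>k\<in>S. \<forall>y\<in>dom P. u \<bullet> pt y \<le> u \<bullet> pt k}"
    by (rule fan_coneE[OF \<sigma>(1)])
  then obtain k y where k: "k \<in> S" "k \<in> dom P" and y: "y \<in> dom P" "\<not> u \<bullet> pt y \<le> u \<bullet> pt k"
    using \<sigma>(2) by blast
  define m1 where "m1 = pt y - pt k"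
  have "u \<bullet> m1 > 0" using y by (simp add: m1_def inner_diff_right)
  then have m1: "m1 \<bullet> u > 0" by (simp add: inner_commute)
  then have "rot m1 \<noteq> 0" by auto
  then obtain y' where y': "y' \<in> dom P" "rot m1 \<bullet> (pt y' - pt k) \<noteq> 0" using full k by blast
  define m2 where "m2 = pt y' - pt k"
  have cr: "cross m1 m2 \<noteq> 0" using y' by (simp add: m2_def inner_rot)
  have m: "m1 \<in> chart_monomials \<sigma>" "m2 \<in> chart_monomials \<sigma>"
    using exponent_difference_chart[OF S(3) k(1)] y y' by (auto simp: m1_def m2_def)
  have no_end: "ray_end p u \<notin> chart \<Sigma> \<sigma>"
  proof
    assume "ray_end p u \<in> chart \<Sigma> \<sigma>"
    then have "half_line u \<subseteq> \<sigma>" by (auto simp: chart_def ray_end_def dest: face_of_imp_subset)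
    moreover have "u \<in> half_line u" by (auto simp: half_line_def intro: exI[of _ 1])
    ultimately show False using \<sigma>(2) by blast
  qed
  (* On the ray, m1 is smaller than its value at parameter c only for parameters smaller than c, and
     there m2 is bounded below. So all points of the ray satisfy all of these conditions, whereas a
     point with finite m1 at which m2 is minus infinity violates them for large c. *)
  define N where "N c = {z \<in> chart \<Sigma> \<sigma>. monomial_value z m1 \<in> {ereal (m1 \<bullet> p + c * (m1 \<bullet> u))..}} \<union>
     {z \<in> chart \<Sigma> \<sigma>. monomial_value z m2 \<in> {ereal (m2 \<bullet> p - c * \<bar>m2 \<bullet> u\<bar>)..}}" for c
  define M where "M = {z \<in> chart \<Sigma> \<sigma>. monomial_value z m1 \<in> {ereal (m1 \<bullet> p)..}}"
  have "closedin (chart_topology \<Sigma> \<sigma>) ((M \<inter> (\<Inter>c\<in>{0<..}. N c)) - embed ` (- ?R) \<inter> chart \<Sigma> \<sigma>)"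
  proof (intro closedin_diff closedin_Int closedin_INT)
    show "closedin (chart_topology \<Sigma> \<sigma>) M"
      unfolding M_def using m by (intro closedin_chart_preimage) auto
    show "openin (chart_topology \<Sigma> \<sigma>) (embed ` (- ?R) \<inter> chart \<Sigma> \<sigma>)"
      using closed_closed_ray[OF u] by (intro openin_embed_chart \<sigma>) (simp add: open_Compl)
    show "{0::real<..} \<noteq> {}" by (metis empty_iff greaterThan_iff zero_less_one)
    fix c :: real
    show "closedin (chart_topology \<Sigma> \<sigma>) (N c)"
      unfolding N_def using m by (intro closedin_Un closedin_chart_preimage) auto
  qed
  moreover have "(M \<inter> (\<Inter>c\<in>{0<..}. N c)) - embed ` (- ?R) \<inter> chart \<Sigma> \<sigma> = embed ` ?R \<inter> chart \<Sigma> \<sigma>" (is "?L = ?S")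
  proof
    show "?L \<subseteq> ?S"
    proof
      fix z assume z: "z \<in> ?L"
      then have zM: "z \<in> M" and zN: "\<And>c. c > 0 \<Longrightarrow> z \<in> N c" by auto
      have zc: "z \<in> chart \<Sigma> \<sigma>" using zM by (simp add: M_def)
      obtain \<tau> x where tx: "z = (\<tau>, coset x \<tau>)" "\<tau> \<in> \<Sigma>" "\<tau> \<subseteq> \<sigma>"
        by (rule chart_pointE[OF zc])
      have v1: "monomial_value z m1 \<noteq> -\<infinity>" using zM by (auto simp: M_def)
      then have v1x: "monomial_value z m1 = ereal (m1 \<bullet> x)"
        unfolding tx(1) monomial_value_coset by metis
      have "monomial_value z m2 \<noteq> -\<infinity>"
      proof
        assume v2: "monomial_value z m2 = -\<infinity>"
        define c where "c = (\<bar>m1 \<bullet> x - m1 \<bullet> p\<bar> + 1) / (m1 \<bullet> u)"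
        have c: "c > 0" "c * (m1 \<bullet> u) = \<bar>m1 \<bullet> x - m1 \<bullet> p\<bar> + 1" using m1 by (auto simp: c_def)
        have "m1 \<bullet> p + c * (m1 \<bullet> u) \<le> m1 \<bullet> x" using zN[OF c(1)] v1x v2 by (auto simp: N_def)
        then show False using c(2) by linarith
      qed
      then obtain w where "z = embed w" using chart_planar_point[OF zc cr v1] by metis
      then show "z \<in> ?S" using z zc by blast
    qed
    show "?S \<subseteq> ?L"
    proof
      fix z assume "z \<in> ?S"
      then obtain s where s: "0 \<le> s" "z = embed (p + s *\<^sub>R u)" and zc: "z \<in> chart \<Sigma> \<sigma>" by blast
      have "0 \<le> s * (m1 \<bullet> u)" using s m1 by simp
      then have zM: "z \<in> M" using zc s by (simp add: M_def inner_add_right)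
      have zN: "z \<in> N c" if "c > 0" for c
      proof (cases "c \<le> s")
        case True
        then have "c * (m1 \<bullet> u) \<le> s * (m1 \<bullet> u)" using m1 by (intro mult_right_mono) auto
        then show ?thesis using zc s by (simp add: N_def inner_add_right)
      next
        case False
        have "- (s * (m2 \<bullet> u)) \<le> \<bar>s * (m2 \<bullet> u)\<bar>" by linarith
        also have "\<dots> \<le> c * \<bar>m2 \<bullet> u\<bar>" using s False by (simp add: abs_mult mult_right_mono)
        finally show ?thesis using zc s by (simp add: N_def inner_add_right)
      qed
      have "p + s *\<^sub>R u \<in> ?R" using s(1) by blast
      then have "embed (p + s *\<^sub>R u) \<notin> embed ` (- ?R)"
        by (simp only: image_iff embed_eq_iff) blast
      then show "z \<in> ?L" using zM zN s(2) by (intro DiffI IntI INT_I) simp_all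
    qed
  qed
  ultimately show ?thesis using no_end by (simp add: Int_Un_distrib2 Int_insert_left)
qed

lemma closure_of_ray:
  assumes u: "u \<noteq> 0" and ab: "a \<noteq> b" "a \<in> dom P" "b \<in> dom P"
    and top: "\<And>k. k \<in> dom P \<Longrightarrow> u \<bullet> pt k \<le> u \<bullet> pt a" "u \<bullet> pt b = u \<bullet> pt a"
  shows "surface_of P closure_of (embed ` open_ray p u)
    \<subseteq> embed ` closed_ray p u \<union> {ray_end p u}"
proof -
  let ?X = "(embed ` closed_ray p u \<union> {ray_end p u}) \<inter> toric_points \<Sigma>"
  have "closedin (surface_of P) ?X"
  proof (rule closedin_toric_surface)
    fix \<sigma> assume \<sigma>: "\<sigma> \<in> \<Sigma>"
    have "?X \<inter> chart \<Sigma> \<sigma> = (embed ` closed_ray p u \<union> {ray_end p u}) \<inter> chart \<Sigma> \<sigma>"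
      by (auto simp: chart_def)
    then show "closedin (chart_topology \<Sigma> \<sigma>) (?X \<inter> chart \<Sigma> \<sigma>)"
      using closedin_ray_chart[OF \<sigma> _ u, of p] closedin_ray_chart_limit[OF \<sigma> _ u ab top, of p]
      by (cases "u \<in> \<sigma>") simp_all
  qed simp
  moreover have "embed ` open_ray p u \<subseteq> ?X"
  proof
    fix z assume "z \<in> embed ` open_ray p u"
    then obtain s where s: "0 < s" "z = embed (p + s *\<^sub>R u)" by blast
    then have "p + s *\<^sub>R u \<in> closed_ray p u" by (intro CollectI exI[of _ s]) simp
    then show "z \<in> ?X" using s embed_in_surface by blast
  qed
  ultimately have "surface_of P closure_of (embed ` open_ray p u) \<subseteq> ?X"
    by (intro closure_of_minimal)
  then show ?thesis by blast
qed

end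


section \<open>The compactified curve as a graph\<close>

text \<open>Cramer's rule gives a point where both inequalities are equalities.\<close>

lemma half_planes_meet:
  fixes w z :: plane
  assumes "cross w z \<noteq> 0"
  shows "\<exists>x. \<alpha> \<le> w \<bullet> x \<and> \<beta> \<le> z \<bullet> x"
proof -
  define x where "x = ((\<alpha> * snd z - \<beta> * snd w) / cross w z, (\<beta> * fst w - \<alpha> * fst z) / cross w z)"
  have "w \<bullet> x = (fst w * (\<alpha> * snd z - \<beta> * snd w) + snd w * (\<beta> * fst w - \<alpha> * fst z)) / cross w z"
    by (simp add: x_def inner_prod_def add_divide_distrib)
  also have "fst w * (\<alpha> * snd z - \<beta> * snd w) + snd w * (\<beta> * fst w - \<alpha> * fst z) = \<alpha> * cross w z"
    by (simp add: cross_def algebra_simps)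
  finally have "w \<bullet> x = \<alpha>" using assms by simp
  moreover have "z \<bullet> x = (fst z * (\<alpha> * snd z - \<beta> * snd w) + snd z * (\<beta> * fst w - \<alpha> * fst z)) / cross w z"
    by (simp add: x_def inner_prod_def add_divide_distrib)
  then have "z \<bullet> x = \<beta> * cross w z / cross w z"
    by (simp add: cross_def algebra_simps)
  then have "z \<bullet> x = \<beta>" using assms by simp
  ultimately show ?thesis by (intro exI[of _ x]) simp
qed

context nonsingular_curve
begin

abbreviation X :: "tpoint topology" where "X \<equiv> surface_of P"

lemma embed_image_iff [simp]: "embed x \<in> embed ` S \<longleftrightarrow> x \<in> S"
  by (simp add: image_iff embed_eq_iff)

lemma planar_closure_of: "embed x \<in> X closure_of (embed ` S) \<longleftrightarrow> x \<in> closure S"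
proof
  assume x: "embed x \<in> X closure_of (embed ` S)"
  show "x \<in> closure S"
  proof (rule ccontr)
    assume "x \<notin> closure S"
    then have "embed x \<in> embed ` (- closure S)" by simp
    moreover have "openin X (embed ` (- closure S))"
      by (intro openin_embed) (simp add: open_Compl)
    ultimately obtain z where "z \<in> embed ` S" "z \<in> embed ` (- closure S)"
      using x unfolding in_closure_of by metis
    then obtain y where "y \<in> S" "embed y \<in> embed ` (- closure S)" by blast
    then have "y \<in> S" "y \<notin> closure S" by simp_all
    then show False using closure_subset by (metis subsetD)
  qed
next
  assume "x \<in> closure S"
  then show "embed x \<in> X closure_of (embed ` S)"
    using continuous_map_image_closure_subset[OF continuous_map_embed, of S] by auto
qed

lemma closure_of_bounded:
  assumes "bounded S"
  shows "X closure_of (embed ` S) = embed ` closure S"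
proof
  have "closedin X (embed ` closure S)"
    using assms by (intro closedin_embed_compact) simp
  then show "X closure_of (embed ` S) \<subseteq> embed ` closure S"
    using closure_subset by (intro closure_of_minimal image_mono)
qed (use planar_closure_of in blast)

lemma planar_closed_edge: "embed x \<in> closed_edge P e \<longleftrightarrow> x \<in> closure e"
  unfolding closed_edge_def by (rule planar_closure_of)

lemma closedin_closed_edge: "closedin X (closed_edge P e)"
  unfolding closed_edge_def by simp

lemma closed_edge_bounded: "e \<in> bounded_edges P \<Longrightarrow> closed_edge P e = embed ` closure e"
  unfolding closed_edge_def bounded_edges_def by (intro closure_of_bounded) auto

lemma bounded_edge_segmentE:
  assumes "e \<in> bounded_edges P"
  obtains p q where "p \<noteq> q" "e = open_segment p q"
  using assms by (rule bounded_edgeE)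

lemma ends_open_segment:
  fixes p q :: plane
  assumes "p \<noteq> q"
  shows "closure (open_segment p q) - open_segment p q = {p, q}"
  unfolding open_segment_def closure_open_segment[unfolded open_segment_def]
  using assms by auto

lemma edge_ends_bounded:
  assumes "open_segment p q \<in> bounded_edges P" "p \<noteq> q"
  shows "edge_ends P (open_segment p q) = {embed p, embed q}"
proof -
  have "edge_ends P (open_segment p q) = embed ` (closed_segment p q - open_segment p q)"
    unfolding edge_ends_def closed_edge_bounded[OF assms(1)]
    using assms(2) by (auto simp: embed_eq_iff)
  also have "closed_segment p q - open_segment p q = {p, q}"
    by (auto simp: open_segment_def)
  finally show ?thesis by simp
qed

text \<open>A point at infinity of an unbounded edge determines the edge: its cone gives the direction of the
  edge, and its coset gives the line that contains it.\<close>

lemma closed_edges_meet_in_plane: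
  assumes e: "e \<in> edges P" and f: "f \<in> edges P" and "e \<noteq> f"
    and z: "z \<in> closed_edge P e" "z \<in> closed_edge P f"
  obtains x where "z = embed x"
proof (cases "z \<in> range embed")
  case True then show thesis using that by blast
next
  case False
  have dirs: "\<exists>p u. u \<noteq> 0 \<and> g = open_ray p u \<and> z = ray_end p u"
    if g: "g \<in> edges P" "z \<in> closed_edge P g" for g
  proof -
    have "g \<notin> bounded_edges P" using g closed_edge_bounded False by blast
    with g(1) obtain a b p u where ab: "a \<noteq> b" "g = cell P {a, b}" and pu: "u \<noteq> 0" "g = open_ray p u"
      and p: "{a, b} \<subset> attained P p"
      and top: "\<And>k. k \<in> dom P \<Longrightarrow> u \<bullet> pt k \<le> u \<bullet> pt a" "u \<bullet> pt b = u \<bullet> pt a"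
      by (rule unbounded_edgeE) (rule that; assumption)
    have "a \<in> dom P" "b \<in> dom P" using p attained_subset by blast+
    then have "closed_edge P g \<subseteq> embed ` closed_ray p u \<union> {ray_end p u}"
      unfolding closed_edge_def pu(2) using closure_of_ray[OF pu(1) ab(1) _ _ top] by blast
    then show ?thesis using pu g(2) False by blast
  qed
  obtain p u where pu: "u \<noteq> 0" "e = open_ray p u" "z = ray_end p u" using dirs[OF e z(1)] by blast
  obtain q w where qw: "w \<noteq> 0" "f = open_ray q w" "z = ray_end q w" using dirs[OF f z(2)] by blast
  have "w \<in> half_line w" by (auto simp: half_line_def intro: exI[of _ 1])
  also have "half_line w = half_line u" using pu(3) qw(3) by (simp add: ray_end_def)
  finally obtain l where l: "w = l *\<^sub>R u" "0 \<le> l" by (auto simp: half_line_def)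
  have l0: "l > 0" using l qw(1) by (cases "l = 0") auto
  have "q \<in> coset q (half_line w)" using span_zero by (intro image_eqI[of _ _ 0]) auto
  also have "\<dots> = coset p (half_line u)"
    using pu(3) qw(3) unfolding ray_end_def by (metis prod.inject)
  finally obtain c where c: "q = p + c *\<^sub>R u"
    unfolding span_half_line span_singleton by blast
  (* Far enough out, the two rays run on the same part of their common line. *)
  define s where "s = (\<bar>c\<bar> + 1) / l"
  have s: "s > 0" "c + s * l > 0" using l0 by (auto simp: s_def)
  have "q + s *\<^sub>R w = p + (c + s * l) *\<^sub>R u" unfolding c l(1) by (simp add: algebra_simps)
  then have "q + s *\<^sub>R w \<in> e" "q + s *\<^sub>R w \<in> f" using pu(2) qw(2) s by blast+
  then have "e = f" using edge_closure_disjoint[OF e f] closure_subset by blast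
  then show thesis using \<open>e \<noteq> f\<close> by simp
qed

lemma curve_eq: "curve P = (\<Union>e\<in>edges P. closed_edge P e)"
proof
  have "embed ` planar_curve P \<subseteq> (\<Union>e\<in>edges P. closed_edge P e)"
    unfolding planar_curve_eq using planar_closed_edge by blast
  moreover have "closedin X (\<Union>e\<in>edges P. closed_edge P e)"
    using finite_edges closedin_closed_edge by (intro closedin_Union) auto
  ultimately show "curve P \<subseteq> (\<Union>e\<in>edges P. closed_edge P e)"
    unfolding curve_def by (rule closure_of_minimal)
  have "e \<subseteq> planar_curve P" if "e \<in> edges P" for e
    unfolding planar_curve_eq using that closure_subset by blast
  then show "(\<Union>e\<in>edges P. closed_edge P e) \<subseteq> curve P"
    unfolding curve_def closed_edge_def by (intro UN_least closure_of_mono image_mono)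
qed

lemma edge_disjoint_closed_edge:
  assumes "e \<in> edges P" "f \<in> edges P" "e \<noteq> f"
  shows "embed ` e \<inter> closed_edge P f = {}"
  using edge_closure_disjoint[OF assms(1,2)] assms(3) planar_closed_edge by blast

lemma connected_closed_edge:
  assumes "e \<in> edges P"
  shows "connectedin X (closed_edge P e)"
proof -
  obtain a b where "e = cell P {a, b}" using assms by (rule edgeE)
  then have "connected e" using convex_cell convex_connected by blast
  then show ?thesis unfolding closed_edge_def
    by (intro connectedin_closure_of connectedin_continuous_map_image[OF continuous_map_embed]) simp
qed

lemma two_ends:
  assumes e: "e \<in> edges P" and xy: "x \<in> closure e - e" "y \<in> closure e - e" "x \<noteq> y"
  shows "e \<in> bounded_edges P" "e = open_segment x y"
proof -
  have "e \<in> bounded_edges P \<and> e = open_segment x y"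
  proof (cases "e \<in> bounded_edges P")
    case True
    then obtain p q where pq: "p \<noteq> q" "e = open_segment p q" by (rule bounded_edge_segmentE)
    have "closure e - e = {p, q}" unfolding pq(2) by (rule ends_open_segment[OF pq(1)])
    then have "{x, y} = {p, q}" using xy by auto
    then have "open_segment x y = open_segment p q" by (metis doubleton_eq_iff open_segment_commute)
    then show ?thesis using True pq by simp
  next
    case False
    with e obtain a b p u where "a \<noteq> b" "e = cell P {a, b}" and pu: "u \<noteq> 0" "e = open_ray p u"
      and "{a, b} \<subset> attained P p"
      and "\<And>k. k \<in> dom P \<Longrightarrow> u \<bullet> pt k \<le> u \<bullet> pt a" "u \<bullet> pt b = u \<bullet> pt a"
      by (rule unbounded_edgeE) (rule that; assumption)
    have "closure e \<subseteq> closed_ray p u"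
      by (rule closure_minimal[OF _ closed_closed_ray[OF pu(1)]]) (use pu(2) less_imp_le in blast)
    then have "w = p" if w: "w \<in> closure e - e" for w
    proof -
      obtain s where s: "w = p + s *\<^sub>R u" "0 \<le> s" using \<open>closure e \<subseteq> _\<close> w by blast
      have "\<not> 0 < s" using s(1) w pu(2) by blast
      then show ?thesis using s by simp
    qed
    then show ?thesis using xy by metis
  qed
  then show "e \<in> bounded_edges P" "e = open_segment x y" by auto
qed

lemma finite_ends:
  assumes "e \<in> bounded_edges P"
  shows "finite (closure e - e)"
proof -
  from assms obtain p q where pq: "p \<noteq> q" "e = open_segment p q" by (rule bounded_edge_segmentE)
  have "closure e - e = {p, q}" unfolding pq(2) by (rule ends_open_segment[OF pq(1)])
  then show ?thesis by simp
qed

lemma finite_bounded_edges: "finite (bounded_edges P)"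
  using finite_edges by (rule finite_subset[rotated]) (auto simp: bounded_edges_def)

lemma bounded_edge_is_edge: "e \<in> bounded_edges P \<Longrightarrow> e \<in> edges P"
  by (simp add: bounded_edges_def)

section \<open>Connectedness of the curve\<close>

lemma frontier_region_subset: "frontier (cell P {a}) \<subseteq> planar_curve P"
proof
  fix x assume x: "x \<in> frontier (cell P {a})"
  then have "x \<in> closure (cell P {a})" "x \<notin> cell P {a}"
    using open_region[of a] by (auto simp: frontier_def interior_open)
  then have "a \<in> attained P x" "attained P x \<noteq> {a}" using closure_cell[of x "{a}"] by auto
  then show "x \<in> planar_curve P" using planar_curve_region by (metis singletonD)
qed

text \<open>The complement is the union of the half-planes on which another monomial is at least the one of
  \<open>a\<close>. Half-planes meet unless their boundaries are parallel. The half-planes of two exponents \<open>y\<close> and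
  \<open>z\<close> that are not collinear with \<open>a\<close> meet, and every other one meets at least one of these two.\<close>

lemma connected_compl_region: "connected (- cell P {a})"
proof (cases "a \<in> dom P")
  case False
  then have "cell P {a} = {}" using attained_subset by fastforce
  then show ?thesis by (simp add: connected_UNIV)
next
  case True
  define H where "H k = {x. monomial P a x \<le> monomial P k x}" for k
  have H: "H k = {x. (pt k - pt a) \<bullet> x \<ge> the (P a) - the (P k)}" for k
    by (auto simp: H_def monomial_eq inner_diff_left)
  have conv: "connected (H k)" for k
    unfolding H by (intro convex_connected convex_halfspace_ge)
  have compl: "- cell P {a} = (\<Union>k\<in>dom P - {a}. H k)"
  proof (intro set_eqI iffI)
    fix x assume "x \<in> - cell P {a}"
    then obtain k where "k \<in> attained P x" "k \<noteq> a"
      using attained_nonempty[of x] by (metis ComplD mem_cell subset_singletonD subsetI singletonI)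
    then show "x \<in> (\<Union>k\<in>dom P - {a}. H k)" using True by (auto simp: H_def attained_iff)
  next
    fix x assume "x \<in> (\<Union>k\<in>dom P - {a}. H k)"
    then obtain k where "k \<in> dom P" "k \<noteq> a" "monomial P a x \<le> monomial P k x" by (auto simp: H_def)
    then have "attained P x \<noteq> {a}" by (metis attained_iff attained_less insertI1 linorder_not_less singletonD)
    then show "x \<in> - cell P {a}" by simp
  qed
  obtain y where y: "y \<in> dom P" "(1, 0) \<bullet> (pt y - pt a) \<noteq> 0"
    using full[of "(1, 0)" a] True by (auto simp: zero_prod_def)
  then have ya: "y \<noteq> a" by auto
  then have "rot (pt y - pt a) \<noteq> 0" by simp
  then obtain z where z: "z \<in> dom P" "rot (pt y - pt a) \<bullet> (pt z - pt a) \<noteq> 0" using full True by blast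
  have yz: "orient a y z \<noteq> 0" using z by (simp add: inner_rot)
  then have za: "z \<noteq> a" by (auto simp: cross_def)
  have meet: "H k \<inter> H l \<noteq> {}" if "orient a k l \<noteq> 0" for k l
    using half_planes_meet[OF that, of "the (P a) - the (P k)" "the (P a) - the (P l)"] unfolding H by blast
  have hub: "connected (H y \<union> H z)" using meet[OF yz] conv by (intro connected_Un)
  have "connected (H k \<union> (H y \<union> H z))" if k: "k \<in> dom P - {a}" for k
  proof -
    have "orient a k y \<noteq> 0 \<or> orient a k z \<noteq> 0"
    proof (rule ccontr)
      assume "\<not> ?thesis"
      then have "rot (pt k - pt a) \<bullet> (pt y - pt a) = 0" "rot (pt k - pt a) \<bullet> (pt z - pt a) = 0"
        by (auto simp: inner_rot)
      moreover have "rot (pt k - pt a) \<noteq> 0" using k by simp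
      ultimately show False using orthogonal_cross yz by blast
    qed
    then have "H k \<inter> (H y \<union> H z) \<noteq> {}" using meet by blast
    then show ?thesis by (rule connected_Un[OF conv hub])
  qed
  moreover have "H y \<noteq> {}" using meet[OF yz] by blast
  ultimately have "connected (\<Union>k\<in>dom P - {a}. H k \<union> (H y \<union> H z))"
    by (intro connected_Union) auto
  also have "(\<Union>k\<in>dom P - {a}. H k \<union> (H y \<union> H z)) = (\<Union>k\<in>dom P - {a}. H k)"
    using y(1) z(1) ya za by blast
  finally show ?thesis using compl by simp
qed

text \<open>The plane is unicoherent, and it is the union of the closed region and the complement of the
  region, both of which are closed and connected.\<close>

lemma connected_frontier_region: "connected (frontier (cell P {a}))"
proof -
  have "connected (closure (cell P {a}) \<inter> - cell P {a})"
  proof (rule unicoherentD[OF unicoherent_UNIV])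
    show "connected (closure (cell P {a}))"
      using convex_cell convex_connected connected_imp_connected_closure by blast
    show "UNIV = closure (cell P {a}) \<union> - cell P {a}" using closure_subset by blast
    show "closedin (top_of_set UNIV) (- cell P {a})"
      using open_region[of a] by (simp add: closed_Compl)
  qed (use connected_compl_region[of a] in simp_all)
  also have "closure (cell P {a}) \<inter> - cell P {a} = frontier (cell P {a})"
    using open_region[of a] by (auto simp: frontier_def interior_open)
  finally show ?thesis .
qed

text \<open>If the curve fell into two closed parts, then the connected boundary of each region would lie in one
  of them. Adding every region to the part of its boundary would disconnect the plane.\<close>

lemma connected_planar_curve: "connected (planar_curve P)"
proof (rule ccontr)
  assume "\<not> connected (planar_curve P)"
  then obtain U V where UV: "closed U" "closed V" "U \<union> V = planar_curve P" "U \<inter> V = {}" "U \<noteq> {}" "V \<noteq> {}"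
    unfolding connected_closed_set[OF closed_planar_curve] by metis
  (* R W is the union of the closed regions whose boundary lies in W. *)
  define R where "R W = (\<Union>a\<in>{a \<in> dom P. frontier (cell P {a}) \<subseteq> W}. closure (cell P {a}))" for W
  have closedR: "closed (R W)" for W unfolding R_def using fin by (intro closed_UN) auto
  have side: "frontier (cell P {a}) \<subseteq> U \<or> frontier (cell P {a}) \<subseteq> V" for a
    using connected_closedD[OF connected_frontier_region[of a], of U V] UV frontier_region_subset[of a] by blast
  have cl: "x \<in> cell P {a} \<or> x \<in> frontier (cell P {a})" if "x \<in> closure (cell P {a})" for x a
    using that open_region[of a] by (simp add: frontier_def interior_open)
  have no_region: "x \<notin> cell P {a}" if "x \<in> U \<union> V" for x a
    using that UV(3) planar_curve_region[of x] by (metis mem_cell)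
  have RW: "x \<in> W" if x: "x \<in> R W" "x \<in> U \<union> V" for x W
    using x cl no_region unfolding R_def by blast
  have "U \<inter> R V = {}" "V \<inter> R U = {}" using RW UV(4) by blast+
  moreover have "R U \<inter> R V = {}"
  proof (rule ccontr)
    assume "R U \<inter> R V \<noteq> {}"
    then obtain x a b where a: "x \<in> closure (cell P {a})" "frontier (cell P {a}) \<subseteq> U"
      and b: "x \<in> closure (cell P {b})" "frontier (cell P {b}) \<subseteq> V" by (auto simp: R_def)
    show False
    proof (cases "x \<in> U \<union> V")
      case True
      then show False using cl[OF a(1)] cl[OF b(1)] no_region[OF True] a(2) b(2) UV(4) by blast
    next
      case False
      then have "x \<in> cell P {a}" "x \<in> cell P {b}" using cl[OF a(1)] cl[OF b(1)] a(2) b(2) by blast+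
      then have "a = b" by simp
      then have "frontier (cell P {a}) = {}" using a(2) b(2) UV(4) by blast
      then have "cell P {a} = {} \<or> cell P {a} = UNIV" by (simp add: frontier_eq_empty)
      then show False using \<open>x \<in> cell P {a}\<close> UV(5) no_region by blast
    qed
  qed
  ultimately have "(U \<union> R U) \<inter> (V \<union> R V) = {}" using UV(4) by blast
  moreover have "(U \<union> R U) \<union> (V \<union> R V) = UNIV"
  proof -
    have "x \<in> U \<union> V \<union> R U \<union> R V" for x
    proof (cases "x \<in> planar_curve P")
      case False
      then obtain a where a: "attained P x = {a}" using planar_curve_region by blast
      then have "a \<in> dom P" using attained_subset by blast
      moreover have "x \<in> closure (cell P {a})" using a closure_subset by fastforce
      ultimately show ?thesis using side[of a] unfolding R_def by blast
    qed (use UV(3) in blast)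
    then show ?thesis by blast
  qed
  moreover have "closed (U \<union> R U)" "closed (V \<union> R V)" using UV closedR by auto
  ultimately show False
    using connected_closedD[OF connected_UNIV, of "U \<union> R U" "V \<union> R V"] UV(5,6) by auto
qed

lemma connected_curve: "connectedin X (curve P)"
  unfolding curve_def
  by (intro connectedin_closure_of connectedin_continuous_map_image[OF continuous_map_embed])
     (simp add: connected_planar_curve)

end


section \<open>Cycles and cuts\<close>

abbreviation side :: "(nat \<Rightarrow> plane) \<Rightarrow> nat \<Rightarrow> nat \<Rightarrow> plane set" where
  "side v n i \<equiv> open_segment (v i) (v (Suc i mod n))"

abbreviation closed_side :: "(nat \<Rightarrow> plane) \<Rightarrow> nat \<Rightarrow> nat \<Rightarrow> plane set" where
  "closed_side v n i \<equiv> closed_segment (v i) (v (Suc i mod n))"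

context nonsingular_curve
begin

lemma polygon_vertices_distinct:
  fixes v :: "nat \<Rightarrow> plane"
  assumes "2 \<le> n" "inj_on v {..<n}" "i < n"
  shows "v i \<noteq> v (Suc i mod n)"
proof -
  have "Suc i mod n \<noteq> i" using assms by (cases "Suc i = n") auto
  then show ?thesis using assms unfolding inj_on_def
    by (metis lessThan_iff less_le_trans mod_less_divisor pos2)
qed

lemma polygon_edges_distinct:
  fixes v :: "nat \<Rightarrow> plane"
  assumes n: "3 \<le> n" and inj: "inj_on v {..<n}"
  shows "inj_on (side v n) {..<n}"
proof (rule inj_onI)
  fix i j assume ij: "i \<in> {..<n}" "j \<in> {..<n}"
    and eq: "side v n i = side v n j"
  have lt: "Suc i mod n < n" for i using n by simp
  have vneq: "v i \<noteq> v (Suc i mod n)" if "i < n" for i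
    using polygon_vertices_distinct[OF _ inj that] n by simp
  from eq have "{v i, v (Suc i mod n)} = {v j, v (Suc j mod n)}"
    using vneq[of i] ij unfolding open_segment_eq by (metis lessThan_iff)
  then have "i = j \<or> (i = Suc j mod n \<and> j = Suc i mod n)"
    using inj ij lt unfolding inj_on_def doubleton_eq_iff by (metis lessThan_iff)
  then show "i = j"
  proof
    assume *: "i = Suc j mod n \<and> j = Suc i mod n"
    have "(Suc k = n \<and> Suc k mod n = 0) \<or> Suc k mod n = Suc k" if "k < n" for k
      using that by (cases "Suc k = n") simp_all
    then have "(Suc j = n \<and> i = 0) \<or> i = Suc j" "(Suc i = n \<and> j = 0) \<or> j = Suc i"
      using * ij unfolding lessThan_iff by metis+
    then show "i = j" using n by linarith
  qed
qed

lemma cycle_of_polygon: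
  fixes v :: "nat \<Rightarrow> plane"
  assumes n: "3 \<le> n" and inj: "inj_on v {..<n}"
    and e: "\<And>i. i < n \<Longrightarrow> side v n i \<in> bounded_edges P"
  shows "cycle P (side v n ` {..<n})"
proof -
  let ?e = "side v n"
  have vneq: "v i \<noteq> v (Suc i mod n)" if "i < n" for i
    using polygon_vertices_distinct[OF _ inj that] n by simp
  have "inj_on ?e {..<n}" using polygon_edges_distinct[OF n inj] .
  moreover have "inj_on (embed \<circ> v) {..<n}"
    using inj by (auto simp: inj_on_def embed_eq_iff)
  moreover have "?e i \<in> edges P" "edge_ends P (?e i) = {(embed \<circ> v) i, (embed \<circ> v) (Suc i mod n)}"
    if "i < n" for i
    using e[OF that] edge_ends_bounded[OF e[OF that] vneq[OF that]] bounded_edge_is_edge by auto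
  moreover have "0 < n" using n by simp
  ultimately show ?thesis
    unfolding cycle_def by (intro exI[of _ n] exI[of _ "embed \<circ> v"] exI[of _ ?e]) auto
qed

definition adjacent :: "plane set set \<Rightarrow> (plane \<times> plane) set" where
  "adjacent E = {(x, y). x \<noteq> y \<and> open_segment x y \<in> E}"

text \<open>A shortest path does not repeat a point.\<close>

lemma simple_path:
  assumes "(p, q) \<in> R\<^sup>*"
  obtains f and n :: nat where "f 0 = p" "f n = q" "\<And>i. i < n \<Longrightarrow> (f i, f (Suc i)) \<in> R" "inj_on f {..n}"
proof -
  define Q where "Q n \<longleftrightarrow> (p, q) \<in> R ^^ n" for n
  have "\<exists>n. Q n" using assms by (simp add: Q_def rtrancl_power)
  then have Qn: "Q (LEAST n. Q n)" by (rule LeastI_ex)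
  define n where "n = (LEAST n. Q n)"
  have least: "n \<le> m" if "Q m" for m using that by (simp add: n_def Least_le)
  have "(p, q) \<in> R ^^ n" using Qn[folded n_def] unfolding Q_def .
  then obtain f where "f 0 = p \<and> f n = q \<and> (\<forall>i<n. (f i, f (Suc i)) \<in> R)"
    unfolding relpow_fun_conv by blast
  then have f: "f 0 = p" "f n = q" "\<And>i. i < n \<Longrightarrow> (f i, f (Suc i)) \<in> R" by auto
  have "i = j" if ij: "i \<le> j" "j \<le> n" "f i = f j" for i j
  proof (rule ccontr)
    assume "i \<noteq> j"
    then have lt: "i < j" using ij by simp
    have "(p, q) \<in> R ^^ (n - (j - i))"
      unfolding relpow_fun_conv
    proof (intro exI[of _ "\<lambda>k. if k \<le> i then f k else f (k + (j - i))"] conjI allI impI)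
      fix k assume "k < n - (j - i)"
      then show "((if k \<le> i then f k else f (k + (j - i))),
          (if Suc k \<le> i then f (Suc k) else f (Suc k + (j - i)))) \<in> R"
        using f(3)[of k] f(3)[of "k + (j - i)"] ij lt
        by (cases k i rule: linorder_cases) auto
    next
      have "f i = q" if "n - (j - i) \<le> i"
      proof -
        have "j = n" using that ij lt by linarith
        then show ?thesis using ij f by simp
      qed
      moreover have "n - (j - i) = i" if "n - (j - i) \<le> i" using that ij lt by linarith
      ultimately show "(if n - (j - i) \<le> i then f (n - (j - i)) else f (n - (j - i) + (j - i))) = q"
        using f ij lt by auto
    qed (use f in auto)
    then have "n \<le> n - (j - i)" by (intro least) (simp add: Q_def)
    then show False using lt ij by simp
  qed
  then have "inj_on f {..n}" by (intro linorder_inj_onI') (metis atMost_iff less_imp_le nat_neq_iff)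
  then show thesis using that f by blast
qed

lemma cycle_through_edge:
  assumes T: "T \<subseteq> bounded_edges P" and pq: "open_segment p q \<in> T" "p \<noteq> q"
    and path: "(p, q) \<in> (adjacent (bounded_edges P - T))\<^sup>*"
  obtains \<gamma> where "cycle P \<gamma>" "\<gamma> \<inter> T = {open_segment p q}"
proof -
  obtain f and m :: nat where f: "f 0 = p" "f m = q"
    "\<And>i. i < m \<Longrightarrow> (f i, f (Suc i)) \<in> adjacent (bounded_edges P - T)" "inj_on f {..m}"
    using simple_path[OF path] by metis
  define n where "n = Suc m"
  let ?e = "side f n"
  have steps: "?e i \<in> bounded_edges P - T" if "i < m" for i
    using f(3)[OF that] that by (simp add: adjacent_def n_def)
  have last: "?e m = open_segment p q"
    using f(1,2) by (simp add: n_def open_segment_commute)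
  have "m \<noteq> 0" using f(1,2) pq by metis
  moreover have "m \<noteq> 1" using f(1,2) f(3)[of 0] pq by (auto simp: adjacent_def)
  ultimately have n3: "3 \<le> n" by (simp add: n_def)
  have ivl: "{..<n} = insert m {..<m}" by (auto simp: n_def)
  have "?e i \<in> bounded_edges P" if "i < n" for i
  proof (cases "i = m")
    case True
    then show ?thesis using last pq(1) T by (metis subsetD)
  next
    case False
    then show ?thesis using steps[of i] that by (simp add: n_def)
  qed
  then have "cycle P (?e ` {..<n})"
    using f(4) n3 by (intro cycle_of_polygon) (auto simp: n_def lessThan_Suc_atMost)
  moreover have "?e ` {..<n} \<inter> T = {open_segment p q}"
  proof -
    have "?e ` {..<m} \<inter> T = {}" using steps by blast
    then show ?thesis unfolding ivl image_insert last using pq(1) by blast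
  qed
  ultimately show thesis by (rule that)
qed

lemma finite_closedin:
  assumes "finite A"
  shows "closedin X (embed ` A)"
  using assms by (intro closedin_embed_compact finite_imp_compact)

text \<open>If removing the cut left the curve connected, then the ends of an edge in the cut could be
  joined outside of the cut, and the resulting cycle would meet the cut exactly once.\<close>

lemma even_set_disconnects:
  assumes T: "T \<subseteq> bounded_edges P" "T \<noteq> {}"
    and even: "\<And>\<gamma>. cycle P \<gamma> \<Longrightarrow> even (card (\<gamma> \<inter> T))"
  shows "\<not> connectedin X (remove_edges P T)"
proof -
  obtain e0 where e0: "e0 \<in> T" using T by blast
  then obtain p q where pq: "p \<noteq> q" "e0 = open_segment p q" using T bounded_edge_segmentE by blast
  define R where "R = adjacent (bounded_edges P - T)"
  define A where "A = {x. (p, x) \<in> R\<^sup>*}"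
  define Q where "Q = (\<Union>f\<in>T. closure f - f)"
  (* A contains the vertices that can be reached from p without using T. The curve without T splits
     into the part S1 of the edges with an end in A and the part S2 of the others. The points of Q
     are added because a vertex may have no edge outside of T. *)
  define F where "F = {f \<in> edges P - T. (closure f - f) \<inter> A \<noteq> {}}"
  define G where "G = edges P - T - F"
  define S1 where "S1 = (\<Union>f\<in>F. closed_edge P f) \<union> embed ` (A \<inter> Q)"
  define S2 where "S2 = (\<Union>f\<in>G. closed_edge P f) \<union> embed ` (Q - A)"
  have pA: "p \<in> A" by (simp add: A_def)
  have qA: "q \<notin> A"
  proof
    assume "q \<in> A"
    then obtain \<gamma> where "cycle P \<gamma>" "\<gamma> \<inter> T = {e0}"
      using cycle_through_edge[OF T(1), of p q] pq e0 by (auto simp: A_def R_def)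
    then show False using even[of \<gamma>] by simp
  qed
  have ends0: "closure e0 - e0 = {p, q}" unfolding pq(2) by (rule ends_open_segment[OF pq(1)])
  have finT: "finite T" using T finite_bounded_edges finite_subset by blast
  have finQ: "finite Q" unfolding Q_def using finT T finite_ends by blast
  have edgeT: "f \<in> edges P" if "f \<in> T" for f using that T bounded_edge_is_edge by blast
  have closed: "closedin X S1" "closedin X S2"
    unfolding S1_def S2_def F_def G_def using finite_edges finQ
    by (auto intro!: closedin_Un closedin_Union closedin_closed_edge finite_closedin)
  have end_of: "x \<in> closure f - f" if "f \<in> edges P" "g \<in> edges P" "f \<noteq> g" "x \<in> closure f" "x \<in> closure g" for x f g
    using that edge_closure_disjoint by blast
  have spread: "x \<in> A" if fx: "f \<in> F" "x \<in> closure f - f" for x f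
  proof -
    obtain y where y: "y \<in> A" "y \<in> closure f - f" using fx(1) unfolding F_def by blast
    show ?thesis
    proof (cases "x = y")
      case False
      have f: "f \<in> edges P" "f \<notin> T" using fx(1) by (auto simp: F_def)
      have "f \<in> bounded_edges P" "f = open_segment y x" using two_ends[OF f(1) y(2) fx(2)] False by blast+
      then have "(y, x) \<in> R" using False f by (simp add: R_def adjacent_def)
      then show ?thesis using y by (auto simp: A_def intro: rtrancl_into_rtrancl)
    qed (use y in simp)
  qed
  have stay: "x \<notin> A" if "f \<in> G" "x \<in> closure f - f" for x f
    using that by (auto simp: F_def G_def)
  have Q_end: "x \<in> closure f - f" if xf: "x \<in> Q" "f \<in> edges P - T" "x \<in> closure f" for x f
  proof -
    obtain t where "t \<in> T" "x \<in> closure t" using xf(1) unfolding Q_def by blast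
    then show ?thesis using end_of[of f t x] xf edgeT by blast
  qed
  have FG: "F \<subseteq> edges P - T" "G \<subseteq> edges P - T" by (auto simp: F_def G_def)
  have disj: "S1 \<inter> S2 = {}"
  proof (rule ccontr)
    assume "S1 \<inter> S2 \<noteq> {}"
    then obtain z where z: "z \<in> S1" "z \<in> S2" by blast
    consider (ee) f g where "f \<in> F" "z \<in> closed_edge P f" "g \<in> G" "z \<in> closed_edge P g"
      | (ev) f x where "f \<in> F" "z \<in> closed_edge P f" "z = embed x" "x \<in> Q" "x \<notin> A"
      | (ve) g x where "g \<in> G" "z \<in> closed_edge P g" "z = embed x" "x \<in> Q" "x \<in> A"
      | (vv) x y where "z = embed x" "x \<in> A" "z = embed y" "y \<notin> A"
      using z unfolding S1_def S2_def by blast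
    then show False
    proof cases
      case ee
      then have fg: "f \<in> edges P" "g \<in> edges P" "f \<noteq> g" using FG by (auto simp: G_def)
      obtain x where x: "z = embed x" using closed_edges_meet_in_plane[OF fg] ee by blast
      then have "x \<in> closure f" "x \<in> closure g" using ee planar_closed_edge by blast+
      then show False using end_of fg spread[OF ee(1)] stay[OF ee(3)] by blast
    next
      case ev
      then show False using Q_end[of x f] FG spread planar_closed_edge by blast
    next
      case ve
      then show False using Q_end[of x g] FG stay planar_closed_edge by blast
    next
      case vv
      then show False by (simp add: embed_eq_iff)
    qed
  qed
  have cover: "remove_edges P T \<subseteq> S1 \<union> S2"
  proof
    fix z assume z: "z \<in> remove_edges P T"
    then obtain f where f: "f \<in> edges P" "z \<in> closed_edge P f"
      unfolding remove_edges_def curve_eq by blast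
    show "z \<in> S1 \<union> S2"
    proof (cases "f \<in> T")
      case True
      then obtain x where x: "z = embed x" "x \<in> closure f" using f T closed_edge_bounded by blast
      moreover have "x \<notin> f" using z x True by (auto simp: remove_edges_def)
      ultimately have "x \<in> Q" using True by (auto simp: Q_def)
      then show ?thesis using x by (cases "x \<in> A") (auto simp: S1_def S2_def)
    next
      case False
      then show ?thesis using f by (cases "f \<in> F") (auto simp: S1_def S2_def G_def)
    qed
  qed
  have "embed x \<in> remove_edges P T" if "x \<in> closure e0 - e0" for x
  proof -
    have "x \<notin> f" if "f \<in> T" for f
      using edge_closure_disjoint[OF edgeT[OF that] edgeT[OF e0]] \<open>x \<in> closure e0 - e0\<close> by blast
    moreover have "embed x \<in> curve P" unfolding curve_eq using that edgeT[OF e0] planar_closed_edge by blast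
    ultimately show ?thesis by (auto simp: remove_edges_def)
  qed
  then have "embed p \<in> remove_edges P T" "embed q \<in> remove_edges P T" using ends0 by blast+
  moreover have "p \<in> Q" "q \<in> Q" using ends0 e0 by (auto simp: Q_def)
  then have "embed p \<in> S1" "embed q \<in> S2" using pA qA by (auto simp: S1_def S2_def)
  ultimately show ?thesis
    unfolding connectedin_closedin using closed disj cover by blast
qed

lemma even_changes:
  fixes s :: "nat \<Rightarrow> bool"
  assumes "0 < n"
  shows "even (card {i \<in> {..<n}. s i \<noteq> s (Suc i mod n)})"
proof -
  obtain m where m: "n = Suc m" using assms by (cases n) auto
  have open_path: "even (card {i \<in> {..<k}. s i \<noteq> s (Suc i)}) \<longleftrightarrow> s 0 = s k" for k and s :: "nat \<Rightarrow> bool"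
  proof (induction k)
    case (Suc k)
    have "{i \<in> {..<Suc k}. s i \<noteq> s (Suc i)} = (if s k \<noteq> s (Suc k) then insert k else id) {i \<in> {..<k}. s i \<noteq> s (Suc i)}"
      by (auto simp: less_Suc_eq)
    then show ?case using Suc by auto
  qed simp
  define A where "A = {i \<in> {..<m}. s i \<noteq> s (Suc i)}"
  have "{i \<in> {..<n}. s i \<noteq> s (Suc i mod n)} = A \<union> (if s m \<noteq> s 0 then {m} else {})"
  proof (rule set_eqI)
    fix i
    consider "i < m" | "i = m" | "m < i" by linarith
    then show "i \<in> {i \<in> {..<n}. s i \<noteq> s (Suc i mod n)} \<longleftrightarrow> i \<in> A \<union> (if s m \<noteq> s 0 then {m} else {})"
    proof cases
      case 1
      then have "Suc i mod n = Suc i" "i < n" by (simp_all add: m)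
      then show ?thesis using 1 by (simp add: A_def)
    next
      case 2
      then have "Suc i mod n = 0" "i < n" by (simp_all add: m)
      then show ?thesis using 2 by (simp add: A_def)
    next
      case 3
      then have "\<not> i < n" by (simp add: m)
      then show ?thesis using 3 by (simp add: A_def)
    qed
  qed
  moreover have "finite A" "m \<notin> A" by (auto simp: A_def)
  ultimately show ?thesis using open_path[of m s] unfolding A_def[symmetric] by auto
qed

text \<open>A minimal disconnecting set \<open>B\<close> leaves two parts, and every edge of \<open>B\<close> joins one part
  to the other, because putting back an edge with both ends in one part does not connect the
  parts. So a cycle changes sides exactly at its edges in \<open>B\<close>.\<close>

lemma minimal_disconnecting_even:
  assumes B: "B \<subseteq> bounded_edges P" and disc: "\<not> connectedin X (remove_edges P B)"
    and min: "\<And>B'. B' \<subset> B \<Longrightarrow> connectedin X (remove_edges P B')"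
    and \<gamma>: "cycle P \<gamma>"
  shows "even (card (\<gamma> \<inter> B))"
proof -
  let ?C = "remove_edges P B"
  have edgeB: "f \<in> edges P" if "f \<in> B" for f using that B bounded_edge_is_edge by blast
  have "curve P \<subseteq> topspace X"
    unfolding curve_def by (rule closure_of_subset_topspace)
  then have "?C \<subseteq> topspace X" unfolding remove_edges_def by (rule subset_trans[OF Diff_subset])
  then obtain U V where UV: "closedin X U" "closedin X V" "?C \<subseteq> U \<union> V" "U \<inter> V \<inter> ?C = {}"
    "U \<inter> ?C \<noteq> {}" "V \<inter> ?C \<noteq> {}"
    using disc unfolding connectedin_closedin by metis
  have notin: "z \<notin> (\<Union>b\<in>B. embed ` b)" if "z \<in> closed_edge P f" "f \<in> edges P" "f \<notin> B" for z f
    using edge_disjoint_closed_edge[OF edgeB that(2)] that by blast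
  have in_C: "closed_edge P f \<subseteq> ?C" if "f \<in> edges P" "f \<notin> B" for f
    unfolding remove_edges_def curve_eq using notin that by blast
  have ends_C: "edge_ends P f \<subseteq> ?C" if f: "f \<in> edges P" for f
  proof (cases "f \<in> B")
    case True
    have "z \<notin> embed ` b" if "z \<in> edge_ends P f" "b \<in> B" for z b
      using that edge_disjoint_closed_edge[OF edgeB[OF that(2)] f] by (cases "b = f") (auto simp: edge_ends_def)
    then show ?thesis using f unfolding remove_edges_def curve_eq by (auto simp: edge_ends_def)
  qed (use in_C f in \<open>auto simp: edge_ends_def\<close>)
  have outside: "edge_ends P f \<subseteq> U \<or> edge_ends P f \<subseteq> V" if f: "f \<in> edges P" "f \<notin> B" for f
  proof -
    have "closed_edge P f \<subseteq> U \<union> V" "U \<inter> V \<inter> closed_edge P f = {}" using in_C[OF f] UV(3,4) by blast+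
    then have "U \<inter> closed_edge P f = {} \<or> V \<inter> closed_edge P f = {}"
      using connected_closed_edge[OF f(1)] UV(1,2) unfolding connectedin_closedin by blast
    then show ?thesis using \<open>closed_edge P f \<subseteq> U \<union> V\<close> unfolding edge_ends_def by blast
  qed
  have one_sided: False
    if b: "b \<in> B" and W: "closedin X W" "closedin X Z" "?C \<subseteq> W \<union> Z" "W \<inter> Z \<inter> ?C = {}" "W \<inter> ?C \<noteq> {}" "Z \<inter> ?C \<noteq> {}"
      and ends: "edge_ends P b \<subseteq> W" for b W Z
  proof -
    let ?D = "remove_edges P (B - {b})"
    let ?O = "\<Union>f\<in>edges P - {b}. closed_edge P f"
    (* Once b is put back, W together with the closed edge and Z still separate. Z has to be shrunk
       because it may contain points of b. *)
    let ?W = "W \<union> closed_edge P b" and ?Z = "Z \<inter> ?O"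
    have bC: "closed_edge P b \<inter> ?C \<subseteq> W" using ends b by (auto simp: edge_ends_def remove_edges_def)
    have D: "?D \<subseteq> ?C \<union> embed ` b" by (auto simp: remove_edges_def)
    have bb: "embed ` b \<subseteq> closed_edge P b" using planar_closed_edge closure_subset by blast
    have CO: "z \<in> ?O" if "z \<in> ?C" "z \<notin> W" for z
      using that bC unfolding remove_edges_def curve_eq by blast
    have closed: "closedin X ?W" "closedin X ?Z"
      using W finite_edges by (auto intro!: closedin_Un closedin_Int closedin_Union closedin_closed_edge)
    have cover: "?D \<subseteq> ?W \<union> ?Z" using D bb CO W(3) by blast
    have bO: "embed ` b \<inter> ?O = {}" using edge_disjoint_closed_edge[OF edgeB[OF b]] by blast
    have disj: "?W \<inter> ?Z \<inter> ?D = {}" using D bO bC W(4) by blast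
    have CD: "?C \<subseteq> ?D" by (auto simp: remove_edges_def)
    have "?W \<inter> ?D \<noteq> {}" using W(5) CD by blast
    moreover have "?Z \<inter> ?D \<noteq> {}"
    proof -
      obtain z where "z \<in> Z" "z \<in> ?C" using W(6) by blast
      moreover from this have "z \<in> ?O" using W(4) CO by blast
      ultimately show ?thesis using CD by blast
    qed
    moreover have "connectedin X ?D" using min b by (metis Diff_subset Diff_iff insertI1 psubsetI)
    ultimately show False using closed cover disj unfolding connectedin_closedin by blast
  qed
  obtain n v e where ve: "0 < (n::nat)" "inj_on v {..<n}" "inj_on e {..<n}" "e ` {..<n} = \<gamma>"
    "\<And>i. i < n \<Longrightarrow> e i \<in> edges P \<and> edge_ends P (e i) = {v i, v (Suc i mod n)}"
    using \<gamma> unfolding cycle_def by blast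
  define s where "s i \<longleftrightarrow> v i \<in> U" for i
  have crossing: "e i \<in> B \<longleftrightarrow> s i \<noteq> s (Suc i mod n)" if i: "i < n" for i
  proof -
    have ei: "e i \<in> edges P" "edge_ends P (e i) = {v i, v (Suc i mod n)}" using ve(5)[OF i] by auto
    have side: "v j \<in> U \<longleftrightarrow> v j \<notin> V" if "v j \<in> edge_ends P (e i)" for j
      using that ends_C[OF ei(1)] UV(3,4) by blast
    show ?thesis
    proof
      assume b: "e i \<in> B"
      have "\<not> edge_ends P (e i) \<subseteq> U" using one_sided[OF b UV] by blast
      moreover have "\<not> edge_ends P (e i) \<subseteq> V"
        using one_sided[OF b UV(2,1) _ _ UV(6,5)] UV(3,4) by blast
      ultimately show "s i \<noteq> s (Suc i mod n)" using side ei(2) by (auto simp: s_def)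
    next
      assume "s i \<noteq> s (Suc i mod n)"
      then have "\<not> edge_ends P (e i) \<subseteq> U" "\<not> edge_ends P (e i) \<subseteq> V"
        using side ei(2) by (auto simp: s_def)
      then show "e i \<in> B" using outside ei(1) by blast
    qed
  qed
  have "\<gamma> \<inter> B = e ` {i \<in> {..<n}. s i \<noteq> s (Suc i mod n)}"
    using ve(4) crossing by auto
  moreover have "inj_on e {i \<in> {..<n}. s i \<noteq> s (Suc i mod n)}"
    using ve(3) by (rule inj_on_subset) auto
  ultimately show ?thesis using even_changes[OF ve(1), of s] by (simp add: card_image)
qed

text \<open>In a finite graph without vertices of degree one, a walk that never turns back runs into
  itself, and the shortest closed stretch of it is a simple cycle.\<close>

lemma cycle_of_min_degree_two:
  assumes E: "E \<subseteq> bounded_edges P" "E \<noteq> {}"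
    and deg: "\<And>f x. f \<in> E \<Longrightarrow> x \<in> closure f - f \<Longrightarrow> \<exists>g\<in>E. g \<noteq> f \<and> x \<in> closure g"
  obtains n v where "3 \<le> (n::nat)" "inj_on v {..<n}"
    "\<And>i. i < n \<Longrightarrow> side v n i \<in> E"
proof -
  have edgeE': "f \<in> edges P" if "f \<in> E" for f using that E bounded_edge_is_edge by blast
  have next_ex: "\<exists>z. (y, z) \<in> adjacent E \<and> z \<noteq> x" if xy: "(x, y) \<in> adjacent E" for x y
  proof -
    have f: "open_segment x y \<in> E" "x \<noteq> y" using xy by (auto simp: adjacent_def)
    have y: "y \<in> closure (open_segment x y) - open_segment x y" using ends_open_segment[OF f(2)] by blast
    obtain g where g: "g \<in> E" "g \<noteq> open_segment x y" "y \<in> closure g" using deg[OF f(1) y] by blast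
    obtain a b where ab: "a \<noteq> b" "g = open_segment a b" using bounded_edge_segmentE E g(1) by blast
    have "y \<notin> g" using edge_closure_disjoint[OF edgeE'[OF g(1)] edgeE'[OF f(1)]] g(2) y by blast
    then have "y \<in> {a, b}" using ends_open_segment[OF ab(1)] g(3) ab(2) by blast
    then obtain z where z: "z \<noteq> y" "g = open_segment y z"
      using ab by (metis insert_iff open_segment_commute singletonD)
    moreover have "z \<noteq> x" using z(2) g(2) by (metis open_segment_commute)
    ultimately show ?thesis using g(1) by (intro exI[of _ z]) (simp add: adjacent_def)
  qed
  obtain f0 where "f0 \<in> E" using E by blast
  then obtain a0 b0 where f0: "(a0, b0) \<in> adjacent E"
    using bounded_edge_segmentE E(1) unfolding adjacent_def by (metis (mono_tags, lifting) case_prodI mem_Collect_eq subsetD)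
  have "\<exists>w. \<forall>k::nat. w k \<in> adjacent E \<and> (fst (w (Suc k)) = snd (w k) \<and> snd (w (Suc k)) \<noteq> fst (w k))"
  proof (rule dependent_nat_choice)
    show "\<exists>w. w \<in> adjacent E" using f0 by blast
    fix w :: "plane \<times> plane" and k assume "w \<in> adjacent E"
    then show "\<exists>w'. w' \<in> adjacent E \<and> (fst w' = snd w \<and> snd w' \<noteq> fst w)"
      using next_ex[of "fst w" "snd w"] by (metis fst_conv prod.collapse snd_conv)
  qed
  then obtain w where w: "\<And>k::nat. w k \<in> adjacent E" "\<And>k. fst (w (Suc k)) = snd (w k)"
    "\<And>k. snd (w (Suc k)) \<noteq> fst (w k)" by blast
  define v where "v k = fst (w k)" for k
  have v: "(v k, v (Suc k)) \<in> adjacent E" "v (Suc (Suc k)) \<noteq> v k" for k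
    using w(1)[of k] w(2)[of k] w(2)[of "Suc k"] w(3)[of k] by (simp_all add: v_def)
  have v1: "v (Suc k) \<noteq> v k" for k using v(1)[of k] by (auto simp: adjacent_def)
  have "range v \<subseteq> (\<Union>f\<in>E. closure f - f)"
  proof
    fix x assume "x \<in> range v"
    then obtain k where k: "x = v k" by blast
    have "open_segment (v k) (v (Suc k)) \<in> E" using v(1)[of k] by (simp add: adjacent_def)
    moreover have "x \<in> closure (open_segment (v k) (v (Suc k))) - open_segment (v k) (v (Suc k))"
    proof -
      have "v k \<noteq> v (Suc k)" using v1[of k] by (rule not_sym)
      then show ?thesis using ends_open_segment[of "v k" "v (Suc k)"] k by simp
    qed
    ultimately show "x \<in> (\<Union>f\<in>E. closure f - f)" by blast
  qed
  moreover have "finite E" using E finite_bounded_edges finite_subset by blast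
  then have "finite (\<Union>f\<in>E. closure f - f)" using finite_ends E(1) by blast
  ultimately have "finite (range v)" using finite_subset by blast
  then have "\<not> inj v" using finite_imageD by blast
  then obtain i j where "v i = v j" "i < j" by (metis injI linorder_neqE_nat)
  then have ex: "\<exists>n. 0 < n \<and> (\<exists>i. v i = v (i + n))" by (intro exI[of _ "j - i"]) (auto intro: exI[of _ i])
  (* Minimality of the period n makes the n points distinct. It is at least 3 since the walk does not
     turn back. *)
  define n where "n = (LEAST n. 0 < n \<and> (\<exists>i. v i = v (i + n)))"
  have n: "0 < n \<and> (\<exists>i. v i = v (i + n))" unfolding n_def by (rule LeastI_ex[OF ex])
  have least: "n \<le> m" if "0 < m" "v i = v (i + m)" for m i
    unfolding n_def using that by (intro Least_le) blast
  obtain i0 where i0: "v i0 = v (i0 + n)" using n by blast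
  have "n \<noteq> 1" "n \<noteq> 2" using i0 v1[of i0] v(2)[of i0] by (auto simp: numeral_2_eq_2)
  then have n3: "3 \<le> n" using n by linarith
  define u where "u k = v (i0 + k)" for k
  have inj: "inj_on u {..<n}"
  proof (rule linorder_inj_onI')
    fix a b assume ab: "a \<in> {..<n}" "b \<in> {..<n}" "a < b"
    show "u a \<noteq> u b"
    proof
      assume "u a = u b"
      then have "v (i0 + a) = v ((i0 + a) + (b - a))" using ab by (simp add: u_def)
      then have "n \<le> b - a" using ab by (intro least[of _ "i0 + a"]) auto
      then show False using ab by simp
    qed
  qed
  have "side u n k \<in> E" if k: "k < n" for k
  proof -
    have "u (Suc k mod n) = v (Suc (i0 + k))"
      using k i0 by (cases "Suc k = n") (auto simp: u_def)
    then show ?thesis using v(1)[of "i0 + k"] by (simp add: u_def adjacent_def)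
  qed
  then show thesis using that n3 inj by blast
qed

end


section \<open>The Jordan curve of a cycle\<close>

text \<open>The Jordan curve theorem for complex numbers, carried over by an isometry.\<close>

lemma Jordan_plane:
  fixes c :: "real \<Rightarrow> plane"
  assumes "simple_path c" "pathfinish c = pathstart c"
  obtains I J where "I \<noteq> {}" "open I" "open J" "bounded I" "I \<inter> J = {}"
    "I \<union> J = - path_image c" "path_image c \<subseteq> closure I" "path_image c \<subseteq> closure J"
proof -
  define h :: "plane \<Rightarrow> complex" where "h x = Complex (fst x) (snd x)" for x
  define g :: "complex \<Rightarrow> plane" where "g z = (Re z, Im z)" for z
  have gh: "g (h x) = x" and hg: "h (g z) = z" for x z by (simp_all add: g_def h_def)
  have lin: "linear h" "linear g"
    by (auto intro!: linearI simp: h_def g_def complex_eq_iff)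
  have norm: "norm (g z) = norm z" for z by (simp add: g_def norm_Pair cmod_def)
  have dist: "dist (g z) x = dist z (h x)" for z x
  proof -
    have "g z - x = g (z - h x)" using linear_diff[OF lin(2)] gh by simp
    then show ?thesis by (simp add: dist_norm norm)
  qed
  have conth: "continuous_on UNIV h" using lin(1) linear_continuous_on linear_conv_bounded_linear by blast
  have "inj h" using gh by (metis injI)
  then have "simple_path (h \<circ> c)" using assms(1) simple_path_linear_image_eq[OF lin(1)] by blast
  moreover have "pathfinish (h \<circ> c) = pathstart (h \<circ> c)"
    using assms(2) by (simp add: pathfinish_compose pathstart_compose)
  ultimately have Jordan: "inside (path_image (h \<circ> c)) \<noteq> {} \<and> open (inside (path_image (h \<circ> c))) \<and>
    open (outside (path_image (h \<circ> c))) \<and> bounded (inside (path_image (h \<circ> c))) \<and>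
    frontier (inside (path_image (h \<circ> c))) = path_image (h \<circ> c) \<and>
    frontier (outside (path_image (h \<circ> c))) = path_image (h \<circ> c)"
    using Jordan_inside_outside[of "h \<circ> c"] by blast
  define G where "G = path_image (h \<circ> c)"
  have J: "inside G \<noteq> {}" "open (inside G)" "open (outside G)" "bounded (inside G)"
    "frontier (inside G) = G" "frontier (outside G) = G"
    using Jordan unfolding G_def by blast+
  have im: "h x \<in> G \<longleftrightarrow> x \<in> path_image c" for x
    unfolding G_def path_image_compose using gh by (metis image_iff)
  have cl: "path_image c \<subseteq> closure (h -` S)" if S: "frontier S = G" for S
  proof
    fix x assume "x \<in> path_image c"
    then have "h x \<in> closure S" using im[of x] S by (auto simp: frontier_def)
    then have "\<exists>z\<in>S. dist z (h x) < \<epsilon>" if "\<epsilon> > 0" for \<epsilon> using that by (auto simp: closure_approachable)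
    then have "\<exists>y\<in>h -` S. dist y x < \<epsilon>" if "\<epsilon> > 0" for \<epsilon> using that dist hg by (metis vimage_eq)
    then show "x \<in> closure (h -` S)" by (simp add: closure_approachable)
  qed
  show thesis
  proof (rule that)
    show "h -` inside G \<noteq> {}" using J(1) hg by (metis ex_in_conv vimage_eq)
    show "open (h -` inside G)" "open (h -` outside G)"
      using J(2,3) conth by (auto intro: open_vimage)
    have "h -` S = g ` S" for S using gh hg by (auto simp: image_iff) metis
    moreover have "bounded (g ` inside G)"
      using J(4) lin(2) bounded_linear_image linear_conv_bounded_linear by blast
    ultimately show "bounded (h -` inside G)" by simp
    show "h -` inside G \<inter> h -` outside G = {}"
      using inside_Int_outside[of G] by blast
    have "h x \<in> inside G \<union> outside G \<longleftrightarrow> x \<notin> path_image c" for x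
      unfolding inside_Un_outside Compl_iff im ..
    then show "h -` inside G \<union> h -` outside G = - path_image c" by blast
  qed (use cl J(5,6) in blast)+
qed

lemma polygon_simple_path:
  fixes v :: "nat \<Rightarrow> plane"
  assumes n: "3 \<le> n" and inj: "inj_on v {..<n}"
    and disj: "\<And>i j. i < n \<Longrightarrow> j < n \<Longrightarrow> i \<noteq> j \<Longrightarrow>
      side v n i \<inter> closed_side v n j = {}"
  obtains c where "simple_path c" "pathfinish c = pathstart c"
    "path_image c = (\<Union>i<n. closed_side v n i)"
proof -
  define g where "g = rec_nat (linepath (v 0) (v 1)) (\<lambda>k p. p +++ linepath (v (Suc k)) (v (Suc (Suc k))))"
  have g0: "g 0 = linepath (v 0) (v 1)" and gS: "g (Suc k) = g k +++ linepath (v (Suc k)) (v (Suc (Suc k)))" for k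
    by (simp_all add: g_def)
  have vneq: "v i \<noteq> v j" if "i < n" "j < n" "i \<noteq> j" for i j
    using inj that by (auto simp: inj_on_def)
  have sf: "pathfinish (g k) = v (Suc k)" for k
    by (cases k) (simp_all add: g0 gS)
  have sf': "pathstart (g k) = v 0" for k by (induction k) (simp_all add: g0 gS)
  have im: "path_image (g k) = (\<Union>i\<le>k. closed_segment (v i) (v (Suc i)))" for k
  proof (induction k)
    case (Suc k)
    then show ?case
      by (simp add: gS path_image_join sf atMost_Suc Un_commute)
  qed (simp add: g0)
  have meet: "x \<in> {v i, v (Suc i mod n)} \<and> x \<in> {v j, v (Suc j mod n)}"
    if "i < n" "j < n" "i \<noteq> j" "x \<in> closed_side v n i"
      "x \<in> closed_side v n j" for i j x
    using disj[OF that(1-3)] disj[OF that(2,1)] that unfolding open_segment_def by blast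
  have arc: "arc (g k)" if "Suc k < n" for k
    using that
  proof (induction k)
    case 0
    then show ?case using vneq[of 0 1] n by (simp add: g0)
  next
    case (Suc k)
    have "path_image (g k) \<inter> closed_segment (v (Suc k)) (v (Suc (Suc k))) \<subseteq> {v (Suc k)}"
    proof
      fix x assume x: "x \<in> path_image (g k) \<inter> closed_segment (v (Suc k)) (v (Suc (Suc k)))"
      then obtain i where i: "i \<le> k" "x \<in> closed_segment (v i) (v (Suc i))" unfolding im by blast
      have mm: "Suc i mod n = Suc i" "Suc (Suc k) mod n = Suc (Suc k)" using i Suc.prems by simp_all
      have "x \<in> {v i, v (Suc i)} \<and> x \<in> {v (Suc k), v (Suc (Suc k))}"
        using meet[of i "Suc k" x] i x Suc.prems unfolding mm by simp
      moreover have "v i \<noteq> v (Suc k)" "v i \<noteq> v (Suc (Suc k))" "v (Suc i) \<noteq> v (Suc (Suc k))"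
        using vneq[of i "Suc k"] vneq[of i "Suc (Suc k)"] vneq[of "Suc i" "Suc (Suc k)"] i Suc.prems by simp_all
      ultimately show "x \<in> {v (Suc k)}" by auto
    qed
    then show ?case unfolding gS
      using Suc vneq[of "Suc k" "Suc (Suc k)"] by (intro arc_join) (auto simp: sf)
  qed
  (* g m passes through all vertices, and only the side from the last one back to v 0 is missing. *)
  define m where "m = n - 2"
  have m: "n = Suc (Suc m)" using n by (simp add: m_def)
  let ?c = "g m +++ linepath (v (Suc m)) (v 0)"
  have mod: "Suc i mod n = Suc i" if "i \<le> m" for i using that by (simp add: m)
  have mod0: "Suc (Suc m) mod n = 0" by (simp add: m)
  show thesis
  proof (rule that)
    show "pathfinish ?c = pathstart ?c" by (simp add: sf')
    have "path_image (g m) \<inter> closed_segment (v (Suc m)) (v 0) \<subseteq> {v 0, v (Suc m)}"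
    proof
      fix x assume x: "x \<in> path_image (g m) \<inter> closed_segment (v (Suc m)) (v 0)"
      then obtain i where i: "i \<le> m" "x \<in> closed_segment (v i) (v (Suc i))" unfolding im by blast
      have "x \<in> {v (Suc m), v (Suc (Suc m) mod n)}"
        using meet[of i "Suc m" x] i x mod[OF i(1)] mod0 by (simp add: m)
      then show "x \<in> {v 0, v (Suc m)}" unfolding mod0 by blast
    qed
    then show "simple_path ?c"
      using arc[of m] vneq[of "Suc m" 0] by (intro simple_path_join_loop) (auto simp: sf' sf m)
    have "{..<n} = insert (Suc m) {..m}" by (auto simp: m)
    moreover have "(\<Union>i\<le>m. closed_side v n i) = (\<Union>i\<le>m. closed_segment (v i) (v (Suc i)))"
      using mod by simp
    ultimately show "path_image ?c = (\<Union>i<n. closed_side v n i)"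
      by (simp add: path_image_join sf im mod0 Un_commute)
  qed
qed

context nonsingular_curve
begin

lemma Jordan_polygon:
  fixes v :: "nat \<Rightarrow> plane"
  assumes n: "3 \<le> n" and inj: "inj_on v {..<n}"
    and e: "\<And>i. i < n \<Longrightarrow> side v n i \<in> bounded_edges P"
  obtains I J where "I \<noteq> {}" "open I" "open J" "bounded I" "I \<inter> J = {}"
    "I \<union> J = - (\<Union>i<n. closed_side v n i)"
    "(\<Union>i<n. closed_side v n i) \<subseteq> closure I"
    "(\<Union>i<n. closed_side v n i) \<subseteq> closure J"
proof -
  have disj: "side v n i \<inter> closed_side v n j = {}"
    if ij: "i < n" "j < n" "i \<noteq> j" for i j
  proof (rule ccontr)
    assume "\<not> ?thesis"
    then obtain x where x: "x \<in> side v n i"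
      "x \<in> closed_side v n j" by blast
    have "v j \<noteq> v (Suc j mod n)" using polygon_vertices_distinct[OF _ inj ij(2)] n by simp
    then have "x \<in> closure (side v n j)" using x(2) by simp
    then have "side v n i = side v n j"
      using edge_closure_disjoint[OF bounded_edge_is_edge[OF e[OF ij(1)]] bounded_edge_is_edge[OF e[OF ij(2)]] x(1)]
      by blast
    then show False using polygon_edges_distinct[OF n inj] ij unfolding inj_on_def by blast
  qed
  obtain c where c: "simple_path c" "pathfinish c = pathstart c"
    "path_image c = (\<Union>i<n. closed_side v n i)"
    by (rule polygon_simple_path[OF n inj disj])
  obtain I J where "I \<noteq> {}" "open I" "open J" "bounded I" "I \<inter> J = {}"
    "I \<union> J = - (\<Union>i<n. closed_side v n i)"
    "(\<Union>i<n. closed_side v n i) \<subseteq> closure I"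
    "(\<Union>i<n. closed_side v n i) \<subseteq> closure J"
    by (rule Jordan_plane[OF c(1,2), unfolded c(3)])
  then show thesis by (rule that)
qed

section \<open>The boundary of a bounded region\<close>

definition region_edges :: "nat \<times> nat \<Rightarrow> plane set set" where
  "region_edges a = {e \<in> edges P. e \<subseteq> closure (cell P {a})}"

lemma mem_region_edges:
  assumes "cell P {c, d} \<in> edges P" "c \<noteq> d"
  shows "cell P {c, d} \<in> region_edges a \<longleftrightarrow> a = c \<or> a = d"
proof
  assume a: "cell P {c, d} \<in> region_edges a"
  have "cell P {c, d} \<noteq> {}" using assms(1) unfolding edges_def by auto
  then obtain x where "attained P x = {c, d}" by auto
  moreover from this have "x \<in> closure (cell P {a})" using a by (auto simp: region_edges_def)
  ultimately show "a = c \<or> a = d" using closure_cell[of x "{a}"] by auto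
next
  assume "a = c \<or> a = d"
  then obtain b where b: "{c, d} = {a, b}" "a \<noteq> b" using assms(2) by (metis insert_commute)
  then show "cell P {c, d} \<in> region_edges a"
    using assms(1) region_at_edge[of _ a b] unfolding region_edges_def by (simp add: subset_eq)
qed

text \<open>The closure of an edge adds only vertices.\<close>

lemma attained_vertexE:
  assumes "{a, b} \<subset> attained P x" "a \<noteq> b"
  obtains c where "attained P x = {a, b, c}" "orient a b c \<noteq> 0"
proof -
  have ab: "a \<in> attained P x" "b \<in> attained P x" "attained P x \<noteq> {a, b}" using assms(1) by auto
  obtain c where c: "c \<in> attained P x" "orient a b c \<noteq> 0"
    using attained_pair[OF ab(1,2) assms(2)] ab(3) by metis
  then show thesis using that attained_triangle[OF ab(1,2) c] by simp
qed

lemma edge_strict_end: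
  assumes e: "e \<in> edges P" "e = cell P A" and x: "x \<in> closure e - e"
  shows "A \<subset> attained P x"
  using closure_cell[of x A] x e(2) by auto

lemma region_edges_nonempty:
  assumes "bounded (cell P {a})" "cell P {a} \<noteq> {}"
  shows "region_edges a \<noteq> {}"
proof -
  have "cell P {a} \<noteq> UNIV" using assms(1) not_bounded_UNIV by metis
  then have "frontier (cell P {a}) \<noteq> {}" using assms(2) by (simp add: frontier_eq_empty)
  then obtain x where x: "x \<in> frontier (cell P {a})" by blast
  then have "a \<in> attained P x" using closure_cell[of x "{a}"] by (auto simp: frontier_def)
  moreover have "attained P x \<noteq> {a}"
    using x frontier_region_subset planar_curve_region by blast
  ultimately obtain b where b: "b \<in> attained P x" "b \<noteq> a" "a \<in> attained P x" by blast
  have "cell P {a, b} \<in> edges P"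
  proof (cases "attained P x = {a, b}")
    case True
    then show ?thesis using edgeI b by metis
  next
    case False
    then have "{a, b} \<subset> attained P x" using b by blast
    then obtain c where "attained P x = {a, b, c}" "orient a b c \<noteq> 0"
      using attained_vertexE b(2) by metis
    then show ?thesis by (rule edge_at_vertex)
  qed
  then have "cell P {a, b} \<in> region_edges a" using mem_region_edges[of a b a] b(2) by simp
  then show ?thesis by blast
qed

text \<open>At a vertex with exponents \<open>a\<close>, \<open>b\<close>, \<open>z\<close> the boundary of the region of \<open>a\<close> consists of the edges of
  \<open>a\<close> with \<open>b\<close> and of \<open>a\<close> with \<open>z\<close>.\<close>

lemma region_edges_degree:
  assumes f: "f \<in> region_edges a" and x: "x \<in> closure f - f"
  shows "\<exists>g\<in>region_edges a. g \<noteq> f \<and> x \<in> closure g"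
proof -
  have fe: "f \<in> edges P" using f by (simp add: region_edges_def)
  obtain c d y where cd: "c \<noteq> d" "f = cell P {c, d}" "attained P y = {c, d}" using fe by (rule edgeE)
  have "a = c \<or> a = d" using f fe mem_region_edges cd by simp
  then obtain b where b: "a \<noteq> b" "f = cell P {a, b}" "attained P y = {a, b}" using cd by (metis insert_commute)
  have "{a, b} \<subset> attained P x" using edge_strict_end[OF fe b(2) x] .
  then obtain z where z: "attained P x = {a, b, z}" "orient a b z \<noteq> 0"
    using attained_vertexE b(1) by metis
  have "attained P x = {a, z, b}" "orient a z b \<noteq> 0"
    using z by (auto simp: cross_def algebra_simps)
  from edge_at_vertex[OF this] have g: "cell P {a, z} \<in> edges P" "x \<in> closure (cell P {a, z})" by auto
  have "z \<noteq> a" "z \<noteq> b" using z(2) by (auto simp: cross_def)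
  then have "cell P {a, z} \<in> region_edges a" using mem_region_edges[OF g(1)] by simp
  moreover have "y \<notin> cell P {a, z}" using b(1,3) \<open>z \<noteq> a\<close> \<open>z \<noteq> b\<close> by (simp add: doubleton_eq_iff)
  moreover have "y \<in> f" by (simp add: b(2,3))
  ultimately show ?thesis using g(2) by (intro bexI[of _ "cell P {a, z}"]) auto
qed

lemma connected_in_side:
  assumes "connected S" "S \<subseteq> I \<union> J" "open I" "open J" "I \<inter> J = {}"
  shows "S \<subseteq> I \<or> S \<subseteq> J"
  using connectedD[OF assms(1) assms(3,4)] assms(2,5) by blast

lemma region_off_curve: "x \<in> cell P {a} \<Longrightarrow> x \<notin> planar_curve P"
  unfolding planar_curve_region by (intro exI[of _ a]) simp

text \<open>Every vertex of the bounded region has two edges on its boundary, so the boundary contains some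
  polygon. By convexity the inside of this polygon is contained in the region and hence equal to it,
  so the polygon is the whole boundary.\<close>

lemma region_boundary_polygon:
  assumes bdd: "bounded (cell P {a})" and ne: "cell P {a} \<noteq> {}"
  obtains n v where "3 \<le> (n::nat)" "inj_on v {..<n}"
    "\<And>i. i < n \<Longrightarrow> side v n i \<in> bounded_edges P"
    "region_edges a = side v n ` {..<n}"
    "frontier (cell P {a}) = (\<Union>i<n. closed_side v n i)"
proof -
  let ?R = "cell P {a}"
  have bE: "region_edges a \<subseteq> bounded_edges P"
    using bdd bounded_subset[of "closure ?R"] by (auto simp: region_edges_def bounded_edges_def)
  obtain n v where nv: "3 \<le> (n::nat)" "inj_on v {..<n}"
    and ev: "\<And>i. i < n \<Longrightarrow> side v n i \<in> region_edges a"
    using cycle_of_min_degree_two[OF bE region_edges_nonempty[OF assms] region_edges_degree] by metis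
  let ?e = "side v n"
  let ?G = "\<Union>i<n. closed_side v n i"
  have evb: "?e i \<in> bounded_edges P" if "i < n" for i using ev[OF that] bE by blast
  have cle: "closed_side v n i = closure (?e i)" if "i < n" for i
    using polygon_vertices_distinct[OF _ nv(2) that] nv(1) by simp
  obtain I J where IJ: "I \<noteq> {}" "open I" "open J" "bounded I" "I \<inter> J = {}" "I \<union> J = - ?G"
    "?G \<subseteq> closure I" "?G \<subseteq> closure J"
    by (rule Jordan_polygon[OF nv evb])
  have GR: "?G \<subseteq> closure ?R"
  proof (rule UN_least)
    fix i assume "i \<in> {..<n}"
    then have i: "i < n" by simp
    have "?e i \<subseteq> closure ?R" using ev[OF i] by (simp add: region_edges_def)
    then show "closed_side v n i \<subseteq> closure ?R"
      unfolding cle[OF i] by (rule closure_minimal) simp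
  qed
  have noR: "?G \<inter> ?R = {}"
  proof (rule ccontr)
    assume "?G \<inter> ?R \<noteq> {}"
    then obtain i x where i: "i < n" "x \<in> closure (?e i)" "x \<in> ?R" using cle by blast
    then have "x \<in> planar_curve P"
      unfolding planar_curve_eq using bounded_edge_is_edge[OF evb] by blast
    then show False using region_off_curve[OF i(3)] by blast
  qed
  (* The complement of the closed region is connected, avoids the polygon and is unbounded,
     so it lies outside; hence the inside is contained in the closed region. *)
  have "connected (- closure ?R)"
    using bdd convex_cell by (intro connected_complement_bounded_convex convex_closure) auto
  moreover have "- closure ?R \<subseteq> I \<union> J" using GR IJ(6) by blast
  ultimately have "- closure ?R \<subseteq> I \<or> - closure ?R \<subseteq> J"
    by (rule connected_in_side) (use IJ in auto)
  moreover have "\<not> - closure ?R \<subseteq> I"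
  proof
    assume "- closure ?R \<subseteq> I"
    then have "UNIV \<subseteq> closure ?R \<union> I" by blast
    moreover have "bounded (closure ?R \<union> I)" using bounded_closure[OF bdd] IJ(4) by simp
    ultimately show False using bounded_subset not_bounded_UNIV by blast
  qed
  ultimately have "I \<subseteq> closure ?R" using IJ(5) by blast
  then have "I \<subseteq> interior (closure ?R)" using IJ(2) interior_maximal by blast
  also have "\<dots> = ?R" using convex_interior_closure[OF convex_cell] open_region interior_open by metis
  finally have IR: "I \<subseteq> ?R" .
  have "?R \<subseteq> I \<union> J" using noR IJ(6) by blast
  then have "?R \<subseteq> I \<or> ?R \<subseteq> J"
    by (rule connected_in_side[OF convex_connected[OF convex_cell]]) (use IJ in auto)
  then have RI: "?R = I" using IR IJ(1,5) by blast
  have "J \<inter> closure I = {}" using IJ(3,5) open_Int_closure_eq_empty[of J I] by blast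
  then have "closure I - I = ?G" using IJ(6,7) noR RI by blast
  then have front: "frontier ?R = ?G" using open_region[of a] RI by (simp add: frontier_def interior_open)
  have "region_edges a = ?e ` {..<n}"
  proof
    show "?e ` {..<n} \<subseteq> region_edges a" using ev by blast
    show "region_edges a \<subseteq> ?e ` {..<n}"
    proof
      fix e assume e: "e \<in> region_edges a"
      then have ee: "e \<in> edges P" "e \<subseteq> closure ?R" by (auto simp: region_edges_def)
      obtain c d x where x: "c \<noteq> d" "e = cell P {c, d}" "attained P x = {c, d}" using ee(1) by (rule edgeE)
      then have "x \<in> e" "x \<notin> ?R" by auto
      then have "x \<in> frontier ?R" using ee(2) open_region[of a] by (auto simp: frontier_def interior_open)
      then obtain i where i: "i < n" "x \<in> closure (?e i)" unfolding front using cle by blast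
      then have "e = ?e i" using edge_closure_disjoint[OF ee(1) bounded_edge_is_edge[OF evb[OF i(1)]] \<open>x \<in> e\<close>] by blast
      then show "e \<in> ?e ` {..<n}" using i(1) by blast
    qed
  qed
  then show thesis using that[OF nv evb _ front] by blast
qed

lemma planar_curve_embed: "embed x \<in> curve P \<longleftrightarrow> x \<in> planar_curve P"
  unfolding curve_def planar_closure_of using closed_planar_curve by simp

text \<open>A bounded region is open in the surface, and its closure in the surface only adds its boundary,
  which is part of the curve. So it is open and closed in the complement of the curve, and being
  connected it is a component.\<close>

lemma region_boundary_primitive:
  assumes bdd: "bounded (cell P {a})" and ne: "cell P {a} \<noteq> {}"
  shows "primitive_cycle P (region_edges a)"
proof -
  let ?R = "cell P {a}"
  let ?Y = "subtopology X (- curve P)"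
  obtain n v where nv: "3 \<le> (n::nat)" "inj_on v {..<n}"
    "\<And>i. i < n \<Longrightarrow> side v n i \<in> bounded_edges P"
    "region_edges a = side v n ` {..<n}"
    "frontier ?R = (\<Union>i<n. closed_side v n i)"
    by (rule region_boundary_polygon[OF assms]) (rule that; assumption)
  have cyc: "cycle P (region_edges a)" unfolding nv(4) by (rule cycle_of_polygon[OF nv(1-3)])
  have opn: "openin X (embed ` ?R)" using open_region by (rule openin_embed)
  have cls: "X closure_of (embed ` ?R) = embed ` closure ?R" using bdd by (rule closure_of_bounded)
  have off: "embed ` ?R \<subseteq> - curve P"
  proof
    fix z assume "z \<in> embed ` ?R"
    then obtain x where "z = embed x" "attained P x = {a}" by auto
    then show "z \<in> - curve P" using planar_curve_embed planar_curve_region by simp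
  qed
  have clR: "closure ?R = ?R \<union> frontier ?R"
    using closure_Un_frontier by blast
  have openY: "openin ?Y (embed ` ?R)" using opn off by (auto simp: openin_subtopology)
  have closedY: "closedin ?Y (embed ` ?R)"
  proof -
    have "embed ` frontier ?R \<subseteq> curve P" using frontier_region_subset planar_curve_embed by blast
    then have "embed ` ?R = embed ` closure ?R \<inter> - curve P" unfolding clR image_Un using off by blast
    then show ?thesis using cls unfolding closedin_subtopology by (metis closedin_closure_of)
  qed
  have connY: "connectedin ?Y (embed ` ?R)"
    unfolding connectedin_subtopology using off
    by (auto intro!: connectedin_continuous_map_image[OF continuous_map_embed] convex_connected convex_cell)
  obtain x where x: "x \<in> ?R" using ne by blast
  have "embed x \<in> topspace ?Y" using x openin_subset[OF openY] by blast
  define C where "C = Collect (connected_component_of ?Y (embed x))"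
  have C: "C \<in> connected_components_of ?Y"
    using \<open>embed x \<in> topspace ?Y\<close> by (simp add: C_def connected_component_in_connected_components_of)
  have "embed ` ?R \<subseteq> C"
    unfolding C_def using x by (intro connected_component_of_maximal connY) auto
  moreover have "C \<subseteq> embed ` ?R"
  proof -
    have "C \<subseteq> embed ` ?R \<or> disjnt C (embed ` ?R)"
      using connectedin_connected_components_of[OF C] closedY openY by (rule connectedin_clopen_cases)
    moreover have "embed x \<in> C" "embed x \<in> embed ` ?R" using \<open>embed ` ?R \<subseteq> C\<close> x by blast+
    ultimately show ?thesis unfolding disjnt_def by blast
  qed
  ultimately have comp: "embed ` ?R \<in> connected_components_of ?Y" using C by simp
  have "X frontier_of (embed ` ?R) = embed ` frontier ?R"
  proof -
    have "X frontier_of (embed ` ?R) = embed ` closure ?R - embed ` ?R"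
      using opn cls by (simp add: frontier_of_def interior_of_openin)
    also have "\<dots> = embed ` (closure ?R - ?R)" by (auto simp: embed_eq_iff)
    also have "closure ?R - ?R = frontier ?R" using open_region[of a] by (simp add: frontier_def interior_open)
    finally show ?thesis .
  qed
  also have "\<dots> = (\<Union>e\<in>region_edges a. closed_edge P e)"
  proof -
    have "closed_edge P (side v n i) = embed ` closed_side v n i" if "i < n" for i
      using closed_edge_bounded[OF nv(3)[OF that]] polygon_vertices_distinct[OF _ nv(2) that] nv(1) by simp
    then show ?thesis unfolding nv(4,5) image_UN by auto
  qed
  finally show ?thesis unfolding primitive_cycle_def using cyc comp by blast
qed

text \<open>A cycle with a bounded edge lies in the plane: each of its vertices belongs to two different edges,
  and these cannot meet at infinity.\<close>

lemma cycle_polygonE: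
  assumes \<gamma>: "cycle P \<gamma>" and b: "\<gamma> \<inter> bounded_edges P \<noteq> {}"
  obtains n v where "3 \<le> (n::nat)" "inj_on v {..<n}"
    "\<And>i. i < n \<Longrightarrow> side v n i \<in> bounded_edges P"
    "\<gamma> = side v n ` {..<n}"
proof -
  obtain n v e where ve: "0 < (n::nat)" "inj_on v {..<n}" "inj_on e {..<n}" "e ` {..<n} = \<gamma>"
    and e: "\<And>i. i < n \<Longrightarrow> e i \<in> edges P" "\<And>i. i < n \<Longrightarrow> edge_ends P (e i) = {v i, v (Suc i mod n)}"
    using \<gamma> unfolding cycle_def by metis
  have two: "\<exists>p q. p \<noteq> q \<and> e i = open_segment p q \<and> edge_ends P (e i) = {embed p, embed q}"
    if i: "i < n" "e i \<in> bounded_edges P" for i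
  proof -
    obtain p q where "p \<noteq> q" "e i = open_segment p q" using i(2) by (rule bounded_edge_segmentE)
    then show ?thesis using edge_ends_bounded[of p q] i(2) by (intro exI[of _ p] exI[of _ q]) auto
  qed
  obtain k where k: "k < n" "e k \<in> bounded_edges P" using b ve(4) by auto
  have "n \<noteq> 1"
  proof
    assume "n = 1"
    then have "edge_ends P (e k) = {v 0}" using e(2)[OF k(1)] k(1) by simp
    moreover obtain p q where "p \<noteq> q" "edge_ends P (e k) = {embed p, embed q}" using two[OF k] by blast
    ultimately have "p \<noteq> q" "embed p = v 0" "embed q = v 0" by auto
    then show False by (metis embed_eq_iff)
  qed
  then have n2: "2 \<le> n" using ve(1) by simp
  have inj: "v i \<noteq> v j" "e i \<noteq> e j" if "i < n" "j < n" "i \<noteq> j" for i j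
    using ve(2,3) that by (auto simp: inj_on_def)
  have planar: "v i \<in> range embed" if i: "i < n" for i
  proof -
    (* j is the predecessor of i on the cycle. *)
    define j where "j = (if i = 0 then n - 1 else i - 1)"
    have j: "j < n" "Suc j mod n = i" "j \<noteq> i" using i n2 by (auto simp: j_def)
    have "v i \<in> edge_ends P (e i)" "v i \<in> edge_ends P (e j)"
      using e(2)[OF i] e(2)[OF j(1)] j(2) by simp_all
    then have "v i \<in> closed_edge P (e i)" "v i \<in> closed_edge P (e j)"
      unfolding edge_ends_def by auto
    then obtain x where "v i = embed x"
      using closed_edges_meet_in_plane[OF e(1)[OF i] e(1)[OF j(1)]] inj(2)[OF i j(1)] j(3) by metis
    then show ?thesis by blast
  qed
  define p where "p i = (SOME x. v i = embed x)" for i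
  have p: "v i = embed (p i)" if "i < n" for i
  proof -
    have "\<exists>x. v i = embed x" using planar[OF that] by blast
    then show ?thesis unfolding p_def by (rule someI_ex)
  qed
  have lt: "Suc i mod n < n" for i using ve(1) by simp
  have neq: "Suc i mod n \<noteq> i" if "i < n" for i using that n2 by (cases "Suc i = n") auto
  have seg: "e i \<in> bounded_edges P \<and> e i = side p n i" if i: "i < n" for i
  proof -
    have "embed (p i) \<in> edge_ends P (e i)" "embed (p (Suc i mod n)) \<in> edge_ends P (e i)"
      using e(2)[OF i] p[OF i] p[OF lt[of i]] by auto
    then have "p i \<in> closure (e i) - e i" "p (Suc i mod n) \<in> closure (e i) - e i"
      by (auto simp: edge_ends_def planar_closed_edge)
    moreover have "p i \<noteq> p (Suc i mod n)" using inj(1)[OF i lt] neq[OF i] p[OF i] p[OF lt[of i]] by metis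
    ultimately show ?thesis using two_ends[OF e(1)[OF i]] by blast
  qed
  have "n \<noteq> 2"
  proof
    assume n: "n = 2"
    have "e 0 = open_segment (p 0) (p 1)" "e 1 = open_segment (p 1) (p 0)"
      using seg[of 0] seg[of 1] n by (simp_all add: numeral_2_eq_2)
    then show False using inj(2)[of 0 1] n by (simp add: open_segment_commute)
  qed
  then have n3: "3 \<le> n" using n2 by simp
  have injp: "inj_on p {..<n}" using inj(1) p by (metis inj_onI lessThan_iff)
  have "\<gamma> = side p n ` {..<n}"
    using ve(4) seg by (metis (mono_tags, lifting) image_cong lessThan_iff)
  then show thesis using that[OF n3 injp] seg by metis
qed

text \<open>By the Jordan curve theorem the edges of a cycle in the plane are those with exactly one adjacent
  region inside of it; all other edges have two or none. So, modulo 2, the cycle is the sum of the boundaries of the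
  regions inside of it, and these regions are bounded.\<close>

lemma even_on_cycles:
  assumes K: "K \<subseteq> bounded_edges P" and \<gamma>: "cycle P \<gamma>"
    and even: "\<And>a. bounded (cell P {a}) \<Longrightarrow> cell P {a} \<noteq> {} \<Longrightarrow> even (card (region_edges a \<inter> K))"
  shows "even (card (\<gamma> \<inter> K))"
proof (cases "\<gamma> \<inter> K = {}")
  case False
  then have "\<gamma> \<inter> bounded_edges P \<noteq> {}" using K by blast
  then obtain n v where nv: "3 \<le> (n::nat)" "inj_on v {..<n}"
    and ev: "\<And>i. i < n \<Longrightarrow> side v n i \<in> bounded_edges P"
    and \<gamma>e: "\<gamma> = side v n ` {..<n}"
    by (rule cycle_polygonE[OF \<gamma>]) (rule that; assumption)
  let ?e = "side v n"
  let ?G = "\<Union>i<n. closed_side v n i"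
  have cle: "closed_side v n i = closure (?e i)" if "i < n" for i
    using polygon_vertices_distinct[OF _ nv(2) that] nv(1) by simp
  have G: "?G = (\<Union>e\<in>\<gamma>. closure e)" unfolding \<gamma>e using cle by auto
  obtain I J where IJ: "I \<noteq> {}" "open I" "open J" "bounded I" "I \<inter> J = {}" "I \<union> J = - ?G"
    "?G \<subseteq> closure I" "?G \<subseteq> closure J"
    by (rule Jordan_polygon[OF nv ev])
  have \<gamma>edges: "\<gamma> \<subseteq> edges P" unfolding \<gamma>e using bounded_edge_is_edge[OF ev] by blast
  have Gcurve: "?G \<subseteq> planar_curve P" unfolding G planar_curve_eq using \<gamma>edges by blast
  have side: "cell P {a} \<subseteq> I \<or> cell P {a} \<subseteq> J" for a
  proof (rule connected_in_side[OF convex_connected[OF convex_cell]])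
    show "cell P {a} \<subseteq> I \<union> J" using region_off_curve Gcurve IJ(6) by blast
  qed (use IJ in auto)
  define M where "M = {a \<in> dom P. cell P {a} \<noteq> {} \<and> cell P {a} \<subseteq> I}"
  have finM: "finite M" using fin by (simp add: M_def)
  have finK: "finite K" using K finite_bounded_edges finite_subset by blast
  define N where "N e = {a \<in> M. e \<in> region_edges a}" for e
  (* The regions next to an edge lie on the same side of the cycle, unless the edge is in the cycle. *)
  have odd_iff: "odd (card (N e)) \<longleftrightarrow> e \<in> \<gamma>" if e: "e \<in> edges P" for e
  proof -
    obtain c d x where cd: "c \<noteq> d" "e = cell P {c, d}" "attained P x = {c, d}" using e by (rule edgeE)
    have xe: "x \<in> e" using cd by simp
    have adj: "x \<in> closure (cell P {c})" "x \<in> closure (cell P {d})"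
      using region_at_edge[of x c d] region_at_edge[of x d c] cd by (auto simp: insert_commute)
    then have nonempty: "cell P {c} \<noteq> {}" "cell P {d} \<noteq> {}" by (metis closure_empty empty_iff)+
    have "c \<in> dom P" "d \<in> dom P" using cd(3) attained_subset by blast+
    then have Ne: "N e = {a \<in> {c, d}. cell P {a} \<subseteq> I}"
      unfolding N_def M_def using mem_region_edges[of c d] e cd nonempty by auto
    have not_both: "\<not> (cell P {a} \<subseteq> I \<and> cell P {a} \<subseteq> J)" if "a \<in> {c, d}" for a
      using that nonempty IJ(5) by blast
    show ?thesis
    proof (cases "e \<in> \<gamma>")
      case True
      then have xG: "x \<in> ?G" unfolding G using xe closure_subset by blast
      obtain r where r: "r > 0" "\<And>y. dist y x < r \<Longrightarrow> attained P y \<subseteq> attained P x"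
        using attained_near_subset by blast
      (* Points of W near x are not on the edge, so they are in one of the two adjacent regions. *)
      have touch: "\<exists>a\<in>{c, d}. cell P {a} \<subseteq> W"
        if W: "?G \<subseteq> closure W" "W \<inter> ?G = {}" "W \<inter> Z = {}" and WZ: "\<And>a. cell P {a} \<subseteq> W \<or> cell P {a} \<subseteq> Z" for W Z
      proof -
        have "x \<in> closure W" using W(1) xG by blast
        then obtain y where y: "y \<in> W" "dist y x < r" using r(1) unfolding closure_approachable by blast
        then have "attained P y \<subseteq> {c, d}" using r(2)[of y] cd(3) by simp
        moreover have "attained P y \<noteq> {c, d}"
        proof
          assume "attained P y = {c, d}"
          then have "y \<in> e" using cd by simp
          then show False using True W(2) y(1) closure_subset unfolding G by blast
        qed
        ultimately have "attained P y = {c} \<or> attained P y = {d}" using attained_nonempty[of y] by blast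
        then obtain a where a: "a \<in> {c, d}" "attained P y = {a}" by blast
        then have "y \<in> cell P {a}" by simp
        then have "cell P {a} \<subseteq> W" using WZ[of a] y(1) W(3) by blast
        then show ?thesis using a(1) by blast
      qed
      have off: "I \<inter> ?G = {}" "J \<inter> ?G = {}" using IJ(6) by blast+
      have JI: "J \<inter> I = {}" using IJ(5) by blast
      have side': "cell P {a} \<subseteq> J \<or> cell P {a} \<subseteq> I" for a using side[of a] by (rule disj_commute[THEN iffD1])
      have "\<exists>a\<in>{c, d}. cell P {a} \<subseteq> I" by (rule touch[OF IJ(7) off(1) IJ(5) side])
      moreover have "\<exists>a\<in>{c, d}. cell P {a} \<subseteq> J" by (rule touch[OF IJ(8) off(2) JI side'])
      ultimately have "N e = {c} \<or> N e = {d}" unfolding Ne using not_both by blast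
      then show ?thesis using True by auto
    next
      case False
      then have "x \<notin> ?G" unfolding G using edge_closure_disjoint[OF e _ xe] \<gamma>edges by blast
      then have "x \<in> I \<or> x \<in> J" using IJ(6) by blast
      then have "N e = {c, d} \<or> N e = {}"
      proof
        assume x: "x \<in> I"
        have "cell P {a} \<subseteq> I" if "x \<in> closure (cell P {a})" for a
        proof -
          have "I \<inter> cell P {a} \<noteq> {}" using that x IJ(2) open_Int_closure_eq_empty by blast
          then show ?thesis using side[of a] IJ(5) by blast
        qed
        then show ?thesis unfolding Ne using adj by blast
      next
        assume x: "x \<in> J"
        have "\<not> cell P {a} \<subseteq> I" if "x \<in> closure (cell P {a})" for a
        proof -
          have "J \<inter> cell P {a} \<noteq> {}" using that x IJ(3) open_Int_closure_eq_empty by blast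
          then show ?thesis using IJ(5) by blast
        qed
        then show ?thesis unfolding Ne using adj by blast
      qed
      then show ?thesis using False cd(1) by auto
    qed
  qed
  (* Count the pairs of an edge in K and an adjacent region inside of the cycle in two ways. *)
  have "(\<Sum>a\<in>M. card {e \<in> K. e \<in> region_edges a}) = (\<Sum>e\<in>K. card (N e))"
    unfolding N_def by (rule sum_multicount_gen[OF finM finK]) simp
  moreover have "even (card {e \<in> K. e \<in> region_edges a})" if "a \<in> M" for a
  proof -
    have "{e \<in> K. e \<in> region_edges a} = region_edges a \<inter> K" by blast
    moreover have "bounded (cell P {a})" "cell P {a} \<noteq> {}"
      using that IJ(4) bounded_subset by (auto simp: M_def)
    ultimately show ?thesis using even by simp
  qed
  then have "even (\<Sum>a\<in>M. card {e \<in> K. e \<in> region_edges a})" by (rule dvd_sum)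
  ultimately have "even (card {e \<in> K. odd (card (N e))})"
    using even_sum_iff[OF finK, of "\<lambda>e. card (N e)"] by simp
  also have "{e \<in> K. odd (card (N e))} = \<gamma> \<inter> K"
    using odd_iff K bounded_edge_is_edge by blast
  finally show ?thesis .
qed simp

end


section \<open>Dividing sets and multi-bridges\<close>

lemma of_nat_bit: "(of_nat n :: bit) = of_bool (odd n)"
  using of_int_bit[of "int n"] by simp

lemma sum_bit:
  assumes "finite A"
  shows "(\<Sum>e\<in>A. g e) = (of_nat (card {e \<in> A. g e = 1}) :: bit)"
  using assms
proof (induction A)
  case (insert x A)
  have "{e \<in> insert x A. g e = 1} = (if g x = 1 then insert x {e \<in> A. g e = 1} else {e \<in> A. g e = 1})"
    by auto
  then show ?case using insert by (cases "g x") auto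
qed simp

text \<open>The three nonzero directions add up to zero, so a vanishing sum makes the three classes equally
  odd or even; their total, three times the common parity, is even only if all classes are even.\<close>

lemma even_direction_classes:
  fixes f :: "'e \<Rightarrow> bit \<times> bit"
  assumes fin: "finite A" and nz: "\<And>e. e \<in> A \<Longrightarrow> f e \<noteq> 0"
  shows "(\<Sum>e\<in>A. f e) = 0 \<and> even (card A) \<longleftrightarrow> (\<forall>w. even (card {e \<in> A. f e = w}))"
proof -
  define N where "N w = {e \<in> A. f e = w}" for w
  have finN: "finite (N w)" for w using fin by (simp add: N_def)
  have cases: "f e = (1, 0) \<or> f e = (0, 1) \<or> f e = (1, 1)" if "e \<in> A" for e
    using nz[OF that] by (cases "f e"; cases "fst (f e)"; cases "snd (f e)") (auto simp: zero_prod_def)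
  have disj: "N v \<inter> N w = {}" if "v \<noteq> w" for v w using that by (auto simp: N_def)
  have "{e \<in> A. fst (f e) = 1} = N (1, 0) \<union> N (1, 1)" using cases by (force simp: N_def)
  then have 1: "card {e \<in> A. fst (f e) = 1} = card (N (1, 0)) + card (N (1, 1))"
    using card_Un_disjoint[OF finN finN disj] by simp
  have "{e \<in> A. snd (f e) = 1} = N (0, 1) \<union> N (1, 1)" using cases by (force simp: N_def)
  then have 2: "card {e \<in> A. snd (f e) = 1} = card (N (0, 1)) + card (N (1, 1))"
    using card_Un_disjoint[OF finN finN disj] by simp
  have "A = (N (1, 0) \<union> N (0, 1)) \<union> N (1, 1)" using cases by (auto simp: N_def)
  moreover have "card ((N (1, 0) \<union> N (0, 1)) \<union> N (1, 1)) = card (N (1, 0)) + card (N (0, 1)) + card (N (1, 1))"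
    using finN disj by (subst card_Un_disjoint; (subst card_Un_disjoint)?) (auto simp: Int_Un_distrib2)
  ultimately have 3: "card A = card (N (1, 0)) + card (N (0, 1)) + card (N (1, 1))" by simp
  have "N w = {}" if "w \<noteq> (1, 0)" "w \<noteq> (0, 1)" "w \<noteq> (1, 1)" for w using cases that by (auto simp: N_def)
  then have all: "(\<forall>w. even (card (N w))) \<longleftrightarrow>
      even (card (N (1, 0))) \<and> even (card (N (0, 1))) \<and> even (card (N (1, 1)))"
    by (metis card.empty even_zero)
  have "fst (\<Sum>e\<in>A. f e) = of_nat (card (N (1, 0)) + card (N (1, 1)))"
    "snd (\<Sum>e\<in>A. f e) = of_nat (card (N (0, 1)) + card (N (1, 1)))"
    unfolding fst_sum snd_sum sum_bit[OF fin] 1 2 by simp_all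
  then have "(\<Sum>e\<in>A. f e) = 0 \<longleftrightarrow> even (card (N (1, 0)) + card (N (1, 1))) \<and> even (card (N (0, 1)) + card (N (1, 1)))"
    unfolding prod_eq_iff of_nat_bit by (simp add: zero_prod_def)
  then show ?thesis using all 3 unfolding N_def[symmetric] by auto
qed

lemma even_card_sym_diff:
  assumes "finite A" "finite B"
  shows "even (card ((A - B) \<union> (B - A))) \<longleftrightarrow> (even (card A) \<longleftrightarrow> even (card B))"
proof -
  have "card ((A - B) \<union> (B - A)) = card (A - B) + card (B - A)"
    using assms by (intro card_Un_disjoint) auto
  moreover have "card A = card (A - B) + card (A \<inter> B)" "card B = card (B - A) + card (A \<inter> B)"
    using assms by (metis card_Diff_subset_Int card_mono finite_Int inf_le1 le_add_diff_inverse2,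
      metis Int_commute assms(2) card_Diff_subset_Int card_mono finite_Int inf_le1 le_add_diff_inverse2)
  ultimately show ?thesis by auto
qed

context nonsingular_curve
begin

lemma finite_cycle: "cycle P \<gamma> \<Longrightarrow> finite \<gamma>"
  unfolding cycle_def by (elim exE conjE) (metis finite_imageI finite_lessThan)

lemma dividing_iff:
  "dividing P T \<longleftrightarrow> T \<subseteq> bounded_edges P \<and>
     (\<forall>\<gamma>. cycle P \<gamma> \<longrightarrow> (\<forall>w. even (card {e \<in> \<gamma> \<inter> T. edge_dir e = w})))"
proof (cases "T \<subseteq> bounded_edges P")
  case True
  have "((\<Sum>e\<in>\<gamma> \<inter> T. edge_dir e) = 0 \<and> even (card (\<gamma> \<inter> T))) \<longleftrightarrow>
      (\<forall>w. even (card {e \<in> \<gamma> \<inter> T. edge_dir e = w}))" if "cycle P \<gamma>" for \<gamma>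
    using finite_cycle[OF that] True bounded_edge_is_edge edge_dir_nonzero
    by (intro even_direction_classes) auto
  then show ?thesis using True unfolding dividing_def admissible_def by blast
qed (simp add: dividing_def admissible_def)

lemma dividing_even:
  "dividing P T \<Longrightarrow> cycle P \<gamma> \<Longrightarrow> even (card {e \<in> \<gamma> \<inter> T. edge_dir e = w})"
  unfolding dividing_iff by blast

lemma dividing_common_direction:
  assumes "\<And>e. e \<in> T \<Longrightarrow> edge_dir e = w"
  shows "dividing P T \<longleftrightarrow> T \<subseteq> bounded_edges P \<and> (\<forall>\<gamma>. cycle P \<gamma> \<longrightarrow> even (card (\<gamma> \<inter> T)))"
proof -
  have "{e \<in> \<gamma> \<inter> T. edge_dir e = v} = (if v = w then \<gamma> \<inter> T else {})" for \<gamma> v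
    using assms by auto
  then have "(\<forall>v. even (card {e \<in> \<gamma> \<inter> T. edge_dir e = v})) \<longleftrightarrow> even (card (\<gamma> \<inter> T))" for \<gamma>
    by (simp del: split_paired_All)
  then show ?thesis unfolding dividing_iff by simp
qed

lemma dividing_sym_diff:
  assumes "dividing P S" "dividing P T"
  shows "dividing P ((S - T) \<union> (T - S))"
  unfolding dividing_iff
proof (intro conjI allI impI)
  fix \<gamma> w assume \<gamma>: "cycle P \<gamma>"
  let ?A = "{e \<in> \<gamma> \<inter> S. edge_dir e = w}" and ?B = "{e \<in> \<gamma> \<inter> T. edge_dir e = w}"
  have "{e \<in> \<gamma> \<inter> ((S - T) \<union> (T - S)). edge_dir e = w} = (?A - ?B) \<union> (?B - ?A)" by auto
  moreover have "even (card ?A)" "even (card ?B)" using assms \<gamma> by (blast intro: dividing_even)+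
  ultimately show "even (card {e \<in> \<gamma> \<inter> ((S - T) \<union> (T - S)). edge_dir e = w})"
    using even_card_sym_diff[of ?A ?B] finite_cycle[OF \<gamma>] by simp
qed (use assms in \<open>auto simp: dividing_iff\<close>)

lemma dividing_empty: "dividing P {}"
  by (simp add: dividing_iff)

lemma multi_bridge_nonempty: "multi_bridge P B \<Longrightarrow> B \<noteq> {}"
  using connected_curve by (auto simp: multi_bridge_def remove_edges_def)

text \<open>All edges of a direction class of a dividing set together form a cut. A smallest disconnecting
  subset of the class is a multi-bridge.\<close>

lemma dividing_contains_multi_bridge:
  assumes T: "dividing P T" "T \<noteq> {}"
  obtains B where "B \<subseteq> T" "multi_bridge P B"
proof -
  obtain e0 where e0: "e0 \<in> T" using T by blast
  define S where "S = {e \<in> T. edge_dir e = edge_dir e0}"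
  have S: "S \<subseteq> bounded_edges P" "S \<noteq> {}" using T e0 by (auto simp: S_def dividing_iff)
  have "even (card (\<gamma> \<inter> S))" if "cycle P \<gamma>" for \<gamma>
  proof -
    have "\<gamma> \<inter> S = {e \<in> \<gamma> \<inter> T. edge_dir e = edge_dir e0}" by (auto simp: S_def)
    then show ?thesis using dividing_even[OF T(1) that] by simp
  qed
  then have disc: "\<not> connectedin X (remove_edges P S)" using even_set_disconnects[OF S] by blast
  have "finite S" using S finite_bounded_edges finite_subset by blast
  (* A disconnecting subset of least size is minimal under inclusion. *)
  define Q where "Q B \<longleftrightarrow> B \<subseteq> S \<and> \<not> connectedin X (remove_edges P B)" for B
  have "Q S" using disc by (simp add: Q_def)
  then obtain B where B: "Q B" "\<And>B'. Q B' \<Longrightarrow> card B \<le> card B'" using ex_has_least_nat[of Q S card] by blast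
  have BS: "B \<subseteq> S" "\<not> connectedin X (remove_edges P B)" using B(1) by (auto simp: Q_def)
  have min: "connectedin X (remove_edges P B')" if "B' \<subset> B" for B'
  proof (rule ccontr)
    assume "\<not> ?thesis"
    then have "card B \<le> card B'" using B(2)[of B'] that BS(1) by (auto simp: Q_def)
    moreover have "finite B" using BS(1) \<open>finite S\<close> finite_subset by blast
    ultimately show False using psubset_card_mono[OF _ that] by simp
  qed
  have Bb: "B \<subseteq> bounded_edges P" using BS S by blast
  have dir: "edge_dir e = edge_dir e0" if "e \<in> B" for e using that BS by (auto simp: S_def)
  have "dividing P B"
    using dividing_common_direction[OF dir] Bb minimal_disconnecting_even[OF Bb BS(2) min] by blast
  then have "multi_bridge P B" unfolding multi_bridge_def using dir BS(2) min by blast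
  then show thesis using that BS(1) by (auto simp: S_def)
qed

lemma set_vec_sym_diff: "set_vec S + set_vec T = set_vec ((S - T) \<union> (T - S))"
  by (auto simp: set_vec_def indicator_def fun_eq_iff plus_fun_def)

lemma set_vec_empty: "set_vec {} = 0"
  by (simp add: set_vec_def fun_eq_iff)

lemma subspace_Div: "F2.subspace (Div P)"
  unfolding F2.subspace_def
proof (intro conjI ballI allI)
  show zero: "0 \<in> Div P" unfolding Div_def set_vec_empty[symmetric] using dividing_empty by blast
  fix f assume f: "f \<in> Div P"
  show "f + g \<in> Div P" if "g \<in> Div P" for g
    using f that dividing_sym_diff unfolding Div_def by (auto simp: set_vec_sym_diff)
  show "scale2 c f \<in> Div P" for c
  proof (cases "c = 0")
    case True
    then have "scale2 c f = 0" by (simp add: scale2_def fun_eq_iff)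
    then show ?thesis by (simp only: zero)
  next
    case False
    then have "scale2 c f = f" using F2.scale_one[of f] by (simp only: bit_not_zero_iff)
    then show ?thesis using f by simp
  qed
qed

text \<open>Remove multi-bridges one at a time; what remains is dividing.\<close>

lemma dividing_in_span: "dividing P T \<Longrightarrow> set_vec T \<in> F2.span (multi_bridges P)"
proof (induction "card T" arbitrary: T rule: less_induct)
  case less
  show ?case
  proof (cases "T = {}")
    case True
    then show ?thesis by (simp add: set_vec_empty F2.span_zero)
  next
    case False
    obtain B where B: "B \<subseteq> T" "multi_bridge P B" using dividing_contains_multi_bridge[OF less.prems False] .
    have "T \<subseteq> bounded_edges P" using less.prems by (simp add: dividing_iff)
    then have finT: "finite T" using finite_bounded_edges finite_subset by blast
    have "dividing P (T - B)"
      using dividing_sym_diff[OF less.prems, of B] B by (simp add: multi_bridge_def Diff_eq_empty_iff[THEN iffD2])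
    moreover have "card (T - B) < card T"
      using B(1) multi_bridge_nonempty[OF B(2)] finT by (intro psubset_card_mono) auto
    ultimately have "set_vec (T - B) \<in> F2.span (multi_bridges P)" using less.hyps by blast
    moreover have "set_vec B \<in> F2.span (multi_bridges P)"
      using B(2) by (intro F2.span_base) (auto simp: multi_bridges_def)
    ultimately have "set_vec B + set_vec (T - B) \<in> F2.span (multi_bridges P)" by (rule F2.span_add[rotated])
    moreover have "(B - (T - B)) \<union> ((T - B) - B) = T" using B(1) by blast
    ultimately show ?thesis by (simp add: set_vec_sym_diff)
  qed
qed

lemma span_multi_bridges: "F2.span (multi_bridges P) = Div P"
proof
  show "F2.span (multi_bridges P) \<subseteq> Div P"
    by (intro F2.span_minimal subspace_Div) (auto simp: multi_bridges_def Div_def multi_bridge_def)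
  show "Div P \<subseteq> F2.span (multi_bridges P)"
    using dividing_in_span by (auto simp: Div_def)
qed

text \<open>Every primitive cycle that meets \<open>B\<close> contains exactly two edges of the direction of \<open>B\<close>, and both of
  them belong to \<open>B\<close>. The same holds for \<open>B'\<close>, so the intersection meets the boundaries of
  bounded regions in none or two edges. Then it meets all cycles evenly and disconnects the curve, and
  minimality applies to both multi-bridges.\<close>

lemma multi_bridges_disjoint:
  assumes two: "\<And>\<gamma> w. primitive_cycle P \<gamma> \<Longrightarrow> card {e \<in> \<gamma>. edge_dir e = w} \<le> 2"
    and B: "multi_bridge P B" "multi_bridge P B'" and meet: "B \<inter> B' \<noteq> {}"
  shows "B = B'"
proof -
  obtain e0 where e0: "e0 \<in> B" "e0 \<in> B'" using meet by blast
  have dir: "edge_dir e = edge_dir e0" if "e \<in> B \<or> e \<in> B'" for e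
    using that B e0 unfolding multi_bridge_def by metis
  have sub: "B \<subseteq> bounded_edges P" "B' \<subseteq> bounded_edges P"
    using B by (auto simp: multi_bridge_def dividing_iff)
  have evenB: "even (card (\<gamma> \<inter> B))" "even (card (\<gamma> \<inter> B'))" if "cycle P \<gamma>" for \<gamma>
    using B that by (auto simp: multi_bridge_def dividing_def)
  have "even (card (\<gamma> \<inter> (B \<inter> B')))" if \<gamma>: "cycle P \<gamma>" for \<gamma>
  proof (rule even_on_cycles[OF _ \<gamma>])
    fix a assume "bounded (cell P {a})" "cell P {a} \<noteq> {}"
    then have prim: "primitive_cycle P (region_edges a)" by (rule region_boundary_primitive)
    then have cyc: "cycle P (region_edges a)" by (simp add: primitive_cycle_def)
    define D where "D = {e \<in> region_edges a. edge_dir e = edge_dir e0}"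
    have D: "card D \<le> 2" "finite D" using two[OF prim] finite_cycle[OF cyc] by (auto simp: D_def)
    have all_or_none: "region_edges a \<inter> C = {} \<or> (region_edges a \<inter> C = D \<and> card D = 2)"
      if C: "even (card (region_edges a \<inter> C))" "\<And>e. e \<in> C \<Longrightarrow> edge_dir e = edge_dir e0" for C
    proof -
      have CD: "region_edges a \<inter> C \<subseteq> D" using C(2) by (auto simp: D_def)
      then have le: "card (region_edges a \<inter> C) \<le> card D" using D(2) card_mono by blast
      have fin: "finite (region_edges a \<inter> C)" using CD D(2) finite_subset by blast
      show ?thesis
      proof (cases "card (region_edges a \<inter> C) = 0")
        case True then show ?thesis using fin by simp
      next
        case False
        moreover have "card (region_edges a \<inter> C) \<noteq> 1" using C(1) by auto
        ultimately have "card (region_edges a \<inter> C) = 2" "card D = 2" using le D(1) by linarith+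
        then show ?thesis using card_subset_eq[OF D(2) CD] by simp
      qed
    qed
    have "region_edges a \<inter> B = {} \<or> (region_edges a \<inter> B = D \<and> card D = 2)"
      "region_edges a \<inter> B' = {} \<or> (region_edges a \<inter> B' = D \<and> card D = 2)"
      using all_or_none evenB[OF cyc] dir by blast+
    moreover have "region_edges a \<inter> (B \<inter> B') = (region_edges a \<inter> B) \<inter> (region_edges a \<inter> B')" by blast
    ultimately show "even (card (region_edges a \<inter> (B \<inter> B')))" by auto
  qed (use sub in blast)
  then have disc: "\<not> connectedin X (remove_edges P (B \<inter> B'))"
    using sub meet by (intro even_set_disconnects) auto
  have "\<not> B \<inter> B' \<subset> B" "\<not> B \<inter> B' \<subset> B'" using B disc unfolding multi_bridge_def by blast+
  then show ?thesis by blast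
qed

text \<open>An edge of a multi-bridge lies in no other one, so the coordinate of this edge vanishes on the span
  of the others.\<close>

lemma independent_multi_bridges:
  assumes two: "\<And>\<gamma> w. primitive_cycle P \<gamma> \<Longrightarrow> card {e \<in> \<gamma>. edge_dir e = w} \<le> 2"
  shows "F2.independent (multi_bridges P)"
  unfolding F2.dependent_def
proof
  assume "\<exists>f\<in>multi_bridges P. f \<in> F2.span (multi_bridges P - {f})"
  then obtain B where B: "multi_bridge P B" "set_vec B \<in> F2.span (multi_bridges P - {set_vec B})"
    by (auto simp: multi_bridges_def)
  obtain e where e: "e \<in> B" using multi_bridge_nonempty[OF B(1)] by blast
  have "F2.subspace {f :: plane set \<Rightarrow> bit. f e = 0}"
    by (auto simp: F2.subspace_def scale2_def)
  moreover have "multi_bridges P - {set_vec B} \<subseteq> {f. f e = 0}"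
  proof
    fix f assume f: "f \<in> multi_bridges P - {set_vec B}"
    then obtain B' where B': "multi_bridge P B'" "f = set_vec B'" "B' \<noteq> B" by (auto simp: multi_bridges_def)
    then have "e \<notin> B'" using multi_bridges_disjoint[OF two B(1) B'(1)] e by blast
    then show "f \<in> {f. f e = 0}" using B'(2) by (simp add: set_vec_def)
  qed
  ultimately have "F2.span (multi_bridges P - {set_vec B}) \<subseteq> {f. f e = 0}" by (rule F2.span_minimal[rotated])
  then have "set_vec B e = 0" using B(2) by blast
  then show False using e by (simp add: set_vec_def)
qed

end

section \<open>The Newton polygon is two-dimensional\<close>

lemma lattice_basis_cross:
  assumes "lattice = {of_int k *\<^sub>R b + of_int l *\<^sub>R c | k l :: int. True}"
  shows "cross b c \<noteq> 0"
proof
  assume 0: "cross b c = 0"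
  have "(1, 0) \<in> lattice" "(0, 1) \<in> lattice"
    unfolding lattice_def
    by (intro CollectI exI[of _ "1::int"] exI[of _ "0::int"], simp,
        intro CollectI exI[of _ "0::int"] exI[of _ "1::int"], simp)
  then obtain k l k' l' :: int where e: "(1, 0) = of_int k *\<^sub>R b + of_int l *\<^sub>R c"
    "(0, 1) = of_int k' *\<^sub>R b + of_int l' *\<^sub>R c" unfolding assms by blast
  have "cross (of_int k *\<^sub>R b + of_int l *\<^sub>R c) (of_int k' *\<^sub>R b + of_int l' *\<^sub>R c) =
      (of_int k * of_int l' - of_int l * of_int k') * cross b c"
    by (simp add: cross_def algebra_simps)
  then have "cross (1, 0) (0, 1) = 0" unfolding e[symmetric] using 0 by simp
  then show False by (simp add: cross_def)
qed

text \<open>Some linear functional is positive on both vectors of the basis, hence on all nonzero points of the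
  cone.\<close>

lemma unimodular_cone_pointed:
  assumes basis: "lattice = {of_int k *\<^sub>R b + of_int l *\<^sub>R c | k l :: int. True}"
    and S: "S \<subseteq> {b, c}" and d: "d \<in> convex_cone hull S" "- d \<in> convex_cone hull S"
  shows "d = 0"
proof -
  obtain f where f: "1 \<le> b \<bullet> f" "1 \<le> c \<bullet> f"
    using half_planes_meet[OF lattice_basis_cross[OF basis], of 1 1] by blast
  let ?C = "{v. v = 0 \<or> 0 < v \<bullet> f}"
  have "convex_cone ?C"
    unfolding convex_cone_iff by (auto simp: inner_add_left add_pos_pos zero_less_mult_iff order_le_less)
  moreover have "S \<subseteq> ?C" using S f by auto
  ultimately have "convex_cone hull S \<subseteq> ?C" by (rule hull_minimal[rotated])
  then have "d = 0 \<or> 0 < d \<bullet> f" "- d = 0 \<or> 0 < - d \<bullet> f" using d by blast+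
  then show ?thesis by auto
qed

text \<open>If a functional \<open>d\<close> were constant on the exponents, then the normal cone of the whole Newton polygon
  would contain \<open>d\<close> and \<open>- d\<close>, but unimodular cones contain no line.\<close>

lemma nonsingular_curveI:
  fixes P :: tpoly
  assumes fin: "finite (dom P)" and complete: "complete_fan (fan_of P)"
    and unimodular: "unimodular_fan (fan_of P)" and nonsing: "nonsingular P"
  shows "nonsingular_curve P"
proof
  show "finite (dom P)" "nonsingular P" by fact+
  show ne: "dom P \<noteq> {}"
  proof
    assume "dom P = {}"
    then have "newton_polygon P = {}" by (simp add: newton_polygon_def)
    then have "fan_of P = {}" by (auto simp: fan_of_def dual_fan_def)
    then show False using complete by (simp add: complete_fan_def)
  qed
  fix d :: plane and a assume d: "d \<noteq> 0" and a: "a \<in> dom P"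
  show "\<exists>k\<in>dom P. d \<bullet> (pt k - pt a) \<noteq> 0"
  proof (rule ccontr)
    assume "\<not> ?thesis"
    then have "pt ` dom P \<subseteq> {x. d \<bullet> x = d \<bullet> pt a}" by (auto simp: inner_diff_right)
    then have const: "newton_polygon P \<subseteq> {x. d \<bullet> x = d \<bullet> pt a}"
      unfolding newton_polygon_def by (intro hull_minimal convex_hyperplane)
    let ?\<sigma> = "normal_cone (newton_polygon P) (newton_polygon P)"
    have "newton_polygon P face_of newton_polygon P" "newton_polygon P \<noteq> {}"
      using ne by (simp_all add: newton_polygon_def face_of_refl)
    then have "?\<sigma> \<in> fan_of P" unfolding fan_of_def dual_fan_def by blast
    then have "\<exists>b c. lattice = {of_int k *\<^sub>R b + of_int l *\<^sub>R c | k l :: int. True} \<and>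
        (\<exists>S \<subseteq> {b, c}. ?\<sigma> = convex_cone hull S)"
      using unimodular unfolding unimodular_fan_def by (rule bspec[rotated])
    then obtain b c S where basis: "lattice = {of_int k *\<^sub>R b + of_int l *\<^sub>R c | k l :: int. True}"
      and S: "S \<subseteq> {b, c}" "?\<sigma> = convex_cone hull S"
      by (elim exE conjE)
    have "d \<bullet> x = d \<bullet> pt a" if "x \<in> newton_polygon P" for x using const that by blast
    then have "d \<in> ?\<sigma>" "- d \<in> ?\<sigma>" by (simp_all add: normal_cone_def)
    then show False using unimodular_cone_pointed[OF basis S(1)] d unfolding S(2) by blast
  qed
qed

theorem proposition5p2:
  fixes P :: tpoly
  assumes "finite (dom P)"
    and "complete_fan (fan_of P)" and "unimodular_fan (fan_of P)"
    and "nonsingular P"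
  shows "F2.span (multi_bridges P) = Div P \<and>
    ((\<forall>\<gamma>. primitive_cycle P \<gamma> \<longrightarrow> (\<forall>w. card {e \<in> \<gamma>. edge_dir e = w} \<le> 2)) \<longrightarrow>
       F2.independent (multi_bridges P) \<and> F2.span (multi_bridges P) = Div P)"
proof -
  interpret nonsingular_curve P using assms by (rule nonsingular_curveI)
  show ?thesis using span_multi_bridges independent_multi_bridges by blast
qed

end
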